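(* Let $Q$ be the set of primes $q$ with $q\equiv 1\pmod 4$, and for $q\in Q$ let $P_q$ be the Paley graph of order $q$, with chromatic polynomial $$\chi_{P_q}(n)=\sum_{r=0}^{\infty}c_r(q)n^{q-r},\qquad c_r(q)=0\ \text{ for } r>q.$$ Then $\{\chi_{P_q}(n)\}_{q\in Q}$ is a two-level polynomial over $Q$ of degree function $q$ whose maximal constant depth is two. That is: there exist polynomials $\varphi_0,\varphi_1,\varphi_2$ such that $c_r(q)=\varphi_r(q)$ for all $q\in Q$ and $r\in\{0,1,2\}$, but there is no polynomial $\varphi_3$ such that $c_3(q)=\varphi_3(q)$ for all sufficiently large $q\in Q$.
   Context: For a prime $q\equiv 1\pmod 4$, the Paley graph $P_q$ is the graph with vertex set $\mathbb Z/q\mathbb Z$ in which two distinct vertices $x,y$ are adjacent if $x-y$ is a quadratic residue modulo $q$. The chromatic polynomial $\chi_G$ of a graph $G$ is the unique polynomial such that for each natural number $n$, $\chi_G(n)$ is the number of proper $n$-colorings of $G$. Two-level polynomial over $Q$: let $Q\subseteq\mathbb N$ be infinite, let $g\in\mathbb Q[q]$ take nonnegative integer values on $Q$, and let $e:Q\to\mathbb N\cup\{-1,\infty\}$. A family of polynomials $(f_q(n))_{q\in Q}$ is a two-level polynomial over $Q$ of degree function $g$ and depth function $e$ if $f_q(n)$ has degree $g(q)$ for each $q\in Q$ and, writing $f_q(n)=\sum_{r=0}^{\infty}c_r(q)n^{g(q)-r}$ with $c_r(q)=0$ for $r>g(q)$, there exist polynomials $\{\varphi_r(q)\}_{r\ge0}$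 such that $c_r(q)=\varphi_r(q)$ for every $q\in Q$ and every $r\le e(q)$. *)

theory Defs
  imports
    "HOL-Library.FuncSet"
    "HOL-Library.Extended_Real"
    "HOL-Computational_Algebra.Computational_Algebra"
    "HOL-Number_Theory.Number_Theory"
begin

definition proper_colorings :: "'a set \<Rightarrow> ('a \<Rightarrow> 'a \<Rightarrow> bool) \<Rightarrow> nat \<Rightarrow> ('a \<Rightarrow> nat) set" where
  "proper_colorings V adj n =
     {c \<in> V \<rightarrow>\<^sub>E {..<n}. \<forall>x\<in>V. \<forall>y\<in>V. adj x y \<longrightarrow> c x \<noteq> c y}"

definition chromatic_polynomial :: "'a set \<Rightarrow> ('a \<Rightarrow> 'a \<Rightarrow> bool) \<Rightarrow> rat poly" where
  "chromatic_polynomial V adj =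
     (THE p. \<forall>n. poly p (of_nat n) = of_nat (card (proper_colorings V adj n)))"

text \<open>The vertex set \<open>\<int>/q\<int>\<close> is represented by the residues \<open>0, \<dots>, q - 1\<close>. The library's
  \<^const>\<open>QuadRes\<close> also counts \<open>0\<close> as a square; here the residue of \<open>x - y\<close> is nonzero
  because \<open>x\<close> and \<open>y\<close> are distinct.\<close>

definition paley_vertices :: "nat \<Rightarrow> int set" where
  "paley_vertices q = {0..<int q}"

definition paley_adj :: "nat \<Rightarrow> int \<Rightarrow> int \<Rightarrow> bool" where
  "paley_adj q x y \<longleftrightarrow> x \<noteq> y \<and> QuadRes (int q) (x - y)"

definition paley_chromatic :: "nat \<Rightarrow> rat poly" where
  "paley_chromatic q = chromatic_polynomial (paley_vertices q) (paley_adj q)"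

definition paley_orders :: "nat set" where
  "paley_orders = {q. prime q \<and> [q = 1] (mod 4)}"

text \<open>The coefficient \<open>c\<^sub>r\<close> in \<open>p(n) = \<Sum>\<^sub>r c\<^sub>r n\<^bsup>d-r\<^esup>\<close>, with \<open>c\<^sub>r = 0\<close> for \<open>r > d\<close>.
  The case distinction is needed because subtraction on \<^typ>\<open>nat\<close> truncates.\<close>

definition desc_coeff :: "nat \<Rightarrow> rat poly \<Rightarrow> nat \<Rightarrow> rat" where
  "desc_coeff d p r = (if r \<le> d then Polynomial.coeff p (d - r) else 0)"

text \<open>Values of the depth function lie in \<open>\<nat> \<union> {-1, \<infinity>}\<close>, embedded in \<^typ>\<open>ereal\<close>. The
  condition \<open>f q \<noteq> 0\<close> is there because the library gives the zero polynomial degree \<open>0\<close>.\<close>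

definition two_level_polynomial ::
    "nat set \<Rightarrow> rat poly \<Rightarrow> (nat \<Rightarrow> ereal) \<Rightarrow> (nat \<Rightarrow> rat poly) \<Rightarrow> bool" where
  "two_level_polynomial Q g e f \<longleftrightarrow>
     infinite Q \<and>
     (\<forall>q\<in>Q. poly g (of_nat q) \<in> \<nat>) \<and>
     (\<forall>q\<in>Q. e q \<in> range (\<lambda>k::nat. ereal (real k)) \<union> {-1, \<infinity>}) \<and>
     (\<forall>q\<in>Q. f q \<noteq> 0 \<and> of_nat (Polynomial.degree (f q)) = poly g (of_nat q)) \<and>
     (\<exists>\<phi> :: nat \<Rightarrow> rat poly. \<forall>q\<in>Q. \<forall>r. ereal (real r) \<le> e q \<longrightarrow>
        desc_coeff (Polynomial.degree (f q)) (f q) r = poly (\<phi> r) (of_nat q))"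

end

theory Submission
  imports Defs "HOL-Library.Disjoint_Sets" "HOL-Analysis.Harmonic_Numbers"
begin

text \<open>
  Sorting colourings by their kernels writes the chromatic polynomial as a sum of falling factorials
  over the partitions of the vertex set into independent sets, so \<open>c\<^sub>r\<close> depends only on the numbers of
  such partitions with at least \<open>q - r\<close> blocks. Since the complement of \<open>P\<^sub>q\<close> is strongly regular, the
  only ingredient up to \<open>r = 3\<close> that is not a polynomial in \<open>q\<close> is the number of independent
  \<open>4\<close>-sets. It is a polynomial in \<open>q\<close> plus \<open>q (q - 1) X\<^sup>2 / 1536\<close>, where \<open>X\<close> is the Jacobsthal sum
  \<open>\<phi> 1\<close> with \<open>\<phi> t = \<Sum>\<^sub>s \<eta> s \<cdot> \<eta> (s\<^sup>2 t - 1)\<close>; moreover \<open>X\<^sup>2 + Y\<^sup>2 = 4 q\<close> with \<open>Y = \<phi> g\<close> for a nonresidue \<open>g\<close>.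

  If \<open>c\<^sub>3\<close> were a polynomial in \<open>q\<close> for large \<open>q\<close>, then \<open>q (q - 1) X\<^sup>2\<close> would be one too, so each value of
  \<open>X\<^sup>2\<close> would be taken boundedly often or \<open>X\<^sup>2\<close> would be eventually constant; in the latter case \<open>q\<close> is
  determined by \<open>Y\<^sup>2\<close>. As \<open>X\<^sup>2, Y\<^sup>2 \<le> 4 q\<close>, either way \<open>\<Sum> 1 / q\<close> over the primes \<open>q \<equiv> 1 (mod 4)\<close> would
  converge, which it does not.
\<close>

subsection \<open>Legendre symbol sums\<close>

text \<open>Knowing that there are infinitely many primes \<open>q\<close> = 1 mod 4 would not
  refute a polynomial third coefficient: the labels \<open>X\<close> or \<open>Y\<close> only
  confine such primes to a set with O(sqrt x) members up to x, and a set that thin, like the primes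
  of the form m^2 + 1, may well be infinite. Some density is required; divergence of the reciprocal
  sum supplies it, and it has an elementary proof because L(1, chi4) is an alternating series. In
  exchange, nothing about the distribution of \<open>X\<close> enters beyond the two-squares
  identity, which gives every \<open>q\<close> two labels of size O(sqrt q).

  The independent 4-sets are where strong regularity gives out: it fixes the size of the common
  neighbourhood of a pair but not the number of edges inside it. Counting those leads to the points
  on y^2 = x^3 - x, whose trace of Frobenius is \<open>X\<close> up to sign.\<close>

definition periodic_mod :: "int \<Rightarrow> (int \<Rightarrow> 'b) \<Rightarrow> bool" where
  "periodic_mod p f \<longleftrightarrow> (\<forall>x y. [x = y] (mod p) \<longrightarrow> f x = f y)"

lemma periodic_modI: "(\<And>x y. [x = y] (mod p) \<Longrightarrow> f x = f y) \<Longrightarrow> periodic_mod p f"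
  by (auto simp: periodic_mod_def)

lemma periodic_modD: "periodic_mod p f \<Longrightarrow> [x = y] (mod p) \<Longrightarrow> f x = f y"
  by (auto simp: periodic_mod_def)

lemma sum_affine_residues:
  fixes f :: "int \<Rightarrow> 'b::comm_monoid_add"
  assumes f: "periodic_mod p f" and u: "coprime u p" and p: "p > 0"
  shows "(\<Sum>x\<in>{0..<p}. f (u * x + v)) = (\<Sum>x\<in>{0..<p}. f x)"
proof -
  let ?g = "\<lambda>x. (u * x + v) mod p"
  have "inj_on ?g {0..<p}"
  proof (rule inj_onI)
    fix x y assume xy: "x \<in> {0..<p}" "y \<in> {0..<p}" "?g x = ?g y"
    hence "[u * x + v = u * y + v] (mod p)" by (simp add: cong_def)
    hence "[u * x = u * y] (mod p)" by (simp only: cong_add_rcancel)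
    hence "[x = y] (mod p)" using u by (simp add: cong_mult_lcancel)
    thus "x = y" using xy by (auto simp: cong_def)
  qed
  moreover have "?g ` {0..<p} \<subseteq> {0..<p}" using p by auto
  ultimately have b: "bij_betw ?g {0..<p} {0..<p}"
    by (simp add: bij_betw_def endo_inj_surj)
  have "(\<Sum>x\<in>{0..<p}. f (u * x + v)) = (\<Sum>x\<in>{0..<p}. f (?g x))"
    by (intro sum.cong periodic_modD[OF f]) (auto simp: cong_def)
  also have "\<dots> = (\<Sum>x\<in>{0..<p}. f x)"
    using sum.reindex_bij_betw[OF b] .
  finally show ?thesis .
qed

locale paley_prime =
  fixes q :: nat
  assumes prime_q: "prime q" and q_mod_4: "q mod 4 = 1"
begin

abbreviation p :: int where "p \<equiv> int q"

abbreviation R :: "int set" where "R \<equiv> {0..<p}"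

definition eta :: "int \<Rightarrow> int" where
  "eta x = Legendre x p"

lemma prime_p: "prime p" using prime_q by simp

lemma q_ge_5: "q \<ge> 5"
proof -
  have "q \<noteq> 1" using prime_q by auto
  thus ?thesis using q_mod_4 by presburger
qed

lemma eta_cong: "[x = y] (mod p) \<Longrightarrow> eta x = eta y"
proof -
  assume a: "[x = y] (mod p)"
  have "[z = x] (mod p) \<longleftrightarrow> [z = y] (mod p)" "[x = z] (mod p) \<longleftrightarrow> [y = z] (mod p)" for z
    using a by (auto simp: cong_def)
  thus ?thesis unfolding eta_def Legendre_def QuadRes_def by presburger
qed

lemma eta_values: "eta x = 0 \<or> eta x = 1 \<or> eta x = -1"
  unfolding eta_def Legendre_def by auto

lemma eta_eq_0_iff: "eta x = 0 \<longleftrightarrow> p dvd x"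
  unfolding eta_def Legendre_def by (auto simp: cong_0_iff)

lemma eta_0 [simp]: "eta 0 = 0" by (simp add: eta_eq_0_iff)

lemma dvd_R: "x \<in> R \<Longrightarrow> p dvd x \<longleftrightarrow> x = 0"
  by (auto dest: zdvd_imp_le)

text \<open>Two integers in {-1, 0, 1} differ by at most 2 < \<open>p\<close>, so a congruence
  between them is an equality. This turns Euler's criterion, which holds modulo \<open>p\<close>,
  into identities such as \<open>eta_mult\<close>.\<close>

lemma eta_cong_int: "[eta x = y] (mod p) \<Longrightarrow> \<bar>y\<bar> \<le> 1 \<Longrightarrow> eta x = y"
proof -
  assume a: "[eta x = y] (mod p)" "\<bar>y\<bar> \<le> 1"
  hence "p dvd eta x - y" by (simp add: cong_iff_dvd_diff)
  moreover have "\<bar>eta x - y\<bar> < p" using eta_values[of x] a q_ge_5 by auto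
  ultimately have "eta x - y = 0" using dvd_imp_le_int[of "eta x - y" p] by linarith
  thus ?thesis by simp
qed

lemma eta_euler: "[eta x = x ^ ((q - 1) div 2)] (mod p)"
  unfolding eta_def using euler_criterion prime_q q_ge_5 by auto

lemma eta_mult: "eta (x * y) = eta x * eta y"
proof (rule eta_cong_int)
  have "[eta (x * y) = (x * y) ^ ((q - 1) div 2)] (mod p)" by (rule eta_euler)
  moreover have "[eta x * eta y = x ^ ((q - 1) div 2) * y ^ ((q - 1) div 2)] (mod p)"
    by (intro cong_mult eta_euler)
  ultimately show "[eta (x * y) = eta x * eta y] (mod p)"
    by (metis cong_sym cong_trans power_mult_distrib)
  show "\<bar>eta x * eta y\<bar> \<le> 1" using eta_values[of x] eta_values[of y] by auto
qed

lemma eta_1 [simp]: "eta 1 = 1"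
proof -
  have "\<not> p dvd 1" using q_ge_5 by auto
  moreover have "eta 1 = eta 1 * eta 1" using eta_mult[of 1 1] by simp
  ultimately show ?thesis using eta_eq_0_iff[of 1] by simp
qed

lemma eta_square: "\<not> p dvd x \<Longrightarrow> eta x * eta x = 1"
  using eta_values[of x] eta_eq_0_iff[of x] by auto

lemma eta_uminus_1 [simp]: "eta (- 1) = 1"
proof (rule eta_cong_int)
  obtain k where k: "q = 4 * k + 1" using q_mod_4 by (metis div_mult_mod_eq mult.commute)
  have "(-1::int) ^ ((q - 1) div 2) = 1" unfolding k by simp
  thus "[eta (-1) = 1] (mod p)" using eta_euler[of "-1"] by simp
qed simp

lemma eta_uminus [simp]: "eta (- x) = eta x"
  using eta_mult[of "-1" x] by simp

lemma eta_diff_commute: "eta (x - y) = eta (y - x)"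
  using eta_uminus[of "x - y"] by simp

lemma not_dvd_coprime: "\<not> p dvd u \<Longrightarrow> coprime u p"
  using prime_p by (metis coprime_commute prime_imp_coprime)

lemma sum_affine:
  fixes f :: "int \<Rightarrow> 'b::comm_monoid_add"
  assumes "periodic_mod p f" "\<not> p dvd u"
  shows "(\<Sum>x\<in>R. f (u * x + v)) = (\<Sum>x\<in>R. f x)"
  using sum_affine_residues[OF assms(1) not_dvd_coprime[OF assms(2)]] q_ge_5 by simp

lemma sum_scale:
  fixes f :: "int \<Rightarrow> 'b::comm_monoid_add"
  assumes "periodic_mod p f" "\<not> p dvd u"
  shows "(\<Sum>x\<in>R. f (u * x)) = (\<Sum>x\<in>R. f x)"
  using sum_affine[OF assms, of 0] by simp

lemma sum_shift:
  fixes f :: "int \<Rightarrow> 'b::comm_monoid_add"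
  assumes "periodic_mod p f"
  shows "(\<Sum>x\<in>R. f (x + v)) = (\<Sum>x\<in>R. f x)"
proof -
  have "\<not> p dvd 1" using q_ge_5 by auto
  from sum_affine[OF assms this, of v] show ?thesis by simp
qed

lemma periodic_eta:
  assumes "\<And>x y. [x = y] (mod p) \<Longrightarrow> [e x = e y] (mod p)"
  shows "periodic_mod p (\<lambda>x. eta (e x))"
  using assms by (intro periodic_modI eta_cong)

lemma periodic_of_bool_cong:
  assumes "\<And>x y. [x = y] (mod p) \<Longrightarrow> [e x = e y] (mod p)"
  shows "periodic_mod p (\<lambda>x. of_bool [e x = c] (mod p))"
proof (rule periodic_modI)
  fix x y assume "[x = y] (mod p)"
  from assms[OF this] have "[e x = c] (mod p) \<longleftrightarrow> [e y = c] (mod p)" by (auto simp: cong_def)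
  thus "of_bool [e x = c] (mod p) = of_bool [e y = c] (mod p)" by simp
qed

lemma periodic_mult:
  "periodic_mod p f \<Longrightarrow> periodic_mod p g \<Longrightarrow> periodic_mod p (\<lambda>x. f x * g x)"
  unfolding periodic_mod_def by metis

lemma periodic_const: "periodic_mod p (\<lambda>x. c)"
  unfolding periodic_mod_def by metis

lemma periodic_sum:
  "(\<And>i. i \<in> A \<Longrightarrow> periodic_mod p (\<lambda>x. f x i)) \<Longrightarrow> periodic_mod p (\<lambda>x. \<Sum>i\<in>A. f x i)"
  unfolding periodic_mod_def by (auto intro!: sum.cong)

text \<open>Periodicity of a summand is read off its syntactic shape, so that a change of variables
  usually costs one side goal closed by \<open>intro\<close>.\<close>

lemmas periodic_intros = periodic_eta periodic_of_bool_cong periodic_mult periodic_const periodic_sum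
  cong_mult cong_add cong_diff cong_pow cong_refl

lemma sum_delta_cong:
  fixes f :: "int \<Rightarrow> int"
  assumes "periodic_mod p f"
  shows "(\<Sum>x\<in>R. of_bool [x = a] (mod p) * f x) = f a"
proof -
  have r: "a mod p \<in> R" using q_ge_5 by simp
  have "(\<Sum>x\<in>R. of_bool [x = a] (mod p) * f x) = (\<Sum>x\<in>R. if x = a mod p then f x else 0)"
    by (intro sum.cong) (auto simp: cong_def)
  also have "\<dots> = f (a mod p)" using r by simp
  also have "\<dots> = f a" by (rule periodic_modD[OF assms]) simp
  finally show ?thesis .
qed

text \<open>The right side is 1 at multiples of \<open>p\<close>, 2 at residues and 0 at
  nonresidues. The identity serves in both directions: to count roots by \<open>eta\<close>, and to
  replace \<open>eta\<close> by a sum over roots that can be interchanged with other sums.\<close>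

lemma sum_square_roots:
  "(\<Sum>x\<in>R. of_bool [x\<^sup>2 = a] (mod p)) = 1 + eta a"
proof -
  consider "p dvd a" | "eta a = 1" | "eta a = -1" using eta_values[of a] eta_eq_0_iff[of a] by auto
  thus ?thesis
  proof cases
    case 1
    have "[x\<^sup>2 = a] (mod p) \<longleftrightarrow> x = 0" if "x \<in> R" for x
    proof -
      have "[x\<^sup>2 = a] (mod p) \<longleftrightarrow> [x\<^sup>2 = 0] (mod p)" using 1 
        by (auto simp: cong_def)
      also have "\<dots> \<longleftrightarrow> p dvd x" using prime_p by (simp add: cong_0_iff prime_dvd_power_iff)
      also have "\<dots> \<longleftrightarrow> x = 0" using that by (rule dvd_R)
      finally show ?thesis .
    qed
    hence "(\<Sum>x\<in>R. of_bool [x\<^sup>2 = a] (mod p)) = (\<Sum>x\<in>R. if x = 0 then 1 else (0::int))"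
      by (intro sum.cong) auto
    thus ?thesis using 1 q_ge_5 by (simp add: eta_eq_0_iff)
  next
    case 2
    hence "\<not> p dvd a" using eta_eq_0_iff[of a] by auto
    from 2 have "QuadRes p a" unfolding eta_def Legendre_def by (auto split: if_splits)
    then obtain y where y: "[y\<^sup>2 = a] (mod p)" unfolding QuadRes_def by blast
    have ny: "\<not> p dvd y"
    proof
      assume "p dvd y"
      hence "p dvd y\<^sup>2" by (simp add: power2_eq_square)
      thus False using y \<open>\<not> p dvd a\<close> by (metis cong_dvd_iff)
    qed
    have n2: "\<not> p dvd 2" using q_ge_5 by (auto dest!: zdvd_imp_le)
    have "y mod p \<noteq> (-y) mod p"
    proof
      assume "y mod p = (-y) mod p"
      hence "p dvd y - (-y)" by (simp add: mod_eq_dvd_iff)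
      hence "p dvd 2 * y" by simp
      thus False using ny n2 prime_p by (simp add: prime_dvd_mult_iff)
    qed
    moreover have "[x\<^sup>2 = a] (mod p) \<longleftrightarrow> x = y mod p \<or> x = (-y) mod p" if "x \<in> R" for x
    proof -
      have "[x\<^sup>2 = a] (mod p) \<longleftrightarrow> [x\<^sup>2 = y\<^sup>2] (mod p)" using y by (auto simp: cong_def)
      also have "\<dots> \<longleftrightarrow> p dvd (x - y) * (x + y)"
        by (simp add: cong_iff_dvd_diff power2_eq_square algebra_simps)
      also have "\<dots> \<longleftrightarrow> p dvd (x - y) \<or> p dvd (x - (-y))"
        using prime_p by (simp add: prime_dvd_mult_iff)
      also have "\<dots> \<longleftrightarrow> x = y mod p \<or> x = (-y) mod p"
        unfolding mod_eq_dvd_iff[symmetric] using that by simp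
      finally show ?thesis .
    qed
    moreover have "y mod p \<in> R" "(-y) mod p \<in> R" using q_ge_5 by simp_all
    ultimately have "(\<Sum>x\<in>R. of_bool [x\<^sup>2 = a] (mod p)) = 
      (\<Sum>x\<in>R. (if x = y mod p then 1 else 0) + (if x = (-y) mod p then 1 else (0::int)))"
      by (intro sum.cong) auto
    also have "\<dots> = 2" using \<open>y mod p \<in> R\<close> \<open>(-y) mod p \<in> R\<close> by (simp only: sum.distrib sum.delta) simp
    finally show ?thesis using 2 by simp
  next
    case 3
    have "\<not> QuadRes p a" using 3 unfolding eta_def Legendre_def by (auto split: if_splits)
    thus ?thesis using 3 unfolding QuadRes_def by (simp add: of_bool_def)
  qed
qed

text \<open>Every \<open>x\<close> has exactly one square, so the root counts
  \<open>1 + eta a\<close> add up to \<open>p\<close> over all \<open>a\<close>.\<close>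

lemma sum_eta: "(\<Sum>x\<in>R. eta x) = 0"
proof -
  have "(\<Sum>a\<in>R. 1 + eta a) = (\<Sum>x\<in>R. \<Sum>a\<in>R. of_bool [x\<^sup>2 = a] (mod p))"
    by (subst sum.swap) (simp add: sum_square_roots)
  also have "\<dots> = (\<Sum>x\<in>R. \<Sum>a\<in>R. of_bool [a = x\<^sup>2] (mod p) * 1)"
    by (subst cong_sym_eq) simp
  also have "\<dots> = (\<Sum>x\<in>R. 1)"
    by (intro sum.cong refl sum_delta_cong periodic_const)
  finally show ?thesis by (simp add: sum.distrib)
qed

lemma sum_eta_shift: "(\<Sum>x\<in>R. eta (x - c)) = 0"
  using sum_shift[of eta "-c"] sum_eta by (simp add: periodic_modI eta_cong)

lemma sum_eta_reflect: "(\<Sum>x\<in>R. eta (c - x)) = 0"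
  using sum_eta_shift eta_diff_commute by (metis (no_types, lifting) sum.cong)

lemma sum_eta_square: "(\<Sum>x\<in>R. eta x * eta x) = p - 1"
proof -
  have "eta x * eta x = 1 - (if x = 0 then 1 else 0)" if "x \<in> R" for x
    using eta_square[of x] dvd_R[OF that] by (cases "x = 0") auto
  hence "(\<Sum>x\<in>R. eta x * eta x) = (\<Sum>x\<in>R. 1 - (if x = 0 then 1 else 0))"
    by (intro sum.cong refl)
  also have "\<dots> = p - 1" using q_ge_5 by (simp add: sum_subtractf)
  finally show ?thesis .
qed

text \<open>The sum is the same for all \<open>c \<noteq> 0\<close> by scaling, and summed over all \<open>c\<close> it vanishes.\<close>

lemma sum_eta_corr_aux:
  assumes "\<not> p dvd c"
  shows "(\<Sum>t\<in>R. eta t * eta (t + c)) = -1"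
proof -
  define F where "F c = (\<Sum>t\<in>R. eta t * eta (t + c))" for c
  have scale: "F c = F 1" if "\<not> p dvd c" for c
  proof -
    have "F c = (\<Sum>t\<in>R. eta (c * t) * eta (c * t + c))"
      unfolding F_def
      by (rule sum_scale[where f="\<lambda>t. eta t * eta (t + c)", symmetric, OF _ that])
        (intro periodic_intros)
    also have "\<dots> = (\<Sum>t\<in>R. (eta c * eta c) * (eta t * eta (t + 1)))"
    proof (intro sum.cong refl)
      fix t
      have "c * t + c = c * (t + 1)" by (simp add: algebra_simps)
      thus "eta (c * t) * eta (c * t + c) = (eta c * eta c) * (eta t * eta (t + 1))"
        by (simp add: eta_mult)
    qed
    also have "\<dots> = F 1" using eta_square[OF that] by (simp add: F_def)
    finally show ?thesis .
  qed
  have "(\<Sum>c\<in>R. F c) = (\<Sum>t\<in>R. eta t * (\<Sum>c\<in>R. eta (c + t)))"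
    unfolding F_def by (subst sum.swap) (simp add: sum_distrib_left add.commute)
  also have "\<dots> = 0"
    using sum_eta_shift[of "- t" for t] by simp
  finally have 0: "(\<Sum>c\<in>R. F c) = 0" .
  have "F 0 = p - 1" unfolding F_def using sum_eta_square by simp
  have "0 \<in> R" using q_ge_5 by simp
  have "(\<Sum>c\<in>R. F c) = F 0 + (\<Sum>c\<in>R - {0}. F c)"
    using sum.remove[of R 0 F] \<open>0 \<in> R\<close> by simp
  also have "(\<Sum>c\<in>R - {0}. F c) = (\<Sum>c\<in>R - {0}. F 1)"
    by (intro sum.cong refl scale) (use dvd_R in blast)
  also have "\<dots> = (p - 1) * F 1" using \<open>0 \<in> R\<close> q_ge_5 by (simp add: card_Diff_singleton of_nat_diff)
  finally have "p - 1 + (p - 1) * F 1 = 0" using 0 \<open>F 0 = p - 1\<close> by presburger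
  hence "(p - 1) * (F 1 + 1) = 0" by (simp only: distrib_left mult_1_right add.commute)
  hence "F 1 = -1" using q_ge_5 by auto
  thus ?thesis using scale[OF assms] by (simp add: F_def)
qed

text \<open>Near-orthogonality of the translates of \<open>eta\<close>. It yields both the codegree
  of the graph and the second moment of the Jacobsthal sums.\<close>

lemma sum_eta_corr:
  "(\<Sum>t\<in>R. eta (t - a) * eta (t - b)) = p * of_bool [a = b] (mod p) - 1"
proof (cases "[a = b] (mod p)")
  case True
  have "(\<Sum>t\<in>R. eta (t - a) * eta (t - b)) = (\<Sum>t\<in>R. eta (t - a) * eta (t - a))"
    using True by (intro sum.cong refl arg_cong2[where f="(*)"] eta_cong[of "_ - b"] cong_diff cong_refl)
      (rule cong_sym)
  also have "\<dots> = (\<Sum>t\<in>R. eta t * eta t)"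
    using sum_shift[of "\<lambda>t. eta t * eta t" "-a"] periodic_mult[of eta eta] periodic_eta[of "\<lambda>x. x"]
    by simp
  finally show ?thesis using True sum_eta_square by simp
next
  case False
  have n: "\<not> p dvd (a - b)" using False by (simp add: cong_iff_dvd_diff)
  have "(\<Sum>t\<in>R. eta t * eta (t + (a - b))) = (\<Sum>t\<in>R. eta (t - a) * eta (t - a + (a - b)))"
  proof -
    have "periodic_mod p (\<lambda>t. eta t * eta (t + (a - b)))" by (intro periodic_intros)
    from sum_shift[OF this, of "-a"] show ?thesis by simp
  qed
  also have "\<dots> = (\<Sum>t\<in>R. eta (t - a) * eta (t - b))" by simp
  finally show ?thesis using sum_eta_corr_aux[OF n] False by simp
qed

section \<open>The Legendre double sum and its reduction to Jacobsthal sums\<close>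

lemma not_dvd_2: "\<not> p dvd 2"
  using q_ge_5 by (auto dest!: zdvd_imp_le)

lemma sum_eta_const_mult: "(\<Sum>x\<in>R. \<Sum>y\<in>R. f x * eta (c * (x - y))) = 0"
proof -
  have "(\<Sum>y\<in>R. eta (x - y)) = 0" for x by (rule sum_eta_reflect)
  hence "(\<Sum>y\<in>R. f x * eta (c * (x - y))) = 0" for x
    by (simp add: eta_mult sum_distrib_left[symmetric])
  thus ?thesis by simp
qed

lemma sum_eta_const_mult': "(\<Sum>x\<in>R. \<Sum>y\<in>R. f y * eta (c * (x - y))) = 0"
proof -
  have "(\<Sum>x\<in>R. \<Sum>y\<in>R. f y * eta (c * (x - y))) = (\<Sum>x\<in>R. \<Sum>y\<in>R. f y * eta (c * (y - x)))"
    by (intro sum.cong refl) (metis eta_mult eta_diff_commute)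
  also have "\<dots> = (\<Sum>y\<in>R. \<Sum>x\<in>R. f y * eta (c * (y - x)))" by (rule sum.swap)
  also have "\<dots> = 0" by (rule sum_eta_const_mult)
  finally show ?thesis .
qed

text \<open>The one term in the expansion of \<open>common_arcs\<close> whose characters interlock,
  so that neither \<open>sum_eta\<close> nor \<open>sum_eta_corr\<close> evaluates it.\<close>

definition legendre_sum :: int where
  "legendre_sum = (\<Sum>c\<in>R. \<Sum>d\<in>R. eta (c * (1 - c)) * eta (d * (1 - d)) * eta (c - d))"

text \<open>The parameter multiplies \<open>s^2\<close> because the substitution
  \<open>r = s * t\<close> produces the sum in this form. For \<open>t = 1\<close> the summand is
  \<open>eta (s^3 - s)\<close>, so \<open>jacobsthal 1\<close> is minus the trace of Frobenius of
  y^2 = x^3 - x.\<close>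

definition jacobsthal :: "int \<Rightarrow> int" where
  "jacobsthal t = (\<Sum>s\<in>R. eta s * eta (s\<^sup>2 * t - 1))"

text \<open>With \<open>x = 2 * c - 1\<close> one has \<open>x^2 - 1 = - 4 * c * (1 - c)\<close>,
  and the factor -4 is invisible to \<open>eta\<close>. The stray \<open>eta 2\<close> comes from
  \<open>x - y = 2 * (c - d)\<close>.\<close>

lemma two_mult_legendre_sum: "eta 2 * legendre_sum = (\<Sum>x\<in>R. \<Sum>y\<in>R. eta (x\<^sup>2 - 1) * eta (y\<^sup>2 - 1) * eta (x - y))"
proof -
  have e: "eta 2 * eta 2 = 1" by (rule eta_square[OF not_dvd_2])
  have e4: "eta 4 = 1" using eta_mult[of 2 2] e by simp
  have "(\<Sum>x\<in>R. \<Sum>y\<in>R. eta (x\<^sup>2 - 1) * eta (y\<^sup>2 - 1) * eta (x - y))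
      = (\<Sum>c\<in>R. \<Sum>y\<in>R. eta ((2 * c + (-1))\<^sup>2 - 1) * eta (y\<^sup>2 - 1) * eta ((2 * c + (-1)) - y))"
    by (rule sum_affine[OF _ not_dvd_2, symmetric]) (intro periodic_intros)
  also have "\<dots> = (\<Sum>c\<in>R. \<Sum>d\<in>R. eta ((2 * c + (-1))\<^sup>2 - 1) * eta ((2 * d + (-1))\<^sup>2 - 1) 
      * eta ((2 * c + (-1)) - (2 * d + (-1))))"
    by (rule sum.cong[OF refl], rule sum_affine[OF _ not_dvd_2, symmetric]) (intro periodic_intros)
  also have "\<dots> = (\<Sum>c\<in>R. \<Sum>d\<in>R. eta 2 * (eta (c * (1 - c)) * eta (d * (1 - d)) * eta (c - d)))"
  proof (intro sum.cong refl)
    fix c d :: int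
    have 1: "eta ((2 * c + (-1))\<^sup>2 - 1) = eta (c * (1 - c))" for c
    proof -
      have "(2 * c + (-1))\<^sup>2 - 1 = - (4 * (c * (1 - c)))" by (simp add: power2_eq_square algebra_simps)
      thus ?thesis by (simp add: eta_mult[of 4] e4)
    qed
    have 2: "(2 * c + (-1)) - (2 * d + (-1)) = 2 * (c - d)" by simp
    show "eta ((2 * c + (-1))\<^sup>2 - 1) * eta ((2 * d + (-1))\<^sup>2 - 1) 
      * eta ((2 * c + (-1)) - (2 * d + (-1))) = eta 2 * (eta (c * (1 - c)) * eta (d * (1 - d)) * eta (c - d))"
      unfolding 1 2 eta_mult[of 2] by simp
  qed
  also have "\<dots> = eta 2 * legendre_sum" by (simp add: legendre_sum_def sum_distrib_left)
  finally show ?thesis ..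
qed

text \<open>Root counts of \<open>r\<^sup>2 - 2 w r + 1\<close> replace the factors \<open>\<eta> (w\<^sup>2 - 1)\<close> of the double sum; each root
  \<open>r \<noteq> 0\<close> determines \<open>2 w = r + 1 / r\<close>, so that \<open>w\<close> can then be summed out.\<close>

definition root_count :: "int \<Rightarrow> int" where "root_count w = (\<Sum>r\<in>R. of_bool [2 * r * w = r\<^sup>2 + 1] (mod p))"

text \<open>Complete the square: \<open>r^2 - 2 * w * r + 1 = (r - w)^2 - (w^2 - 1)\<close>.\<close>

lemma root_count_eq: "root_count w = 1 + eta (w\<^sup>2 - 1)"
proof -
  have "root_count w = (\<Sum>r\<in>R. of_bool [(r + (- w))\<^sup>2 = w\<^sup>2 - 1] (mod p))"
    unfolding root_count_def
  proof (intro sum.cong refl arg_cong[where f=of_bool])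
    fix r
    have "2 * r * w - (r\<^sup>2 + 1) = - ((r + (- w))\<^sup>2 - (w\<^sup>2 - 1))" 
      by (simp add: power2_eq_square algebra_simps)
    thus "[2 * r * w = r\<^sup>2 + 1] (mod p) = [(r + (- w))\<^sup>2 = w\<^sup>2 - 1] (mod p)"
      unfolding cong_iff_dvd_diff by (metis dvd_minus_iff)
  qed
  also have "\<dots> = (\<Sum>r\<in>R. of_bool [r\<^sup>2 = w\<^sup>2 - 1] (mod p))"
    by (rule sum_shift) (intro periodic_intros)
  also have "\<dots> = 1 + eta (w\<^sup>2 - 1)" by (rule sum_square_roots)
  finally show ?thesis .
qed

text \<open>In the product of the two root counts, every term but
  \<open>eta (w^2 - 1) * eta (v^2 - 1)\<close> is free of \<open>w\<close> or of \<open>v\<close>,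
  and summing \<open>eta (2 * (w - v))\<close> over the free variable gives 0. The 2 under
  \<open>eta\<close> supplies a second \<open>eta 2\<close>, which cancels the one in
  \<open>two_mult_legendre_sum\<close>.\<close>

lemma legendre_sum_root_count: "legendre_sum = (\<Sum>w\<in>R. \<Sum>v\<in>R. root_count w * root_count v * eta (2 * (w - v)))"
proof -
  have e: "eta 2 * eta 2 = 1" by (rule eta_square[OF not_dvd_2])
  have "(\<Sum>w\<in>R. \<Sum>v\<in>R. root_count w * root_count v * eta (2 * (w - v))) = 
     (\<Sum>w\<in>R. \<Sum>v\<in>R. (1 + eta (w\<^sup>2 - 1)) * eta (2 * (w - v))) +
     (\<Sum>w\<in>R. \<Sum>v\<in>R. eta (v\<^sup>2 - 1) * eta (2 * (w - v))) + 
     (\<Sum>w\<in>R. \<Sum>v\<in>R. eta 2 * (eta (w\<^sup>2 - 1) * eta (v\<^sup>2 - 1) * eta (w - v)))"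
    by (simp only: sum.distrib[symmetric] root_count_eq eta_mult[of 2]) 
       (intro sum.cong refl, simp add: algebra_simps)
  also have "\<dots> = eta 2 * (eta 2 * legendre_sum)"
    by (simp only: sum_eta_const_mult sum_eta_const_mult' two_mult_legendre_sum sum_distrib_left)
  also have "\<dots> = legendre_sum" using e by (simp add: mult.assoc[symmetric])
  finally show ?thesis ..
qed

lemma sum_linear_solution:
  assumes "\<not> p dvd u"
  shows "(\<Sum>w\<in>R. of_bool [u * w = v] (mod p)) = (1::int)"
proof -
  have "(\<Sum>w\<in>R. of_bool [u * w = v] (mod p)) = (\<Sum>w\<in>R. of_bool [w = v] (mod p) :: int)"
    by (rule sum_scale[OF _ assms]) (intro periodic_intros)
  also have "\<dots> = 1" using sum_delta_cong[OF periodic_const[of 1], of v] by simp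
  finally show ?thesis .
qed

lemma root_count_nonzero: "root_count w = (\<Sum>r\<in>R - {0}. of_bool [2 * r * w = r\<^sup>2 + 1] (mod p))"
proof -
  \<comment> \<open>At \<open>r = 0\<close> the equation reads 0 = 1, so all roots are
    invertible.\<close>
  have "\<not> [2 * 0 * w = 0\<^sup>2 + 1] (mod p)" using q_ge_5 
    by (simp add: cong_def)
  moreover have "0 \<in> R" using q_ge_5 by simp
  ultimately show ?thesis unfolding root_count_def by (subst sum.remove[of R 0]) auto
qed

lemma legendre_sum_by_roots: "legendre_sum = (\<Sum>s\<in>R - {0}. \<Sum>r\<in>R. eta (r * s) * eta ((r - s) * (r * s - 1)))"
proof -
  \<comment> \<open>On the support of the indicators, \<open>2 * (w - v) = (r + 1/r) - (s + 1/s) =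
    (r - s) * (r * s - 1) / (r * s)\<close> modulo \<open>p\<close>. Under \<open>eta\<close>,
    dividing by \<open>r * s\<close> is the same as multiplying by it.\<close>
  have key: "of_bool [2 * r * w = r\<^sup>2 + 1] (mod p) * of_bool [2 * s * v = s\<^sup>2 + 1] (mod p) * eta (2 * (w - v))
    = of_bool [2 * r * w = r\<^sup>2 + 1] (mod p) * of_bool [2 * s * v = s\<^sup>2 + 1] (mod p) * 
      (eta (r * s) * eta ((r - s) * (r * s - 1)))"
    if "r \<in> R - {0}" "s \<in> R - {0}" for r s w v
  proof (cases "[2 * r * w = r\<^sup>2 + 1] (mod p) \<and> [2 * s * v = s\<^sup>2 + 1] (mod p)")
    case True
    have n: "\<not> p dvd (r * s)" using that dvd_R prime_p by (auto simp: prime_dvd_mult_iff)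
    have "eta (r * s) * eta (2 * (w - v)) = eta ((r * s) * (2 * (w - v)))" by (simp only: eta_mult)
    also have "(r * s) * (2 * (w - v)) = s * (2 * r * w) - r * (2 * s * v)" by (simp add: algebra_simps)
    also have "eta \<dots> = eta (s * (r\<^sup>2 + 1) - r * (s\<^sup>2 + 1))"
      using True by (intro eta_cong cong_diff cong_mult cong_refl) auto
    also have "s * (r\<^sup>2 + 1) - r * (s\<^sup>2 + 1) = (r - s) * (r * s - 1)" 
      by (simp add: algebra_simps power2_eq_square)
    finally have "eta (r * s) * (eta (r * s) * eta (2 * (w - v))) = eta (r * s) * eta ((r - s) * (r * s - 1))"
      by simp
    hence "eta (2 * (w - v)) = eta (r * s) * eta ((r - s) * (r * s - 1))"
      using eta_square[OF n] by (simp add: mult.assoc[symmetric])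
    thus ?thesis by simp
  qed auto
  have "legendre_sum = (\<Sum>w\<in>R. \<Sum>v\<in>R. \<Sum>r\<in>R-{0}. \<Sum>s\<in>R-{0}. of_bool [2 * r * w = r\<^sup>2 + 1] (mod p) 
     * of_bool [2 * s * v = s\<^sup>2 + 1] (mod p) * eta (2 * (w - v)))"
    unfolding legendre_sum_root_count root_count_nonzero sum_product by (simp only: sum_distrib_right)
  also have "\<dots> = (\<Sum>w\<in>R. \<Sum>r\<in>R-{0}. \<Sum>v\<in>R. \<Sum>s\<in>R-{0}. of_bool [2 * r * w = r\<^sup>2 + 1] (mod p) 
     * of_bool [2 * s * v = s\<^sup>2 + 1] (mod p) * eta (2 * (w - v)))"
    by (subst (2) sum.swap) (rule refl)
  also have "\<dots> = (\<Sum>r\<in>R-{0}. \<Sum>w\<in>R. \<Sum>s\<in>R-{0}. \<Sum>v\<in>R. of_bool [2 * r * w = r\<^sup>2 + 1] (mod p) 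
     * of_bool [2 * s * v = s\<^sup>2 + 1] (mod p) * eta (2 * (w - v)))"
    by (subst sum.swap, subst (3) sum.swap) (rule refl)
  also have "\<dots> = (\<Sum>r\<in>R-{0}. \<Sum>s\<in>R-{0}. \<Sum>w\<in>R. \<Sum>v\<in>R. of_bool [2 * r * w = r\<^sup>2 + 1] (mod p) 
     * of_bool [2 * s * v = s\<^sup>2 + 1] (mod p) * eta (2 * (w - v)))"
    by (subst (2) sum.swap) (rule refl)
  also have "\<dots> = (\<Sum>r\<in>R-{0}. \<Sum>s\<in>R-{0}. \<Sum>w\<in>R. \<Sum>v\<in>R. of_bool [2 * r * w = r\<^sup>2 + 1] (mod p) 
     * of_bool [2 * s * v = s\<^sup>2 + 1] (mod p) * (eta (r * s) * eta ((r - s) * (r * s - 1))))"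
    by (intro sum.cong refl key)
  also have "\<dots> = (\<Sum>r\<in>R-{0}. \<Sum>s\<in>R-{0}. (\<Sum>w\<in>R. of_bool [2 * r * w = r\<^sup>2 + 1] (mod p)) 
     * (\<Sum>v\<in>R. of_bool [2 * s * v = s\<^sup>2 + 1] (mod p)) * (eta (r * s) * eta ((r - s) * (r * s - 1))))"
    unfolding sum_product by (simp only: sum_distrib_right)
  also have "\<dots> = (\<Sum>r\<in>R-{0}. \<Sum>s\<in>R-{0}. eta (r * s) * eta ((r - s) * (r * s - 1)))"
  proof (intro sum.cong refl)
    fix r s assume a: "r \<in> R - {0}" "s \<in> R - {0}"
    have "\<not> p dvd 2 * r" "\<not> p dvd 2 * s"
      using a dvd_R not_dvd_2 prime_p by (auto simp: prime_dvd_mult_iff)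
    from this[THEN sum_linear_solution] 
    show "(\<Sum>w\<in>R. of_bool [2 * r * w = r\<^sup>2 + 1] (mod p)) 
     * (\<Sum>v\<in>R. of_bool [2 * s * v = s\<^sup>2 + 1] (mod p)) * (eta (r * s) * eta ((r - s) * (r * s - 1)))
     = eta (r * s) * eta ((r - s) * (r * s - 1))"
      by simp
  qed
  \<comment> \<open>The vanishing terms with \<open>r = 0\<close> are put back so that
    \<open>r\<close> runs over a full residue system and can be rescaled.\<close>
  also have "\<dots> = (\<Sum>r\<in>R. \<Sum>s\<in>R-{0}. eta (r * s) * eta ((r - s) * (r * s - 1)))"
    by (intro sum.mono_neutral_left) auto
  also have "\<dots> = (\<Sum>s\<in>R-{0}. \<Sum>r\<in>R. eta (r * s) * eta ((r - s) * (r * s - 1)))"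
    by (rule sum.swap)
  finally show ?thesis .
qed

text \<open>Substituting \<open>r = s t\<close> separates the variables.\<close>

lemma legendre_sum_jacobsthal: "legendre_sum = (\<Sum>t\<in>R. eta (t * (t - 1)) * jacobsthal t)"
proof -
  have "legendre_sum = (\<Sum>s\<in>R - {0}. \<Sum>t\<in>R. eta (t * (t - 1)) * (eta s * eta (s\<^sup>2 * t - 1)))"
    unfolding legendre_sum_by_roots
  proof (rule sum.cong[OF refl])
    fix s assume s: "s \<in> R - {0}"
    hence n: "\<not> p dvd s" using dvd_R by blast
    have "(\<Sum>r\<in>R. eta (r * s) * eta ((r - s) * (r * s - 1))) = 
          (\<Sum>t\<in>R. eta ((s * t) * s) * eta ((s * t - s) * ((s * t) * s - 1)))"
      by (rule sum_scale[OF _ n, symmetric]) (intro periodic_intros)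
    also have "\<dots> = (\<Sum>t\<in>R. eta (t * (t - 1)) * (eta s * eta (s\<^sup>2 * t - 1)))"
    proof (intro sum.cong refl)
      fix t
      have "eta ((s * t) * s) * eta ((s * t - s) * ((s * t) * s - 1)) = 
         eta ((s * s) * (s * ((t * (t - 1)) * (s\<^sup>2 * t - 1))))"
        unfolding eta_mult[symmetric] by (simp add: power2_eq_square algebra_simps)
      also have "\<dots> = eta (t * (t - 1)) * (eta s * eta (s\<^sup>2 * t - 1))"
        unfolding eta_mult[of "s * s"] eta_mult[of s] eta_mult[of "t * (t - 1)"]
        using eta_square[OF n] by simp
      finally show "eta ((s * t) * s) * eta ((s * t - s) * ((s * t) * s - 1)) = 
         eta (t * (t - 1)) * (eta s * eta (s\<^sup>2 * t - 1))" .
    qed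
    finally show "(\<Sum>r\<in>R. eta (r * s) * eta ((r - s) * (r * s - 1))) = 
      (\<Sum>t\<in>R. eta (t * (t - 1)) * (eta s * eta (s\<^sup>2 * t - 1)))" .
  qed
  also have "\<dots> = (\<Sum>s\<in>R. \<Sum>t\<in>R. eta (t * (t - 1)) * (eta s * eta (s\<^sup>2 * t - 1)))"
    by (intro sum.mono_neutral_left) auto
  also have "\<dots> = (\<Sum>t\<in>R. eta (t * (t - 1)) * jacobsthal t)"
    unfolding jacobsthal_def by (subst sum.swap) (simp add: sum_distrib_left)
  finally show ?thesis .
qed

lemma periodic_jacobsthal: "periodic_mod p jacobsthal"
  unfolding jacobsthal_def by (intro periodic_intros)

text \<open>Substitute \<open>k * s\<close> for \<open>s\<close>. Consequently
  \<open>jacobsthal\<close> takes, up to sign, one value on the nonzero squares and one on the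
  nonsquares.\<close>

lemma jacobsthal_square_mult:
  assumes "\<not> p dvd k"
  shows "jacobsthal (t * k\<^sup>2) = eta k * jacobsthal t"
proof -
  have "jacobsthal t = (\<Sum>s\<in>R. eta (k * s) * eta ((k * s)\<^sup>2 * t - 1))"
    unfolding jacobsthal_def by (rule sum_scale[OF _ assms, symmetric]) (intro periodic_intros)
  also have "\<dots> = eta k * jacobsthal (t * k\<^sup>2)"
    unfolding jacobsthal_def sum_distrib_left by (intro sum.cong refl) (simp add: eta_mult power_mult_distrib mult_ac)
  finally have "eta k * jacobsthal t = (eta k * eta k) * jacobsthal (t * k\<^sup>2)" by simp
  thus ?thesis using eta_square[OF assms] by simp
qed

lemma sum_over_squares:
  fixes F :: "int \<Rightarrow> int"
  assumes "periodic_mod p F"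
  shows "(\<Sum>k\<in>R. F (k\<^sup>2)) = (\<Sum>t\<in>R. (1 + eta t) * F t)"
proof -
  have "(\<Sum>t\<in>R. (1 + eta t) * F t) = (\<Sum>t\<in>R. \<Sum>k\<in>R. of_bool [k\<^sup>2 = t] (mod p) * F t)"
    by (simp only: sum_square_roots[symmetric] sum_distrib_right)
  also have "\<dots> = (\<Sum>k\<in>R. \<Sum>t\<in>R. of_bool [t = k\<^sup>2] (mod p) * F t)"
    by (subst sum.swap, subst cong_sym_eq) (rule refl)
  also have "\<dots> = (\<Sum>k\<in>R. F (k\<^sup>2))" by (intro sum.cong refl sum_delta_cong assms)
  finally show ?thesis ..
qed

text \<open>The families \<open>k^2\<close> and \<open>g * k^2\<close> hit \<open>t\<close> with
  multiplicities \<open>1 + eta t\<close> and \<open>1 - eta t\<close>. The point 0 lies once in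
  each, so the total weight is 2 everywhere.\<close>

lemma sum_over_squares_nonsquares:
  fixes F :: "int \<Rightarrow> int"
  assumes F: "periodic_mod p F" and g: "eta g = -1"
  shows "2 * (\<Sum>t\<in>R. F t) = (\<Sum>k\<in>R. F (k\<^sup>2)) + (\<Sum>k\<in>R. F (g * k\<^sup>2))"
proof -
  have ng: "\<not> p dvd g" using g eta_eq_0_iff[of g] by auto
  have P: "periodic_mod p (\<lambda>t. F (g * t))"
    by (rule periodic_modI) (rule periodic_modD[OF F], intro cong_mult cong_refl)
  have E: "periodic_mod p eta" by (rule periodic_modI) (rule eta_cong)
  have "(\<Sum>k\<in>R. F (g * k\<^sup>2)) = (\<Sum>t\<in>R. (1 + eta t) * F (g * t))"
    by (rule sum_over_squares[OF P])
  also have "\<dots> = (\<Sum>t\<in>R. F (g * t)) - (\<Sum>t\<in>R. eta (g * t) * F (g * t))"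
    by (simp add: eta_mult g algebra_simps sum.distrib sum_negf)
  also have "\<dots> = (\<Sum>t\<in>R. F t) - (\<Sum>t\<in>R. eta t * F t)"
    using sum_scale[OF F ng] sum_scale[OF periodic_mult[OF E F] ng] by simp
  finally show ?thesis unfolding sum_over_squares[OF F] by (simp add: algebra_simps sum.distrib)
qed

text \<open>Otherwise \<open>eta\<close> would be nonnegative with sum 0, contradicting
  \<open>eta 1 = 1\<close>.\<close>

lemma ex_nonresidue: "\<exists>g. eta g = -1"
proof (rule ccontr)
  assume "\<not> ?thesis"
  hence "eta x \<ge> 0" for x using eta_values[of x] by (metis order_refl zero_le_one)
  hence "eta 1 = 0" using sum_eta sum_nonneg_eq_0_iff[of R eta] q_ge_5 by fastforce
  thus False by simp
qed

text \<open>On \<open>t = k^2\<close> the weight \<open>eta (t * (t - 1))\<close> reduces to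
  \<open>eta (k^2 - 1)\<close> and \<open>jacobsthal t\<close> to
  \<open>eta k * jacobsthal 1\<close>, so the outer sum is a second copy of
  \<open>jacobsthal 1\<close>. On \<open>t = g * k^2\<close> the same happens with \<open>g\<close>,
  and \<open>eta g = -1\<close> gives the minus sign.\<close>

lemma two_legendre_sum: 
  assumes g: "eta g = -1"
  shows "2 * legendre_sum = (jacobsthal 1)\<^sup>2 - (jacobsthal g)\<^sup>2"
proof -
  define F where "F t = eta (t * (t - 1)) * jacobsthal t" for t
  have F: "periodic_mod p F" unfolding F_def by (intro periodic_intros periodic_jacobsthal)
  have "F (k\<^sup>2) = jacobsthal 1 * (eta k * eta (k\<^sup>2 * 1 - 1))" if "k \<in> R" for k
  proof (cases "k = 0")
    case False
    hence n: "\<not> p dvd k" using dvd_R[OF that] by simp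
    show ?thesis unfolding F_def using jacobsthal_square_mult[OF n, of 1] eta_square[OF n]
      by (simp add: eta_mult power2_eq_square)
  qed (simp add: F_def)
  hence 1: "(\<Sum>k\<in>R. F (k\<^sup>2)) = jacobsthal 1 * jacobsthal 1"
    unfolding jacobsthal_def[of 1] by (simp add: sum_distrib_left)
  have "F (g * k\<^sup>2) = - jacobsthal g * (eta k * eta (k\<^sup>2 * g - 1))" if "k \<in> R" for k
  proof (cases "k = 0")
    case False
    hence n: "\<not> p dvd k" using dvd_R[OF that] by simp
    show ?thesis unfolding F_def using jacobsthal_square_mult[OF n, of g] eta_square[OF n]
      by (simp add: eta_mult power2_eq_square g mult_ac)
  qed (simp add: F_def)
  hence 2: "(\<Sum>k\<in>R. F (g * k\<^sup>2)) = - jacobsthal g * jacobsthal g"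
    unfolding jacobsthal_def[of g] by (simp add: sum_distrib_left)
  show ?thesis
    using sum_over_squares_nonsquares[OF F g] unfolding 1 2 unfolding F_def legendre_sum_jacobsthal
    by (simp add: power2_eq_square)
qed

lemma jacobsthal_0: "jacobsthal 0 = 0"
  unfolding jacobsthal_def by (simp add: sum_eta)

text \<open>Expand the square and sum over \<open>t\<close> first. The correlation leaves
  \<open>p\<close> times the pairs with \<open>y = x\<close> or \<open>y = - x\<close>, where
  \<open>eta (x * y) = 1\<close> for nonzero \<open>x\<close>, and a term -1 whose contribution
  factors into two vanishing sums of \<open>eta\<close>.\<close>

lemma sum_jacobsthal_square: "(\<Sum>t\<in>R. (jacobsthal t)\<^sup>2) = 2 * p * (p - 1)"
proof -
  have inner: "(\<Sum>t\<in>R. eta (x\<^sup>2 * t - 1) * eta (y\<^sup>2 * t - 1)) = p * of_bool [y\<^sup>2 = x\<^sup>2] (mod p) - 1"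
    if "x \<in> R - {0}" "y \<in> R - {0}" for x y
  proof -
    have n: "\<not> p dvd x" "\<not> p dvd y" using that dvd_R by blast+
    hence nn: "\<not> p dvd x\<^sup>2 * y\<^sup>2" using prime_p by (simp add: prime_dvd_mult_iff prime_dvd_power_iff)
    \<comment> \<open>Multiplying the two arguments by the squares \<open>y^2\<close> and
      \<open>x^2\<close> gives \<open>t\<close> the same coefficient in both, and a rescaling then
      removes it.\<close>
    have "(\<Sum>t\<in>R. eta (x\<^sup>2 * t - 1) * eta (y\<^sup>2 * t - 1)) = 
          (\<Sum>t\<in>R. eta ((x\<^sup>2 * y\<^sup>2) * t - y\<^sup>2) * eta ((x\<^sup>2 * y\<^sup>2) * t - x\<^sup>2))"
    proof (intro sum.cong refl)
      fix t
      have "(x\<^sup>2 * y\<^sup>2) * t - y\<^sup>2 = y * y * (x\<^sup>2 * t - 1)" "(x\<^sup>2 * y\<^sup>2) * t - x\<^sup>2 = x * x * (y\<^sup>2 * t - 1)"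
        by (simp_all add: power2_eq_square algebra_simps)
      thus "eta (x\<^sup>2 * t - 1) * eta (y\<^sup>2 * t - 1) = 
        eta ((x\<^sup>2 * y\<^sup>2) * t - y\<^sup>2) * eta ((x\<^sup>2 * y\<^sup>2) * t - x\<^sup>2)"
        using eta_square n by (simp add: eta_mult[of "_ * _"] eta_mult[of x x] eta_mult[of y y])
    qed
    also have "\<dots> = (\<Sum>t\<in>R. eta (t - y\<^sup>2) * eta (t - x\<^sup>2))"
      by (rule sum_scale[OF _ nn]) (intro periodic_intros)
    finally show ?thesis by (simp only: sum_eta_corr)
  qed
  have "(\<Sum>t\<in>R. (jacobsthal t)\<^sup>2) = (\<Sum>t\<in>R. \<Sum>x\<in>R. \<Sum>y\<in>R. (eta x * eta (x\<^sup>2 * t - 1)) * (eta y * eta (y\<^sup>2 * t - 1)))"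
    unfolding jacobsthal_def power2_eq_square[of "sum _ _"] sum_product ..
  also have "\<dots> = (\<Sum>x\<in>R. \<Sum>t\<in>R. \<Sum>y\<in>R. (eta x * eta (x\<^sup>2 * t - 1)) * (eta y * eta (y\<^sup>2 * t - 1)))"
    by (rule sum.swap)
  also have "\<dots> = (\<Sum>x\<in>R. \<Sum>y\<in>R. \<Sum>t\<in>R. (eta x * eta (x\<^sup>2 * t - 1)) * (eta y * eta (y\<^sup>2 * t - 1)))"
    by (subst (2) sum.swap) (rule refl)
  also have "\<dots> = (\<Sum>x\<in>R. \<Sum>y\<in>R. (eta x * eta y) * (\<Sum>t\<in>R. eta (x\<^sup>2 * t - 1) * eta (y\<^sup>2 * t - 1)))"
    by (simp add: sum_distrib_left mult_ac)
  also have "\<dots> = (\<Sum>x\<in>R. \<Sum>y\<in>R. p * (of_bool [y\<^sup>2 = x\<^sup>2] (mod p) * eta (x * y)) - eta x * eta y)"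
  proof (intro sum.cong refl)
    fix x y assume xy: "x \<in> R" "y \<in> R"
    show "(eta x * eta y) * (\<Sum>t\<in>R. eta (x\<^sup>2 * t - 1) * eta (y\<^sup>2 * t - 1)) = 
      p * (of_bool [y\<^sup>2 = x\<^sup>2] (mod p) * eta (x * y)) - eta x * eta y"
    proof (cases "x = 0 \<or> y = 0")
      case False
      thus ?thesis using xy by (subst inner) (auto simp: algebra_simps eta_mult)
    qed auto
  qed
  also have "\<dots> = p * (\<Sum>x\<in>R. \<Sum>y\<in>R. of_bool [y\<^sup>2 = x\<^sup>2] (mod p) * eta (x * y)) - (\<Sum>x\<in>R. eta x) * (\<Sum>y\<in>R. eta y)"
    unfolding sum_product by (simp only: sum_distrib_left sum_subtractf)
  also have "(\<Sum>x\<in>R. \<Sum>y\<in>R. of_bool [y\<^sup>2 = x\<^sup>2] (mod p) * eta (x * y)) = (\<Sum>x\<in>R. 2 * (eta x * eta x))"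
  proof (intro sum.cong refl)
    fix x assume x: "x \<in> R"
    show "(\<Sum>y\<in>R. of_bool [y\<^sup>2 = x\<^sup>2] (mod p) * eta (x * y)) = 2 * (eta x * eta x)"
    proof (cases "x = 0")
      case False
      hence n: "\<not> p dvd x" using dvd_R[OF x] by simp
      have val: "eta (x * y) = 1" if "[y\<^sup>2 = x\<^sup>2] (mod p)" for y
      proof -
        have "p dvd (y - x) * (y + x)" using that by (simp add: cong_iff_dvd_diff power2_eq_square algebra_simps)
        hence "[y = x] (mod p) \<or> [y = -x] (mod p)" 
          using prime_p by (simp add: prime_dvd_mult_iff cong_iff_dvd_diff)
        hence "eta y = eta x" using eta_cong by (metis eta_uminus)
        thus ?thesis using eta_square[OF n] by (simp add: eta_mult)
      qed
      have "(\<Sum>y\<in>R. of_bool [y\<^sup>2 = x\<^sup>2] (mod p) * eta (x * y)) = (\<Sum>y\<in>R. of_bool [y\<^sup>2 = x\<^sup>2] (mod p))"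
        by (intro sum.cong refl) (auto simp: val)
      also have "\<dots> = 1 + eta (x * x)" by (simp only: sum_square_roots power2_eq_square[of x])
      finally show ?thesis using eta_square[OF n] by (simp add: eta_mult)
    qed auto
  qed
  also have "\<dots> = 2 * (p - 1)" by (simp only: sum_distrib_left[symmetric] sum_eta_square)
  finally show ?thesis by (simp add: sum_eta)
qed

text \<open>Jacobsthal's explicit version of the two-squares theorem. The second moment is split
  over squares and nonsquares; on each class the square of \<open>jacobsthal\<close> is constant
  away from 0.\<close>

lemma jacobsthal_squares: 
  assumes g: "eta g = -1"
  shows "(jacobsthal 1)\<^sup>2 + (jacobsthal g)\<^sup>2 = 4 * p"
proof -
  define F where "F t = (jacobsthal t)\<^sup>2" for t
  have F: "periodic_mod p F" unfolding F_def power2_eq_square by (intro periodic_intros periodic_jacobsthal)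
  have aux: "(\<Sum>k\<in>R. F (t * k\<^sup>2)) = (p - 1) * (jacobsthal t)\<^sup>2" for t
  proof -
    have "F (t * k\<^sup>2) = (jacobsthal t)\<^sup>2 * (eta k * eta k)" if "k \<in> R" for k
    proof (cases "k = 0")
      case False
      hence n: "\<not> p dvd k" using dvd_R[OF that] by simp
      show ?thesis unfolding F_def jacobsthal_square_mult[OF n] by (simp add: power2_eq_square)
    qed (simp add: F_def jacobsthal_0)
    thus ?thesis using sum_eta_square by (simp add: sum_distrib_left[symmetric])
  qed
  have "2 * (2 * p * (p - 1)) = (p - 1) * (jacobsthal 1)\<^sup>2 + (p - 1) * (jacobsthal g)\<^sup>2"
    using sum_over_squares_nonsquares[OF F g] aux[of 1] aux[of g] sum_jacobsthal_square by (simp add: F_def)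
  hence "(p - 1) * (4 * p) = (p - 1) * ((jacobsthal 1)\<^sup>2 + (jacobsthal g)\<^sup>2)" by (simp add: algebra_simps)
  thus ?thesis using q_ge_5 by simp
qed

lemma legendre_sum_eq: "legendre_sum = (jacobsthal 1)\<^sup>2 - 2 * p"
proof -
  obtain g where g: "eta g = -1" using ex_nonresidue by blast
  show ?thesis using two_legendre_sum[OF g] jacobsthal_squares[OF g] by simp
qed

section \<open>Arcs among the common neighbours of 0 and 1\<close>

definition common_ind :: "int \<Rightarrow> int" where
  "common_ind c = of_bool (eta c = 1 \<and> eta (1 - c) = 1)"

definition common_arcs :: int where
  "common_arcs = (\<Sum>c\<in>R. \<Sum>d\<in>R. common_ind c * common_ind d * of_bool (eta (c - d) = 1))"

lemma dvd_R_minus_1: "c \<in> R \<Longrightarrow> p dvd 1 - c \<longleftrightarrow> c = 1"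
proof
  assume c: "c \<in> R" "p dvd 1 - c"
  hence "\<bar>1 - c\<bar> < p" using q_ge_5 by auto
  thus "c = 1" using c(2) dvd_imp_le_int[of "1 - c" p] by force
qed simp

text \<open>The last two terms correct the expanded product \<open>(1 + \<eta> c) (1 + \<eta> (1 - c))\<close>, which is \<open>2\<close> instead
  of \<open>0\<close> at \<open>c = 0\<close> and \<open>c = 1\<close>.\<close>

lemma four_common_ind:
  assumes "c \<in> R"
  shows "4 * common_ind c = 1 + eta c + eta (1 - c) + eta (c * (1 - c)) - 2 * of_bool (c = 0) - 2 * of_bool (c = 1)"
proof -
  consider "c = 0" | "c = 1" | "c \<noteq> 0" "c \<noteq> 1" by blast
  thus ?thesis
  proof cases
    case 3
    hence "eta c \<noteq> 0" "eta (1 - c) \<noteq> 0"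
      using dvd_R[OF assms] dvd_R_minus_1[OF assms] by (auto simp: eta_eq_0_iff)
    hence "eta c = 1 \<or> eta c = -1" "eta (1 - c) = 1 \<or> eta (1 - c) = -1"
      using eta_values by blast+
    thus ?thesis using 3 unfolding common_ind_def eta_mult by auto
  qed (simp_all add: common_ind_def)
qed

lemma zero_R: "0 \<in> R" and one_R: "1 \<in> R"
  using q_ge_5 by auto

lemma sum_eta_quad: "(\<Sum>c\<in>R. eta (c * (1 - c))) = -1"
proof -
  have "(\<Sum>c\<in>R. eta (c * (1 - c))) = (\<Sum>c\<in>R. eta (c - 0) * eta (c - 1))"
    using eta_diff_commute[of _ 1] by (intro sum.cong refl) (simp add: eta_mult)
  also have "\<dots> = -1" using q_ge_5 by (subst sum_eta_corr) (simp add: cong_def)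
  finally show ?thesis .
qed

lemma sum_of_bool_R: "a \<in> R \<Longrightarrow> (\<Sum>c\<in>R. f c * of_bool (c = a)) = (f a :: int)"
proof -
  assume "a \<in> R"
  have "(\<Sum>c\<in>R. f c * of_bool (c = a)) = (\<Sum>c\<in>R. if c = a then f c else 0)"
    by (intro sum.cong) auto
  thus ?thesis using \<open>a \<in> R\<close> by simp
qed

text \<open>The weight \<open>F\<close> is kept arbitrary so that one expansion serves both for
  counting (\<open>F = 1\<close>) and for correlating with \<open>eta (d - c)\<close>.\<close>

lemma sum_four_common_ind_mult:
  "(\<Sum>c\<in>R. (4 * common_ind c) * F c) = (\<Sum>c\<in>R. F c) + (\<Sum>c\<in>R. eta c * F c) + (\<Sum>c\<in>R. eta (1 - c) * F c)
    + (\<Sum>c\<in>R. eta (c * (1 - c)) * F c) - 2 * F 0 - 2 * F 1"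
proof -
  have "(\<Sum>c\<in>R. (4 * common_ind c) * F c) = (\<Sum>c\<in>R. F c + eta c * F c + eta (1 - c) * F c + eta (c * (1 - c)) * F c
     - 2 * (F c * of_bool (c = 0)) - 2 * (F c * of_bool (c = 1)))"
    by (rule sum.cong[OF refl], simp only: four_common_ind, simp add: algebra_simps)
  also have "\<dots> = (\<Sum>c\<in>R. F c) + (\<Sum>c\<in>R. eta c * F c) + (\<Sum>c\<in>R. eta (1 - c) * F c)
    + (\<Sum>c\<in>R. eta (c * (1 - c)) * F c) - 2 * F 0 - 2 * F 1"
    by (simp only: sum.distrib sum_subtractf sum_distrib_left[symmetric] 
        sum_of_bool_R[OF zero_R] sum_of_bool_R[OF one_R])
  finally show ?thesis .
qed

lemma four_sum_common_ind: "4 * (\<Sum>c\<in>R. common_ind c) = p - 5"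
  using sum_four_common_ind_mult[of "\<lambda>_. 1"] sum_eta sum_eta_reflect[of 1] sum_eta_quad
  by (simp add: sum_distrib_left)

lemma sum_eta_mult_shift: 
  "a \<in> R \<Longrightarrow> b \<in> R \<Longrightarrow> (\<Sum>d\<in>R. eta (d - a) * eta (d - b)) = p * of_bool (b = a) - 1"
  using sum_eta_corr[of b a] by (simp add: cong_def mult.commute)

text \<open>A character that occurs twice cancels except at its zero. What is left is a full linear
  sum, which is 0, minus its value 1 at that zero.\<close>

lemma quad_eta_sums:
  "(\<Sum>c\<in>R. eta (c * (1 - c)) * eta c) = -1"
  "(\<Sum>c\<in>R. eta (c * (1 - c)) * eta (c - 1)) = -1"
proof -
  have "eta (c * (1 - c)) * eta c = eta (1 - c) - of_bool (c = 0)" if "c \<in> R" for c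
  proof (cases "c = 0")
    case False
    have "eta (c * (1 - c)) * eta c = (eta c * eta c) * eta (1 - c)"
      unfolding eta_mult by (simp only: mult_ac)
    moreover have "eta c * eta c = 1" using False dvd_R[OF that] by (intro eta_square) simp
    ultimately show ?thesis using False by simp
  qed simp
  hence "(\<Sum>c\<in>R. eta (c * (1 - c)) * eta c) = (\<Sum>c\<in>R. eta (1 - c) - 1 * of_bool (c = 0))"
    by (intro sum.cong) auto
  thus "(\<Sum>c\<in>R. eta (c * (1 - c)) * eta c) = -1"
    by (simp only: sum_subtractf sum_eta_reflect sum_of_bool_R[OF zero_R])
  have "eta (c * (1 - c)) * eta (c - 1) = eta c - of_bool (c = 1)" if "c \<in> R" for c
  proof (cases "c = 1")
    case False
    have "eta (c * (1 - c)) * eta (c - 1) = (eta (1 - c) * eta (1 - c)) * eta c"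
      unfolding eta_mult eta_diff_commute[of c 1] by (simp only: mult_ac)
    moreover have "eta (1 - c) * eta (1 - c) = 1"
      using False dvd_R_minus_1[OF that] by (intro eta_square) simp
    ultimately show ?thesis using False by simp
  qed simp
  hence "(\<Sum>c\<in>R. eta (c * (1 - c)) * eta (c - 1)) = (\<Sum>c\<in>R. eta c - 1 * of_bool (c = 1))"
    by (intro sum.cong) auto
  thus "(\<Sum>c\<in>R. eta (c * (1 - c)) * eta (c - 1)) = -1"
    by (simp only: sum_subtractf sum_eta sum_of_bool_R[OF one_R])
qed

lemma sum_common_ind_eta:
  assumes "c \<in> R"
  shows "(\<Sum>d\<in>R. (4 * common_ind d) * eta (d - c)) = 
    p * of_bool (c = 0) + p * of_bool (c = 1) - 2
    + (\<Sum>d\<in>R. eta (d * (1 - d)) * eta (d - c)) - 2 * eta c - 2 * eta (c - 1)"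
proof -
  have 1: "(\<Sum>d\<in>R. eta d * eta (d - c)) = p * of_bool (c = 0) - 1"
    using sum_eta_mult_shift[OF zero_R assms] by simp
  have 2: "(\<Sum>d\<in>R. eta (1 - d) * eta (d - c)) = p * of_bool (c = 1) - 1"
    using sum_eta_mult_shift[OF one_R assms] by (simp only: eta_diff_commute[of 1])
  have 3: "eta (0 - c) = eta c" by simp
  have 4: "eta (1 - c) = eta (c - 1)" by (rule eta_diff_commute)
  show ?thesis unfolding sum_four_common_ind_mult 1 2 sum_eta_shift 3 4 by simp
qed

lemma common_ind_mult_eta: "(4 * common_ind c) * eta c = 4 * common_ind c" "(4 * common_ind c) * eta (c - 1) = 4 * common_ind c"
  using eta_diff_commute[of c 1] by (auto simp: common_ind_def)

lemma common_ind_0_1: "common_ind 0 = 0" "common_ind 1 = 0"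
  by (auto simp: common_ind_def)

text \<open>Expand one factor: the terms with \<open>p\<close> die because \<open>common_ind\<close>
  vanishes at 0 and 1, and \<open>eta c\<close>, \<open>eta (c - 1)\<close> are 1 on its support,
  which gives -6 times the total \<open>p - 5\<close>. Expanding the other factor against the
  remaining kernel leaves \<open>legendre_sum\<close> and three sums equal to -1, each with weight
  -2, which add 6.\<close>

lemma sum_common_ind_eta_pairs: "(\<Sum>c\<in>R. \<Sum>d\<in>R. (4 * common_ind c) * (4 * common_ind d) * eta (c - d)) = legendre_sum - 6 * p + 36"
proof -
  define \<kappa> where "\<kappa> c = (\<Sum>d\<in>R. eta (d * (1 - d)) * eta (d - c))" for c
  have "(\<Sum>c\<in>R. \<Sum>d\<in>R. (4 * common_ind c) * (4 * common_ind d) * eta (c - d)) = 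
        (\<Sum>c\<in>R. (4 * common_ind c) * (\<Sum>d\<in>R. (4 * common_ind d) * eta (d - c)))"
    unfolding sum_distrib_left by (intro sum.cong refl) (metis mult.assoc eta_diff_commute)
  also have "\<dots> = (\<Sum>c\<in>R. (4 * common_ind c) * \<kappa> c - 6 * (4 * common_ind c))"
  proof (intro sum.cong refl)
    fix c assume c: "c \<in> R"
    have z: "common_ind c * of_bool (c = 0) = 0" "common_ind c * of_bool (c = 1) = 0" by (auto simp: common_ind_0_1)
    have "(4 * common_ind c) * (\<Sum>d\<in>R. (4 * common_ind d) * eta (d - c)) = 4 * p * (common_ind c * of_bool (c = 0)) 
       + 4 * p * (common_ind c * of_bool (c = 1)) - 2 * (4 * common_ind c)
       + (4 * common_ind c) * \<kappa> c - 2 * ((4 * common_ind c) * eta c) - 2 * ((4 * common_ind c) * eta (c - 1))"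
      unfolding sum_common_ind_eta[OF c] \<kappa>_def by (simp add: algebra_simps)
    also have "\<dots> = (4 * common_ind c) * \<kappa> c - 6 * (4 * common_ind c)" unfolding z common_ind_mult_eta by simp
    finally show "(4 * common_ind c) * (\<Sum>d\<in>R. (4 * common_ind d) * eta (d - c)) = (4 * common_ind c) * \<kappa> c - 6 * (4 * common_ind c)" .
  qed
  also have "\<dots> = (\<Sum>c\<in>R. (4 * common_ind c) * \<kappa> c) - 6 * (p - 5)"
    by (simp only: sum_subtractf sum_distrib_left[symmetric] four_sum_common_ind)
  also have "(\<Sum>c\<in>R. (4 * common_ind c) * \<kappa> c) = (\<Sum>d\<in>R. eta (d * (1 - d)) * (\<Sum>c\<in>R. (4 * common_ind c) * eta (c - d)))"
    unfolding \<kappa>_def sum_distrib_left by (subst sum.swap) (intro sum.cong refl, metis mult.left_commute eta_diff_commute)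
  also have "\<dots> = (\<Sum>d\<in>R. \<Sum>c\<in>R. eta (d * (1 - d)) * (eta (c * (1 - c)) * eta (c - d))) + 
     (\<Sum>d\<in>R. - 2 * eta (d * (1 - d)) - 2 * (eta (d * (1 - d)) * eta d) - 2 * (eta (d * (1 - d)) * eta (d - 1)))"
    unfolding sum.distrib[symmetric]
  proof (intro sum.cong refl)
    fix d assume d: "d \<in> R"
    have z: "eta (d * (1 - d)) * of_bool (d = 0) = 0" "eta (d * (1 - d)) * of_bool (d = 1) = 0" by auto
    have "eta (d * (1 - d)) * (\<Sum>c\<in>R. (4 * common_ind c) * eta (c - d)) = 
       p * (eta (d * (1 - d)) * of_bool (d = 0)) + p * (eta (d * (1 - d)) * of_bool (d = 1)) +
       (\<Sum>c\<in>R. eta (d * (1 - d)) * (eta (c * (1 - c)) * eta (c - d))) 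
       + (- 2 * eta (d * (1 - d)) - 2 * (eta (d * (1 - d)) * eta d) - 2 * (eta (d * (1 - d)) * eta (d - 1)))"
      unfolding sum_common_ind_eta[OF d] sum_distrib_left[symmetric] by (simp add: algebra_simps)
    thus "eta (d * (1 - d)) * (\<Sum>c\<in>R. (4 * common_ind c) * eta (c - d)) = 
       (\<Sum>c\<in>R. eta (d * (1 - d)) * (eta (c * (1 - c)) * eta (c - d))) 
       + (- 2 * eta (d * (1 - d)) - 2 * (eta (d * (1 - d)) * eta d) - 2 * (eta (d * (1 - d)) * eta (d - 1)))"
      unfolding z by simp
  qed
  also have "(\<Sum>d\<in>R. \<Sum>c\<in>R. eta (d * (1 - d)) * (eta (c * (1 - c)) * eta (c - d))) = legendre_sum"
    unfolding legendre_sum_def by (subst sum.swap) (simp only: mult.left_commute mult.assoc)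
  also have "(\<Sum>d\<in>R. - 2 * eta (d * (1 - d)) - 2 * (eta (d * (1 - d)) * eta d) - 2 * (eta (d * (1 - d)) * eta (d - 1))) = 6"
    unfolding sum_subtractf sum_distrib_left[symmetric] sum_eta_quad quad_eta_sums by simp
  finally show ?thesis by simp
qed

lemma two_residue_indicator:
  assumes "c \<in> R" "d \<in> R"
  shows "2 * of_bool (eta (c - d) = 1) = 1 + eta (c - d) - of_bool (d = c)"
proof -
  have "p dvd c - d \<longleftrightarrow> c = d"
  proof
    assume "p dvd c - d"
    moreover have "\<bar>c - d\<bar> < p" using assms by auto
    ultimately show "c = d" using dvd_imp_le_int[of "c - d" p] by force
  qed simp
  thus ?thesis using eta_values[of "c - d"] eta_eq_0_iff[of "c - d"] by auto
qed

text \<open>The 32 is 4 * 4 * 2, from two copies of \<open>common_ind\<close> and the indicator of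
  \<open>eta (c - d) = 1\<close>. Doubling the latter by \<open>1 + eta (c - d)\<close> overcounts
  the diagonal, whose removal costs \<open>4 * (p - 5)\<close>.\<close>

lemma common_arcs_eq: "32 * common_arcs = p\<^sup>2 - 22 * p + 81 + (jacobsthal 1)\<^sup>2"
proof -
  have hh: "common_ind c * common_ind c = common_ind c" for c by (simp add: common_ind_def)
  have "32 * common_arcs = (\<Sum>c\<in>R. \<Sum>d\<in>R. (4 * common_ind c) * (4 * common_ind d) * (2 * of_bool (eta (c - d) = 1)))"
    unfolding common_arcs_def sum_distrib_left by (intro sum.cong refl) simp
  also have "\<dots> = (\<Sum>c\<in>R. \<Sum>d\<in>R. (4 * common_ind c) * (4 * common_ind d) + (4 * common_ind c) * (4 * common_ind d) * eta (c - d) 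
     - ((4 * common_ind c) * (4 * common_ind d)) * of_bool (d = c))"
    by (intro sum.cong refl) (simp only: two_residue_indicator, simp add: algebra_simps)
  also have "\<dots> = (\<Sum>c\<in>R. 4 * common_ind c) * (\<Sum>d\<in>R. 4 * common_ind d) + (legendre_sum - 6 * p + 36)
     - (\<Sum>c\<in>R. \<Sum>d\<in>R. ((4 * common_ind c) * (4 * common_ind d)) * of_bool (d = c))"
    by (simp only: sum.distrib sum_subtractf sum_common_ind_eta_pairs sum_product)
  also have "(\<Sum>c\<in>R. \<Sum>d\<in>R. ((4 * common_ind c) * (4 * common_ind d)) * of_bool (d = c)) = (\<Sum>c\<in>R. 4 * (4 * common_ind c))"
    by (intro sum.cong refl, subst sum_of_bool_R) (use hh in auto)
  finally have "32 * common_arcs = (p - 5) * (p - 5) + (legendre_sum - 6 * p + 36) - 4 * (p - 5)"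
    by (simp only: sum_distrib_left[symmetric] four_sum_common_ind)
  thus ?thesis unfolding legendre_sum_eq by (simp add: power2_eq_square algebra_simps)
qed

section \<open>Non-adjacency in the Paley graph\<close>

definition nonadj :: "int \<Rightarrow> int \<Rightarrow> bool" where "nonadj x y \<longleftrightarrow> eta (x - y) = -1"

lemma nonadj_sym: "nonadj x y \<longleftrightarrow> nonadj y x"
  unfolding nonadj_def by (simp only: eta_diff_commute[of x y])

lemma periodic_nonadj: "periodic_mod p (nonadj x)"
  unfolding nonadj_def periodic_mod_def using eta_cong[OF cong_diff[OF cong_refl]] by metis

text \<open>As \<open>y - x\<close> is a nonresidue, the affine map taking \<open>0, 1\<close> to \<open>x, y\<close> exchanges residues and
  nonresidues. Hence the common non-neighbours of every nonadjacent pair have the same structure.\<close>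

lemma nonadj_affine:
  assumes "nonadj x y"
  shows "nonadj x ((y - x) * c + x) \<longleftrightarrow> eta c = 1"
    "nonadj y ((y - x) * c + x) \<longleftrightarrow> eta (1 - c) = 1"
    "nonadj ((y - x) * c + x) ((y - x) * d + x) \<longleftrightarrow> eta (c - d) = 1"
proof -
  have e: "eta (y - x) = -1" using assms by (simp add: nonadj_def eta_diff_commute[of x y])
  have 1: "x - ((y - x) * c + x) = - ((y - x) * c)" "y - ((y - x) * c + x) = (y - x) * (1 - c)"
     "((y - x) * c + x) - ((y - x) * d + x) = (y - x) * (c - d)"
    by (simp_all add: algebra_simps)
  show "nonadj x ((y - x) * c + x) \<longleftrightarrow> eta c = 1"
    "nonadj y ((y - x) * c + x) \<longleftrightarrow> eta (1 - c) = 1"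
    "nonadj ((y - x) * c + x) ((y - x) * d + x) \<longleftrightarrow> eta (c - d) = 1"
    unfolding nonadj_def 1 eta_uminus eta_mult[of "y - x"] e by auto
qed

lemma nonadj_not_dvd: "nonadj x y \<Longrightarrow> \<not> p dvd (y - x)"
  using eta_eq_0_iff[of "y - x"] by (auto simp: nonadj_def eta_diff_commute[of x y])

lemma sum_common_nonadj:
  assumes "nonadj x y"
  shows "4 * (\<Sum>z\<in>R. of_bool (nonadj x z \<and> nonadj y z)) = p - 5"
proof -
  have "periodic_mod p (\<lambda>z. of_bool (nonadj x z \<and> nonadj y z) :: int)"
  proof (rule periodic_modI)
    fix z z' assume "[z = z'] (mod p)"
    note this[THEN periodic_modD[OF periodic_nonadj]]
    thus "of_bool (nonadj x z \<and> nonadj y z) = (of_bool (nonadj x z' \<and> nonadj y z') :: int)" by simp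
  qed
  from sum_affine[OF this nonadj_not_dvd[OF assms], of x]
  show ?thesis using four_sum_common_ind unfolding nonadj_affine[OF assms] common_ind_def by simp
qed

lemma sum_common_nonadj_pairs:
  assumes "nonadj x y"
  shows "(\<Sum>z\<in>R. \<Sum>w\<in>R. of_bool (nonadj x z \<and> nonadj y z) * of_bool (nonadj x w \<and> nonadj y w) * 
     of_bool (nonadj z w)) = common_arcs"
proof -
  define F :: "int \<Rightarrow> int \<Rightarrow> int" where 
    "F z w = of_bool (nonadj x z \<and> nonadj y z) * of_bool (nonadj x w \<and> nonadj y w) * of_bool (nonadj z w)" for z w
  have "(\<Sum>z\<in>R. \<Sum>w\<in>R. F z w) = (\<Sum>c\<in>R. \<Sum>w\<in>R. F ((y - x) * c + x) w)"
  proof (rule sum_affine[OF _ nonadj_not_dvd[OF assms], symmetric], rule periodic_modI)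
    fix z z' assume "[z = z'] (mod p)"
    note n = this[THEN periodic_modD[OF periodic_nonadj]]
    hence "nonadj z w \<longleftrightarrow> nonadj z' w" for w using nonadj_sym by blast
    with n show "sum (F z) R = sum (F z') R" unfolding F_def by simp
  qed
  also have "\<dots> = (\<Sum>c\<in>R. \<Sum>d\<in>R. F ((y - x) * c + x) ((y - x) * d + x))"
  proof (rule sum.cong[OF refl], rule sum_affine[OF _ nonadj_not_dvd[OF assms], symmetric], rule periodic_modI)
    fix c z z' assume "[z = z'] (mod p)"
    note this[THEN periodic_modD[OF periodic_nonadj]]
    thus "F ((y - x) * c + x) z = F ((y - x) * c + x) z'" unfolding F_def by simp
  qed
  also have "\<dots> = common_arcs" unfolding F_def nonadj_affine[OF assms] common_arcs_def common_ind_def ..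
  finally show ?thesis unfolding F_def .
qed

lemma sum_nonadj:
  assumes "x \<in> R"
  shows "2 * (\<Sum>y\<in>R. of_bool (nonadj x y)) = p - 1"
proof -
  have "2 * (\<Sum>y\<in>R. of_bool (nonadj x y)) = (\<Sum>y\<in>R. eta (y - x) * eta (y - x) - eta (y - x))"
    unfolding sum_distrib_left
  proof (intro sum.cong refl)
    fix y 
    show "2 * of_bool (nonadj x y) = eta (y - x) * eta (y - x) - eta (y - x)"
      using eta_values[of "y - x"] eta_diff_commute[of x y] unfolding nonadj_def by auto
  qed
  also have "\<dots> = p - 1"
    using sum_eta_corr[of x x] by (simp add: sum_subtractf sum_eta_shift)
  finally show ?thesis .
qed

lemma nonadj_iff:
  assumes "x \<in> R" "y \<in> R"
  shows "nonadj x y \<longleftrightarrow> x \<noteq> y \<and> \<not> paley_adj q x y"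
proof -
  have "p dvd x - y \<longleftrightarrow> x = y"
  proof
    assume "p dvd x - y"
    moreover have "\<bar>x - y\<bar> < p" using assms by auto
    ultimately show "x = y" using dvd_imp_le_int[of "x - y" p] by force
  qed simp
  thus ?thesis unfolding nonadj_def eta_def Legendre_def paley_adj_def by (auto simp: cong_0_iff)
qed

end

subsection \<open>The sum of the reciprocals of the primes congruent to 1 modulo 4\<close>

definition chi4 :: "nat \<Rightarrow> int" where
  "chi4 d = (if d mod 4 = 1 then 1 else if d mod 4 = 3 then -1 else 0)"

lemma chi4_mult: "chi4 (a * b) = chi4 a * chi4 b"
proof -
  have m: "(a * b) mod 4 = ((a mod 4) * (b mod 4)) mod 4" by (simp add: mod_mult_eq)
  have "a mod 4 < 4" "b mod 4 < 4" by auto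
  hence "a mod 4 \<in> {0,1,2,3}" "b mod 4 \<in> {0,1,2,3}" by auto
  thus ?thesis unfolding chi4_def m by auto
qed

lemma chi4_1 [simp]: "chi4 1 = 1" "chi4 (Suc 0) = 1" by (simp_all add: chi4_def)

lemma chi4_power: "chi4 (a ^ k) = chi4 a ^ k"
  by (induction k) (simp_all add: chi4_mult)

text \<open>The Dirichlet series is zeta(s) L(s, chi4), and four times this function counts
  representations as a sum of two squares. Unlike \<open>chi4\<close> it is nonnegative, so that
  partial sums can be compared with products. Its Euler factor at 1 is 1 + 2/p + ... for primes 1
  mod 4, but only 1 + O(1/p^2) for primes 3 mod 4.\<close>

definition chi4_conv :: "nat \<Rightarrow> int" where
  "chi4_conv n = (\<Sum>d | d dvd n. chi4 d)"

lemma chi4_conv_mult: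
  assumes ab: "coprime a b"
  shows "chi4_conv (a * b) = chi4_conv a * chi4_conv b"
proof -
  let ?f = "\<lambda>(x, y). x * y :: nat"
  have inj: "inj_on ?f ({x. x dvd a} \<times> {y. y dvd b})"
  proof (rule inj_onI, clarsimp)
    fix x y x' y' assume d: "x dvd a" "y dvd b" "x' dvd a" "y' dvd b" "x * y = x' * y'"
    have "coprime x y'" "coprime x' y" using d ab by (meson coprime_divisors)+
    thus "x = x' \<and> y = y'" using d(5) coprime_crossproduct_nat by blast
  qed
  have img: "?f ` ({x. x dvd a} \<times> {y. y dvd b}) = {d. d dvd a * b}"
  proof (intro equalityI subsetI)
    fix d assume "d \<in> {d. d dvd a * b}"
    then obtain x y where "d = x * y" "x dvd a" "y dvd b" using division_decomp by blast
    thus "d \<in> ?f ` ({x. x dvd a} \<times> {y. y dvd b})" by force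
  qed (auto intro: mult_dvd_mono)
  have "chi4_conv (a * b) = (\<Sum>z\<in>{x. x dvd a} \<times> {y. y dvd b}. chi4 (?f z))"
    unfolding chi4_conv_def img[symmetric] sum.reindex[OF inj] by simp
  also have "\<dots> = chi4_conv a * chi4_conv b"
    unfolding chi4_conv_def sum_product sum.cartesian_product
    by (intro sum.cong) (auto simp: chi4_mult)
  finally show ?thesis .
qed

lemma chi4_conv_prime_power:
  assumes "prime p"
  shows "chi4_conv (p ^ k) = (\<Sum>j\<le>k. chi4 p ^ j)"
proof -
  have "{d. d dvd p ^ k} = (\<lambda>j. p ^ j) ` {..k}"
    using assms by (auto simp: divides_primepow_nat)
  moreover have "inj_on (\<lambda>j. p ^ j) {..k}"
    using prime_gt_1_nat[OF assms] by (intro inj_onI) (simp add: power_inject_exp)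
  ultimately show ?thesis unfolding chi4_conv_def by (simp add: sum.reindex chi4_power)
qed

lemma chi4_values: "chi4 n = 0 \<or> chi4 n = 1 \<or> chi4 n = -1"
  by (simp add: chi4_def)

lemma sum_alternating: "(\<Sum>j\<le>k. (-1::int) ^ j) = of_bool (even k)"
  by (induction k) auto

lemma chi4_conv_prime_power_cases:
  assumes "prime p"
  shows "chi4 p = 0 \<Longrightarrow> chi4_conv (p ^ k) = 1"
    and "chi4 p = 1 \<Longrightarrow> chi4_conv (p ^ k) = int k + 1"
    and "chi4 p = -1 \<Longrightarrow> chi4_conv (p ^ k) = of_bool (even k)"
proof -
  show "chi4_conv (p ^ k) = 1" if "chi4 p = 0"
    unfolding chi4_conv_prime_power[OF assms] that by (simp add: power_0_left sum.delta' if_distrib cong: if_cong)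
  show "chi4_conv (p ^ k) = int k + 1" if "chi4 p = 1"
    unfolding chi4_conv_prime_power[OF assms] that by simp
  show "chi4_conv (p ^ k) = of_bool (even k)" if "chi4 p = -1"
    unfolding chi4_conv_prime_power[OF assms] that by (rule sum_alternating)
qed

lemma prime_power_split:
  assumes "prime (p::nat)" "n > 0"
  obtains k m where "n = p ^ k * m" "\<not> p dvd m" "m > 0" "k = multiplicity p n"
proof -
  obtain m where "n = p ^ multiplicity p n * m" "\<not> p dvd m"
    using multiplicity_decompose'[of n p] assms by (metis neq0_conv not_prime_unit)
  thus ?thesis using that assms by (metis gr0I mult_0_right)
qed

lemma chi4_conv_nonneg:
  assumes "n > 0"
  shows "chi4_conv n \<ge> 0"
  using assms
proof (induction n rule: less_induct)
  case (less n)
  show ?case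
  proof (cases "n = 1")
    case False
    then obtain p where p: "prime p" "p dvd n" using prime_factor_nat by blast
    obtain k m where km: "n = p ^ k * m" "\<not> p dvd m" "m > 0"
      using prime_power_split[OF p(1) less.prems] by metis
    have "k \<noteq> 0" using km p(2) by (metis mult_1 power_0)
    hence "p ^ k > 1" using prime_gt_1_nat[OF p(1)] by (intro one_less_power) auto
    hence "m < n" using km by simp
    moreover have "coprime (p ^ k) m" using km p(1) by (metis coprime_power_left_iff prime_imp_coprime)
    moreover have "chi4_conv (p ^ k) \<ge> 0"
      using chi4_conv_prime_power_cases[OF p(1), of k] chi4_values[of p] by auto
    ultimately show ?thesis using less.IH[of m] km chi4_conv_mult by simp
  qed (simp add: chi4_conv_def)
qed

text \<open>One half of the Euler product, with finite sums throughout: unique factorization embeds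
  the left side into the expanded product, and the surplus terms are nonnegative.\<close>

lemma sum_le_euler_product:
  fixes f :: "nat \<Rightarrow> real"
  assumes nonneg: "\<And>n. n > 0 \<Longrightarrow> f n \<ge> 0"
    and mult: "\<And>p k m. prime p \<Longrightarrow> \<not> p dvd m \<Longrightarrow> f (p ^ k * m) = f (p ^ k) * f m"
    and f1: "f 1 = 1"
    and P: "finite P" "\<And>p. p \<in> P \<Longrightarrow> prime p"
  shows "(\<Sum>n\<in>{n\<in>{1..X}. \<forall>p. prime p \<and> p dvd n \<longrightarrow> p \<in> P}. f n) \<le> (\<Prod>p\<in>P. \<Sum>k\<le>X. f (p ^ k))"
  using P
proof (induction P rule: finite_induct)
  case empty
  have "{n\<in>{1..X}. \<forall>p::nat. prime p \<and> p dvd n \<longrightarrow> p \<in> {}} \<subseteq> {1}"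
    using prime_factor_nat by fastforce
  hence "(\<Sum>n\<in>{n\<in>{1..X}. \<forall>p. prime p \<and> p dvd n \<longrightarrow> p \<in> {}}. f n) \<le> (\<Sum>n\<in>{1}. f n)"
    using f1 by (intro sum_mono2) auto
  thus ?case using f1 by simp
next
  case (insert p P)
  let ?S = "\<lambda>P. {n\<in>{1..X}. \<forall>p. prime p \<and> p dvd n \<longrightarrow> p \<in> P}"
  have p: "prime p" using insert.prems by simp
  let ?g = "\<lambda>(k, m). p ^ k * m"
  have sub: "?S (insert p P) \<subseteq> ?g ` ({..X} \<times> {m\<in>?S P. \<not> p dvd m})"
  proof
    fix n assume n: "n \<in> ?S (insert p P)"
    hence "n > 0" by auto
    obtain k m where km: "n = p ^ k * m" "\<not> p dvd m" "m > 0"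
      using prime_power_split[OF p \<open>n > 0\<close>] by metis
    \<comment> \<open>By \<open>k < p ^ k \<le> n\<close> the exponents stay within the same
      \<open>X\<close> that truncates the factors.\<close>
    have "k < p ^ k" using prime_gt_1_nat[OF p] power_gt_expt[of p k] by simp
    also have "p ^ k \<le> n" using km by simp
    finally have "k \<le> X" using n by simp
    moreover have "m \<le> n" using km prime_gt_0_nat[OF p] by simp
    hence "m \<le> X" using n by simp
    moreover have "r \<in> P" if "prime r" "r dvd m" for r
    proof -
      have "r dvd n" using that km by simp
      hence "r \<in> insert p P" using n that by auto
      thus ?thesis using that km by auto
    qed
    ultimately have "(k, m) \<in> {..X} \<times> {m\<in>?S P. \<not> p dvd m}" using n km by auto
    thus "n \<in> ?g ` ({..X} \<times> {m\<in>?S P. \<not> p dvd m})" using km(1) by force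
  qed
  have fS: "finite (?S P)" by simp
  have prod_nonneg: "(\<Sum>k\<le>X. f (r ^ k)) \<ge> 0" if "prime r" for r
    using that by (intro sum_nonneg nonneg) (simp add: prime_gt_0_nat)
  have "(\<Sum>n\<in>?S (insert p P). f n) \<le> (\<Sum>n\<in>?g ` ({..X} \<times> {m\<in>?S P. \<not> p dvd m}). f n)"
    using prime_gt_0_nat[OF p] by (intro sum_mono2 sub finite_imageI) (auto intro!: nonneg)
  also have "\<dots> \<le> (\<Sum>z\<in>{..X} \<times> {m\<in>?S P. \<not> p dvd m}. f (?g z))"
    using prime_gt_0_nat[OF p] by (intro order.trans[OF sum_image_le]) (auto intro!: nonneg)
  also have "\<dots> = (\<Sum>k\<le>X. f (p ^ k)) * (\<Sum>m\<in>{m\<in>?S P. \<not> p dvd m}. f m)"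
    unfolding sum_product sum.cartesian_product by (intro sum.cong) (auto simp: mult[OF p])
  also have "\<dots> \<le> (\<Sum>k\<le>X. f (p ^ k)) * (\<Sum>m\<in>?S P. f m)"
    by (intro mult_left_mono sum_mono2 prod_nonneg p) (auto intro!: nonneg)
  also have "\<dots> \<le> (\<Sum>k\<le>X. f (p ^ k)) * (\<Prod>p\<in>P. \<Sum>k\<le>X. f (p ^ k))"
    using insert.IH insert.prems by (intro mult_left_mono prod_nonneg p) auto
  finally show ?case using insert.hyps by simp
qed

lemma geometric_partial_le:
  fixes x :: real
  assumes "0 \<le> x" "x < 1"
  shows "(\<Sum>k\<le>n. x ^ k) \<le> 1 / (1 - x)"
proof -
  have "(\<Sum>k\<le>n. x ^ k) = (\<Sum>k<Suc n. x ^ k)" by (simp only: lessThan_Suc_atMost)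
  also have "\<dots> = (1 - x ^ Suc n) / (1 - x)"
    using assms by (subst sum_gp_strict) simp
  also have "\<dots> \<le> 1 / (1 - x)" using assms by (intro divide_right_mono) auto
  finally show ?thesis .
qed

text \<open>The term \<open>4 / p\<^sup>2\<close> also absorbs the factor at \<open>p = 2\<close>, which is at most \<open>2 \<le> exp 1\<close>.\<close>

lemma euler_factor_le:
  assumes p: "prime p"
  shows "(\<Sum>k\<le>X. real_of_int (chi4_conv (p ^ k)) / real (p ^ k)) 
     \<le> exp (4 * (of_bool (p \<in> paley_orders) / real p) + 4 / (real p)\<^sup>2)"
proof -
  have p2: "real p \<ge> 2" using prime_ge_2_nat[OF p] by simp
  have par: "p \<in> paley_orders \<longleftrightarrow> chi4 p = 1"
    using p by (auto simp: paley_orders_def cong_def chi4_def)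
  consider "chi4 p = 0" | "chi4 p = 1" | "chi4 p = -1" using chi4_values by blast
  thus ?thesis
  proof cases
    case 1
    have "p mod 4 \<noteq> 1 \<and> p mod 4 \<noteq> 3" using 1 by (auto simp: chi4_def split: if_splits)
    hence "even p" by presburger
    hence "p = 2" using p primes_dvd_imp_eq two_is_prime_nat by blast
    have "(\<Sum>k\<le>X. real_of_int (chi4_conv (p ^ k)) / real (p ^ k)) = (\<Sum>k\<le>X. (1/2) ^ k)"
      using chi4_conv_prime_power_cases(1)[OF p 1] \<open>p = 2\<close> by (simp add: power_divide)
    also have "\<dots> \<le> 2" using geometric_partial_le[of "1/2" X] by simp
    also have "\<dots> \<le> exp 1" using exp_ge_add_one_self[of 1] by simp
    also have "\<dots> \<le> exp (4 * (of_bool (p \<in> paley_orders) / real p) + 4 / (real p)\<^sup>2)"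
      using \<open>p = 2\<close> by simp
    finally show ?thesis .
  next
    case 2
    have "p mod 4 = 1" using 2 by (auto simp: chi4_def split: if_splits)
    moreover have "p \<noteq> 1" using p by auto
    ultimately have "p \<ge> 5" by presburger
    hence p5: "real p \<ge> 5" by simp
    \<comment> \<open>Majorising \<open>k + 1\<close> by \<open>2 ^ k\<close> turns the factor into
      a geometric series with ratio 2/p < 1.\<close>
    have "(\<Sum>k\<le>X. real_of_int (chi4_conv (p ^ k)) / real (p ^ k)) \<le> (\<Sum>k\<le>X. (2 / real p) ^ k)"
    proof (rule sum_mono)
      fix k
      have "k < 2 ^ k" by (rule less_exp)
      hence "k + 1 \<le> 2 ^ k" by (simp only: Suc_eq_plus1[symmetric] Suc_le_eq)
      hence "real (k + 1) \<le> real (2 ^ k)" by (rule of_nat_mono)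
      hence "real k + 1 \<le> 2 ^ k" by simp
      thus "real_of_int (chi4_conv (p ^ k)) / real (p ^ k) \<le> (2 / real p) ^ k"
        using chi4_conv_prime_power_cases(2)[OF p 2] by (simp add: power_divide divide_right_mono)
    qed
    also have "\<dots> \<le> 1 / (1 - 2 / real p)" using p5 by (intro geometric_partial_le) auto
    \<comment> \<open>Here \<open>1 / (1 - 2/p) = 1 + 2/(p - 2)\<close>, which is at most
      \<open>1 + 4/p\<close> once \<open>p \<ge> 4\<close>.\<close>
    also have "\<dots> \<le> 1 + 4 / real p" using p5 by (simp add: field_simps)
    also have "\<dots> \<le> exp (4 / real p)" by (rule exp_ge_add_one_self)
    also have "\<dots> \<le> exp (4 * (of_bool (p \<in> paley_orders) / real p) + 4 / (real p)\<^sup>2)"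
      using 2 par by simp
    finally show ?thesis .
  next
    case 3
    have "(\<Sum>k\<le>X. real_of_int (chi4_conv (p ^ k)) / real (p ^ k)) = (\<Sum>k\<le>X. of_bool (even k) * (1 / real p) ^ k)"
      using chi4_conv_prime_power_cases(3)[OF p 3] by (simp add: power_divide)
    also have "\<dots> = (\<Sum>k\<in>{k\<in>{..X}. even k}. (1 / real p) ^ k)"
      by (rule sum.mono_neutral_cong_right) auto
    also have "\<dots> \<le> (\<Sum>k\<in>(\<lambda>j. 2 * j) ` {..X}. (1 / real p) ^ k)"
      by (intro sum_mono2) (auto elim!: evenE)
    also have "\<dots> = (\<Sum>j\<le>X. ((1 / real p)\<^sup>2) ^ j)"
      by (subst sum.reindex) (auto simp: inj_on_def power_mult)
    also have "\<dots> \<le> 1 / (1 - (1 / real p)\<^sup>2)" 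
      using p2 power_mono[OF p2, of 2] by (intro geometric_partial_le) (auto simp: power_divide divide_less_eq)
    also have "\<dots> \<le> 1 + 4 / (real p)\<^sup>2"
    proof -
      define y where "y = (1 / real p)\<^sup>2"
      have "(real p)\<^sup>2 \<ge> 4" using power_mono[OF p2, of 2] by simp
      hence y: "y \<le> 1/4" "y \<ge> 0" unfolding y_def using frac_le[of 1 1 4 "(real p)\<^sup>2"]
        by (auto simp: power_divide)
      have "1 / (1 - y) \<le> 1 + 4 * y"
      proof -
        have "y * (3 - 4 * y) \<ge> 0" using y by (intro mult_nonneg_nonneg) auto
        hence "1 \<le> (1 + 4 * y) * (1 - y)" by (simp add: algebra_simps)
        thus ?thesis using y by (simp add: pos_divide_le_eq)
      qed
      thus ?thesis unfolding y_def by (simp add: power_divide)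
    qed
    also have "\<dots> \<le> exp (4 / (real p)\<^sup>2)" by (rule exp_ge_add_one_self)
    also have "\<dots> \<le> exp (4 * (of_bool (p \<in> paley_orders) / real p) + 4 / (real p)\<^sup>2)"
      by simp
    finally show ?thesis .
  qed
qed

lemma sum_inverse_squares_le: "(\<Sum>n=1..N. 1 / (real n)\<^sup>2) \<le> 2"
proof -
  \<comment> \<open>The subtracted \<open>1 / N\<close> makes the induction telescope.\<close>
  have "(\<Sum>n=1..N. 1 / (real n)\<^sup>2) \<le> 2 - 1 / real N" if "N > 0"
    using that
  proof (induction N rule: nat_induct_non_zero)
    case (Suc n)
    have "1 / (real (Suc n))\<^sup>2 \<le> 1 / real n - 1 / real (Suc n)"
    proof -
      have "1 / (real (Suc n))\<^sup>2 \<le> 1 / (real n * real (Suc n))"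
        using Suc.hyps by (intro divide_left_mono) (auto simp: power2_eq_square)
      also have "\<dots> = 1 / real n - 1 / real (Suc n)"
        using Suc.hyps by (simp add: field_simps)
      finally show ?thesis .
    qed
    thus ?case using Suc by simp
  qed simp
  thus ?thesis by (cases "N = 0") (auto intro: order_trans)
qed

definition chi4_partial :: "nat \<Rightarrow> real" where
  "chi4_partial m = (\<Sum>d=1..m. real_of_int (chi4 d) / real d)"

text \<open>The partial sums of 1 - 1/3 + 1/5 - ... oscillate with shrinking steps, so their minimum
  over positive \<open>m\<close> is 1 - 1/3, reached at \<open>m = 3\<close>. The uniform bound
  plays the role of L(1, chi4) > 0.\<close>

lemma chi4_partial_ge:
  assumes "m > 0"
  shows "chi4_partial m \<ge> 2/3"
proof -
  have chi: "chi4 (4 * k + 1) = 1" "chi4 (4 * k + 2) = 0" "chi4 (4 * k + 3) = -1" "chi4 (4 * k + 4) = 0" for k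
    unfolding chi4_def by presburger+
  have s: "chi4_partial (Suc m) = chi4_partial m + real_of_int (chi4 (Suc m)) / real (Suc m)" for m
    by (simp add: chi4_partial_def)
  have s1: "chi4_partial (4 * k + 1) = chi4_partial (4 * k) + 1 / real (4 * k + 1)" for k
    using s[of "4 * k"] chi(1)[of k] by simp
  have s2: "chi4_partial (4 * k + 2) = chi4_partial (4 * k + 1)" for k
    using s[of "4 * k + 1"] chi(2)[of k] by simp
  have s3: "chi4_partial (4 * k + 3) = chi4_partial (4 * k + 2) - 1 / real (4 * k + 3)" for k
    using s[of "4 * k + 2"] chi(3)[of k] by (simp add: numeral_eq_Suc)
  have s4: "chi4_partial (4 * k + 4) = chi4_partial (4 * k + 3)" for k
    using s[of "4 * k + 3"] chi(4)[of k] by (simp add: numeral_eq_Suc)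
  have inc: "1 / real (4 * k + 1) \<ge> 1 / real (4 * k + 3)" for k
    by (intro divide_left_mono) auto
  \<comment> \<open>Along multiples of 4 the partial sums do not decrease, and stopping at a
    remainder modulo 4 only adds a nonnegative amount.\<close>
  have 4: "chi4_partial (4 * Suc k) \<ge> 2/3" for k
  proof (induction k)
    case 0
    have "chi4_partial 0 = 0" by (simp add: chi4_partial_def)
    thus ?case using s1[of 0] s2[of 0] s3[of 0] s4[of 0] by simp
  next
    case (Suc k)
    define j where "j = Suc k"
    have "chi4_partial (4 * j + 4) \<ge> 2/3"
      using s1[of j] s2[of j] s3[of j] s4[of j] inc[of j] Suc unfolding j_def[symmetric] by linarith
    moreover have "4 * Suc (Suc k) = 4 * j + 4" by (simp add: j_def)
    ultimately show ?case by (simp only:)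
  qed
  define k where "k = m div 4"
  have "m mod 4 < 4" by simp
  hence m: "m = 4 * k \<or> m = 4 * k + 1 \<or> m = 4 * k + 2 \<or> m = 4 * k + 3"
    unfolding k_def by presburger
  show ?thesis
  proof (cases k)
    case 0
    have "chi4_partial 0 = 0" by (simp add: chi4_partial_def)
    hence "chi4_partial 1 \<ge> 2/3" "chi4_partial 2 \<ge> 2/3" "chi4_partial 3 \<ge> 2/3"
      using s1[of 0] s2[of 0] s3[of 0] by (simp_all add: numeral_eq_Suc)
    thus ?thesis using m assms 0 by (auto simp: numeral_eq_Suc)
  next
    case (Suc j)
    have "1 / real (4 * k + 1) \<ge> 0" by simp
    note facts = this 4[of j, folded Suc] s1[of k] s2[of k] s3[of k] inc[of k]
    from m show ?thesis by (elim disjE; hypsubst) (use facts in linarith)+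
  qed
qed

text \<open>Write \<open>n = e * d\<close> and sum over \<open>d\<close> inside. The inner sums are
  then partial sums of the alternating series, bounded below uniformly, and the outer weights
  \<open>1 / e\<close> bring in the harmonic sum.\<close>

lemma sum_chi4_conv:
  "(\<Sum>n=1..X. real_of_int (chi4_conv n) / real n) = (\<Sum>e=1..X. (1 / real e) * chi4_partial (X div e))"
proof -
  have "(\<Sum>n=1..X. real_of_int (chi4_conv n) / real n) = (\<Sum>n=1..X. \<Sum>d | d dvd n. real_of_int (chi4 d) / real n)"
    unfolding chi4_conv_def by (simp add: sum_divide_distrib)
  also have "\<dots> = (\<Sum>(n, d)\<in>Sigma {1..X} (\<lambda>n. {d. d dvd n}). real_of_int (chi4 d) / real n)"
    by (subst sum.Sigma) auto
  also have "\<dots> = (\<Sum>(e, d)\<in>Sigma {1..X} (\<lambda>e. {1..X div e}). (1 / real e) * (real_of_int (chi4 d) / real d))"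
  proof (rule sum.reindex_bij_witness[where i="\<lambda>(e, d). (e * d, d)" and j="\<lambda>(n, d). (n div d, d)"], goal_cases)
    case (2 a)
    then obtain n d where nd: "a = (n, d)" "n \<in> {1..X}" "d dvd n" by auto
    then obtain e where e: "n = d * e" by (auto elim: dvdE)
    have "d > 0" "e > 0" using nd e by (auto intro!: Nat.gr0I)
    moreover have "d \<le> X div e" using nd e \<open>e > 0\<close> by (simp add: less_eq_div_iff_mult_less_eq)
    moreover have "e \<le> X" using nd e \<open>d > 0\<close> 
      by (metis atLeastAtMost_iff dvd_imp_le dvd_triv_right le_trans mult_pos_pos \<open>e > 0\<close>)
    ultimately show ?case using nd e by auto
  next
    case (4 b)
    then obtain e d where ed: "b = (e, d)" "e \<in> {1..X}" "d \<in> {1..X div e}" by auto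
    hence "e * d \<le> X" by (auto simp: less_eq_div_iff_mult_less_eq mult.commute)
    thus ?case using ed by auto
  qed (auto simp: field_simps elim!: dvdE)
  also have "\<dots> = (\<Sum>e=1..X. \<Sum>d=1..X div e. (1 / real e) * (real_of_int (chi4 d) / real d))"
    by (subst sum.Sigma) auto
  also have "\<dots> = (\<Sum>e=1..X. (1 / real e) * chi4_partial (X div e))"
    unfolding chi4_partial_def sum_distrib_left ..
  finally show ?thesis .
qed

text \<open>A finite form of the behaviour of zeta(s) L(s, chi4) near s = 1: the harmonic sum stands
  for the pole of zeta, 2/3 for the value of L, and the Euler factors give the upper bound. The 8 is
  4 times the bound 2 for the sum of inverse squares.\<close>

lemma harm_le_exp_sum:
  "2/3 * harm X \<le> exp (4 * (\<Sum>q\<in>{q\<in>paley_orders. q \<le> X}. 1 / real q) + 8)"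
proof -
  define f where "f n = real_of_int (chi4_conv n) / real n" for n
  define P where "P = {p. prime p \<and> p \<le> X}"
  have fP: "finite P" unfolding P_def by simp
  have "2/3 * harm X = (\<Sum>e=1..X. (1 / real e) * (2/3))"
    unfolding harm_def sum_distrib_left by (simp add: field_simps)
  also have "\<dots> \<le> (\<Sum>e=1..X. (1 / real e) * chi4_partial (X div e))"
    by (intro sum_mono mult_left_mono chi4_partial_ge) (auto simp: div_greater_zero_iff)
  also have "\<dots> = (\<Sum>n\<in>{1..X}. f n)" unfolding f_def sum_chi4_conv ..
  also have "{1..X} = {n\<in>{1..X}. \<forall>p. prime p \<and> p dvd n \<longrightarrow> p \<in> P}"
    unfolding P_def by (auto dest: dvd_imp_le)
  also have "(\<Sum>n\<in>\<dots>. f n) \<le> (\<Prod>p\<in>P. \<Sum>k\<le>X. f (p ^ k))"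
  proof (rule sum_le_euler_product[OF _ _ _ fP])
    fix p k m :: nat assume pm: "prime p" "\<not> p dvd m"
    hence "coprime (p ^ k) m" by (metis coprime_power_left_iff prime_imp_coprime)
    thus "f (p ^ k * m) = f (p ^ k) * f m" unfolding f_def by (simp add: chi4_conv_mult)
  qed (auto simp: f_def chi4_conv_nonneg P_def chi4_conv_def[of 1] chi4_conv_def[of "Suc 0"])
  also have "\<dots> \<le> (\<Prod>p\<in>P. exp (4 * (of_bool (p \<in> paley_orders) / real p) + 4 / (real p)\<^sup>2))"
    using euler_factor_le unfolding f_def P_def
    by (intro prod_mono) (auto intro!: sum_nonneg divide_nonneg_nonneg simp: chi4_conv_nonneg prime_gt_0_nat)
  also have "\<dots> = exp (\<Sum>p\<in>P. 4 * (of_bool (p \<in> paley_orders) / real p) + 4 / (real p)\<^sup>2)"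
    by (rule exp_sum[OF fP, symmetric])
  also have "\<dots> \<le> exp (4 * (\<Sum>q\<in>{q\<in>paley_orders. q \<le> X}. 1 / real q) + 8)"
  proof -
    have "(\<Sum>p\<in>P. of_bool (p \<in> paley_orders) / real p) = (\<Sum>p\<in>P. if p \<in> paley_orders then 1 / real p else 0)"
      by (intro sum.cong) auto
    also have "\<dots> = (\<Sum>p\<in>{p\<in>P. p \<in> paley_orders}. 1 / real p)"
      by (rule sum.inter_filter[OF fP, symmetric])
    also have "{p\<in>P. p \<in> paley_orders} = {q\<in>paley_orders. q \<le> X}"
      unfolding P_def paley_orders_def by auto
    finally have 1: "(\<Sum>p\<in>P. of_bool (p \<in> paley_orders) / real p) = (\<Sum>q\<in>{q\<in>paley_orders. q \<le> X}. 1 / real q)" .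
    have "(\<Sum>p\<in>P. 1 / (real p)\<^sup>2) \<le> (\<Sum>n=1..X. 1 / (real n)\<^sup>2)"
      unfolding P_def by (intro sum_mono2) (auto simp: Suc_le_eq prime_gt_0_nat)
    also have "\<dots> \<le> 2" by (rule sum_inverse_squares_le)
    finally have 2: "(\<Sum>p\<in>P. 1 / (real p)\<^sup>2) \<le> 2" .
    have "(\<Sum>p\<in>P. 4 * (of_bool (p \<in> paley_orders) / real p) + 4 / (real p)\<^sup>2) =
      4 * (\<Sum>p\<in>P. of_bool (p \<in> paley_orders) / real p) + 4 * (\<Sum>p\<in>P. 1 / (real p)\<^sup>2)"
      by (simp add: sum.distrib sum_distrib_left)
    thus ?thesis using 1 2 by simp
  qed
  finally show ?thesis .
qed

lemma sum_inverse_paley_orders_unbounded: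
  "\<exists>X. (\<Sum>q\<in>{q\<in>paley_orders. q \<le> X}. 1 / real q) > C"
proof (rule ccontr)
  assume "\<not> ?thesis"
  hence le: "(\<Sum>q\<in>{q\<in>paley_orders. q \<le> X}. 1 / real q) \<le> C" for X by (simp add: not_less)
  have "harm X \<le> 3/2 * exp (4 * C + 8)" for X
  proof -
    have "2/3 * harm X \<le> exp (4 * (\<Sum>q\<in>{q\<in>paley_orders. q \<le> X}. 1 / real q) + 8)"
      by (rule harm_le_exp_sum)
    also have "\<dots> \<le> exp (4 * C + 8)" using le by simp
    finally show ?thesis by simp
  qed
  moreover have "\<exists>X. harm X > 3/2 * exp (4 * C + 8)"
    using filterlim_at_top_dense[THEN iffD1, OF harm_at_top] 
    by (meson eventually_sequentially order_refl)
  ultimately show False by (meson not_le)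
qed

subsection \<open>The chromatic polynomial via partitions into independent sets\<close>

definition indep_partitions :: "'a set \<Rightarrow> ('a \<Rightarrow> 'a \<Rightarrow> bool) \<Rightarrow> 'a set set set" where
  "indep_partitions V adj = {P. partition_on V P \<and> (\<forall>B\<in>P. \<forall>x\<in>B. \<forall>y\<in>B. \<not> adj x y)}"

definition kernel_partition :: "'a set \<Rightarrow> ('a \<Rightarrow> 'b) \<Rightarrow> 'a set set" where
  "kernel_partition V c = (\<lambda>x. {y\<in>V. c y = c x}) ` V"

lemma partition_on_kernel: "partition_on V (kernel_partition V c)"
  by (rule partition_onI) (auto simp: kernel_partition_def disjnt_iff)

text \<open>A colouring with kernel \<open>P\<close> is an injection from the blocks to the colours,
  and independence of the blocks makes each of these proper. For \<open>n < card P\<close> the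
  truncated subtraction is harmless, since the factor with \<open>i = n\<close> is 0.\<close>

lemma card_colorings_with_kernel:
  fixes P :: "'a set set"
  assumes V: "finite V" and P: "P \<in> indep_partitions V adj"
  shows "card {c \<in> proper_colorings V adj n. kernel_partition V c = P} = (\<Prod>i=0..<card P. n - i)"
proof -
  have part: "partition_on V P" and ind: "\<And>B x y. B \<in> P \<Longrightarrow> x \<in> B \<Longrightarrow> y \<in> B \<Longrightarrow> \<not> adj x y"
    using P by (auto simp: indep_partitions_def)
  have fP: "finite P" using finite_elements[OF V part] .
  define blk where "blk x = (THE B. B \<in> P \<and> x \<in> B)" for x
  define rep :: "'a set \<Rightarrow> 'a" where "rep B = (SOME x. x \<in> B)" for B
  have uniq: "B = B'" if "B \<in> P" "B' \<in> P" "x \<in> B" "x \<in> B'" for x B B'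
    using that partition_onD2[OF part] unfolding disjoint_def by blast
  have blk_eq: "blk x = B" if "B \<in> P" "x \<in> B" for x B
    unfolding blk_def using that uniq by (intro the_equality) auto
  have blk: "blk x \<in> P" "x \<in> blk x" if "x \<in> V" for x
  proof -
    have "x \<in> \<Union>P" using that partition_onD1[OF part] by simp
    then obtain B where "B \<in> P" "x \<in> B" by blast
    thus "blk x \<in> P" "x \<in> blk x" using blk_eq by auto
  qed
  have sub: "B \<subseteq> V" if "B \<in> P" for B using that partition_onD1[OF part] by auto
  have rep: "rep B \<in> B" "rep B \<in> V" "blk (rep B) = B" if "B \<in> P" for B
  proof -
    have "B \<noteq> {}" using that partition_onD3[OF part] by auto
    thus r: "rep B \<in> B" unfolding rep_def by (simp add: some_in_eq)
    thus "rep B \<in> V" "blk (rep B) = B" using that sub blk_eq by auto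
  qed
  have ker: "c x = c y \<longleftrightarrow> blk x = blk y" if "kernel_partition V c = P" "x \<in> V" "y \<in> V" for c :: "'a \<Rightarrow> nat" and x y
  proof -
    have "{z\<in>V. c z = c x} \<in> P" "{z\<in>V. c z = c y} \<in> P"
      unfolding that(1)[symmetric] kernel_partition_def using that by auto
    hence b: "blk x = {z\<in>V. c z = c x}" "blk y = {z\<in>V. c z = c y}"
      using that by (auto intro!: blk_eq)
    show ?thesis using blk(2)[OF that(2)] unfolding b using that by auto
  qed
  define f where "f c = restrict (\<lambda>B. c (rep B)) P" for c :: "'a \<Rightarrow> nat"
  define g where "g u = restrict (\<lambda>x. u (blk x)) V" for u :: "'a set \<Rightarrow> nat"
  have "bij_betw f {c \<in> proper_colorings V adj n. kernel_partition V c = P} {u \<in> P \<rightarrow>\<^sub>E {..<n}. inj_on u P}"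
  proof (rule bij_betw_byWitness[where f'=g])
    show "\<forall>c\<in>{c \<in> proper_colorings V adj n. kernel_partition V c = P}. g (f c) = c"
    proof
      fix c assume "c \<in> {c \<in> proper_colorings V adj n. kernel_partition V c = P}"
      hence c: "c \<in> proper_colorings V adj n" "P = kernel_partition V c" by auto
      have "c \<in> extensional V" using c(1) by (auto simp: proper_colorings_def PiE_def)
      show "g (f c) = c"
      proof (rule extensionalityI[of _ V])
        fix x assume x: "x \<in> V"
        have "c (rep (blk x)) = c x" using ker[OF c(2)[symmetric]] rep blk x by auto
        thus "g (f c) x = c x" using x blk by (simp add: f_def g_def)
      qed (use \<open>c \<in> extensional V\<close> in \<open>auto simp: g_def\<close>)
    qed
    show "\<forall>u\<in>{u \<in> P \<rightarrow>\<^sub>E {..<n}. inj_on u P}. f (g u) = u"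
    proof
      fix u assume "u \<in> {u \<in> P \<rightarrow>\<^sub>E {..<n}. inj_on u P}"
      hence u: "u \<in> P \<rightarrow>\<^sub>E {..<n}" by simp
      show "f (g u) = u"
        by (rule extensionalityI[of _ P]) (use u rep in \<open>auto simp: f_def g_def PiE_def\<close>)
    qed
    show "f ` {c \<in> proper_colorings V adj n. kernel_partition V c = P} \<subseteq> {u \<in> P \<rightarrow>\<^sub>E {..<n}. inj_on u P}"
    proof (intro image_subsetI)
      fix c assume "c \<in> {c \<in> proper_colorings V adj n. kernel_partition V c = P}"
      hence c: "c \<in> proper_colorings V adj n" "P = kernel_partition V c" by auto
      have "c x < n" if "x \<in> V" for x using c(1) that unfolding proper_colorings_def by auto
      hence "f c \<in> P \<rightarrow>\<^sub>E {..<n}" using rep unfolding f_def by auto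
      moreover have "inj_on (f c) P"
      proof (rule inj_onI)
        fix B B' assume B: "B \<in> P" "B' \<in> P" "f c B = f c B'"
        hence "c (rep B) = c (rep B')" by (simp add: f_def)
        thus "B = B'" using ker[OF c(2)[symmetric]] rep B by metis
      qed
      ultimately show "f c \<in> {u \<in> P \<rightarrow>\<^sub>E {..<n}. inj_on u P}" by simp
    qed
    show "g ` {u \<in> P \<rightarrow>\<^sub>E {..<n}. inj_on u P} \<subseteq> {c \<in> proper_colorings V adj n. kernel_partition V c = P}"
    proof (intro image_subsetI)
      fix u assume "u \<in> {u \<in> P \<rightarrow>\<^sub>E {..<n}. inj_on u P}"
      hence u: "u \<in> P \<rightarrow>\<^sub>E {..<n}" "inj_on u P" by auto
      have geq: "g u x = g u y \<longleftrightarrow> blk x = blk y" if "x \<in> V" "y \<in> V" for x y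
        using that u(2) blk by (auto simp: g_def dest: inj_onD)
      have "g u x \<noteq> g u y" if "x \<in> V" "y \<in> V" "adj x y" for x y
      proof
        assume "g u x = g u y"
        hence "blk x = blk y" using geq that by simp
        hence "x \<in> blk y" using blk(2)[OF that(1)] by simp
        thus False using ind[OF blk(1)[OF that(2)] _ blk(2)[OF that(2)], of x] that by simp
      qed
      moreover have "g u \<in> V \<rightarrow>\<^sub>E {..<n}" using u(1) blk by (auto simp: g_def PiE_def)
      ultimately have pc: "g u \<in> proper_colorings V adj n" unfolding proper_colorings_def by auto
      have cls: "{y\<in>V. g u y = g u x} = blk x" if x: "x \<in> V" for x
        using geq[OF _ x] blk[OF x] blk_eq sub[OF blk(1)[OF x]] blk(2) by blast
      have "kernel_partition V (g u) = blk ` V"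
        unfolding kernel_partition_def using cls by (intro image_cong) auto
      also have "\<dots> = P"
        using blk rep by (metis (no_types, lifting) image_eqI subsetI subset_antisym image_subsetI)
      finally show "g u \<in> {c \<in> proper_colorings V adj n. kernel_partition V c = P}" using pc by simp
    qed
  qed
  hence "card {c \<in> proper_colorings V adj n. kernel_partition V c = P} = card {u \<in> P \<rightarrow>\<^sub>E {..<n}. inj_on u P}"
    by (rule bij_betw_same_card)
  also have "\<dots> = (\<Prod>i=0..<card P. n - i)"
    using card_inj_on_subset_funcset[OF fP, of "{..<n}" P] by simp
  finally show ?thesis .
qed

lemma finite_indep_partitions: "finite V \<Longrightarrow> finite (indep_partitions V adj)"
  by (rule finite_subset[OF _ finitely_many_partition_on]) (auto simp: indep_partitions_def)

lemma card_proper_colorings: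
  assumes V: "finite V"
  shows "card (proper_colorings V adj n) = (\<Sum>P\<in>indep_partitions V adj. \<Prod>i=0..<card P. n - i)"
proof -
  have fin: "finite (proper_colorings V adj n)"
    unfolding proper_colorings_def using V by (simp add: finite_PiE)
  have img: "kernel_partition V c \<in> indep_partitions V adj" if "c \<in> proper_colorings V adj n" for c
  proof -
    have "\<not> adj x y" if "x \<in> V" "y \<in> V" "c x = c y" for x y
      using that \<open>c \<in> proper_colorings V adj n\<close> unfolding proper_colorings_def by auto
    thus ?thesis using partition_on_kernel[of V c]
      by (auto simp: indep_partitions_def kernel_partition_def)
  qed
  have "card (proper_colorings V adj n) = (\<Sum>c\<in>proper_colorings V adj n. 1)" by simp
  also have "\<dots> = (\<Sum>P\<in>indep_partitions V adj. \<Sum>c\<in>{c \<in> proper_colorings V adj n. kernel_partition V c = P}. 1)"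
    by (rule sum.group[symmetric]) (use fin finite_indep_partitions[OF V] img in auto)
  also have "\<dots> = (\<Sum>P\<in>indep_partitions V adj. \<Prod>i=0..<card P. n - i)"
    using card_colorings_with_kernel[OF V] by (intro sum.cong) auto
  finally show ?thesis .
qed

definition falling_poly :: "nat \<Rightarrow> rat poly" where
  "falling_poly k = (\<Prod>i=0..<k. [:- of_nat i, 1:])"

lemma poly_falling_poly: "poly (falling_poly k) (of_nat n) = of_nat (\<Prod>i=0..<k. n - i)"
proof (induction k)
  case (Suc k)
  show ?case
  proof (cases "k \<le> n")
    case True
    thus ?thesis using Suc by (simp add: falling_poly_def of_nat_diff algebra_simps)
  next
    case False
    hence "(\<Prod>i=0..<k. n - i) = 0" by (auto simp: prod_zero_iff intro!: bexI[of _ n])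
    hence "(\<Prod>i=0..<Suc k. n - i) = 0" "poly (falling_poly k) (of_nat n) = 0"
      unfolding Suc by simp_all
    thus ?thesis unfolding falling_poly_def by simp
  qed
qed (simp add: falling_poly_def)

text \<open>A polynomial is fixed by its values on the infinitely many naturals, so the
  \<open>THE\<close> in the definition denotes this sum.\<close>

lemma chromatic_polynomial_eq:
  assumes V: "finite V"
  shows "chromatic_polynomial V adj = (\<Sum>P\<in>indep_partitions V adj. falling_poly (card P))"
  unfolding chromatic_polynomial_def
proof (rule the_equality)
  show *: "\<forall>n. poly (\<Sum>P\<in>indep_partitions V adj. falling_poly (card P)) (of_nat n) = 
      of_nat (card (proper_colorings V adj n))"
    by (simp add: poly_sum poly_falling_poly card_proper_colorings[OF V])
  fix r :: "rat poly" assume "\<forall>n. poly r (of_nat n) = of_nat (card (proper_colorings V adj n))"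
  hence eq: "poly r (of_nat n) = poly (\<Sum>P\<in>indep_partitions V adj. falling_poly (card P)) (of_nat n)" for n
    using * by simp
  have "infinite (range (of_nat :: nat \<Rightarrow> rat))" by (rule range_inj_infinite) (simp add: inj_on_def)
  moreover have "range (of_nat :: nat \<Rightarrow> rat) \<subseteq> 
      {x. poly (r - (\<Sum>P\<in>indep_partitions V adj. falling_poly (card P))) x = 0}"
    using eq by auto
  ultimately have "infinite {x. poly (r - (\<Sum>P\<in>indep_partitions V adj. falling_poly (card P))) x = 0}"
    using finite_subset by blast
  hence "r - (\<Sum>P\<in>indep_partitions V adj. falling_poly (card P)) = 0"
    using poly_roots_finite by blast
  thus "r = (\<Sum>P\<in>indep_partitions V adj. falling_poly (card P))" by simp
qed

section \<open>Leading coefficients of falling factorials\<close>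

lemma falling_poly_Suc: "falling_poly (Suc k) = [:- of_nat k, 1:] * falling_poly k"
  by (simp add: falling_poly_def mult.commute)

lemma coeff_falling_poly_Suc:
  "Polynomial.coeff (falling_poly (Suc k)) (Suc j) = Polynomial.coeff (falling_poly k) j - of_nat k * Polynomial.coeff (falling_poly k) (Suc j)"
  by (simp add: falling_poly_Suc)

lemma coeff_falling_poly_0: "k > 0 \<Longrightarrow> Polynomial.coeff (falling_poly k) 0 = 0"
proof (induction k)
  case (Suc k)
  have "Polynomial.coeff (falling_poly (Suc k)) 0 = - of_nat k * Polynomial.coeff (falling_poly k) 0"
    by (simp add: falling_poly_Suc)
  thus ?case using Suc by (cases "k = 0") auto
qed simp

lemma degree_falling_poly: "Polynomial.degree (falling_poly k) = k"
  unfolding falling_poly_def by (subst degree_prod_eq_sum_degree) auto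

lemma coeff_falling_poly_degree: "Polynomial.coeff (falling_poly k) k = 1"
proof (induction k)
  case (Suc k)
  have "Polynomial.coeff (falling_poly k) (Suc k) = 0" by (rule coeff_eq_0) (simp add: degree_falling_poly)
  thus ?case using Suc by (simp add: coeff_falling_poly_Suc)
qed (simp add: falling_poly_def)

text \<open>With \<open>k = j + 1\<close> this is the signed Stirling number s(k, k - 1); the two
  formulas after it are s(k, k - 2) and s(k, k - 3). Indexing by the exponent \<open>j\<close>
  avoids subtraction of naturals, and the recurrence then expresses each step in \<open>j\<close>
  through the preceding formula.\<close>

lemma coeff_falling_poly_1:
  "Polynomial.coeff (falling_poly (j + 1)) j = - of_nat ((j + 1) * j) / 2"
proof (induction j)
  case (Suc j)
  show ?case using Suc coeff_falling_poly_Suc[of "Suc j" j] coeff_falling_poly_degree[of "Suc j"]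
    by (simp add: field_simps)
qed (simp add: coeff_falling_poly_0)

lemma coeff_falling_poly_2:
  "Polynomial.coeff (falling_poly (j + 2)) j = 
    (of_nat j + 2) * (of_nat j + 1) * of_nat j * (3 * (of_nat j + 2) - 1) / 24"
proof (induction j)
  case (Suc j)
  have "Polynomial.coeff (falling_poly (Suc j + 2)) (Suc j) = Polynomial.coeff (falling_poly (j + 2)) j
      - of_nat (j + 2) * Polynomial.coeff (falling_poly (Suc j + 1)) (Suc j)"
    using coeff_falling_poly_Suc[of "j + 2" j] by simp
  thus ?case unfolding Suc.IH coeff_falling_poly_1 by (simp add: field_simps)
qed (simp add: coeff_falling_poly_0)

text \<open>The value is \<open>- (k choose 2) * (k choose 4)\<close> for
  \<open>k = j + 3\<close>.\<close>

lemma coeff_falling_poly_3: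
  "Polynomial.coeff (falling_poly (j + 3)) j = 
    - ((of_nat j + 3)\<^sup>2 * (of_nat j + 2)\<^sup>2 * (of_nat j + 1) * of_nat j / 48)"
proof (induction j)
  case (Suc j)
  have "Polynomial.coeff (falling_poly (Suc j + 3)) (Suc j) = Polynomial.coeff (falling_poly (j + 3)) j
      - of_nat (j + 3) * Polynomial.coeff (falling_poly (Suc j + 2)) (Suc j)"
    using coeff_falling_poly_Suc[of "j + 3" j] by (simp add: numeral_eq_Suc)
  thus ?case unfolding Suc.IH coeff_falling_poly_2 by (simp add: field_simps power2_eq_square)
qed (simp add: coeff_falling_poly_0)

subsection \<open>Partitions of a graph into few cliques\<close>

text \<open>For \<open>F = edges\<close> these are the matchings with \<open>k\<close>
  edges.\<close>

definition packings :: "nat \<Rightarrow> 'a set set \<Rightarrow> 'a set set set" where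
  "packings k F = {N. N \<subseteq> F \<and> card N = k \<and> disjoint N}"

lemma finite_packings: "finite F \<Longrightarrow> finite (packings k F)"
  by (rule finite_subset[of _ "Pow F"]) (auto simp: packings_def)

lemma packings_one:
  assumes "finite F"
  shows "card (packings 1 F) = card F"
proof -
  have "packings 1 F = (\<lambda>B. {B}) ` F"
  proof (intro equalityI subsetI)
    fix N assume N: "N \<in> packings 1 F"
    hence "card N = 1" by (simp add: packings_def)
    then obtain B where "N = {B}" by (rule card_1_singletonE)
    thus "N \<in> (\<lambda>B. {B}) ` F" using N by (auto simp: packings_def)
  qed (auto simp: packings_def disjoint_def)
  thus ?thesis by (simp add: card_image)
qed

lemma disjoint_insert_iff:
  assumes "B \<notin> N"
  shows "disjoint (insert B N) \<longleftrightarrow> disjoint N \<and> (\<forall>C\<in>N. C \<inter> B = {})"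
  using assms by (auto simp: pairwise_insert disjnt_def)

text \<open>Count pairs of a packing and a member \<open>B\<close> of it. Removing \<open>B\<close>
  leaves a packing of sets disjoint from \<open>B\<close>; adding it back raises the cardinality
  because a nonempty \<open>B\<close> is not disjoint from itself.\<close>

lemma card_packings_Suc:
  assumes F: "finite F" and ne: "{} \<notin> F"
  shows "Suc k * card (packings (Suc k) F) = (\<Sum>B\<in>F. card (packings k {C\<in>F. C \<inter> B = {}}))"
proof -
  have "Suc k * card (packings (Suc k) F) = (\<Sum>N\<in>packings (Suc k) F. card N)"
    by (simp add: packings_def)
  also have "\<dots> = (\<Sum>N\<in>packings (Suc k) F. \<Sum>B\<in>{B\<in>F. B \<in> N}. 1)"
  proof (intro sum.cong refl)
    fix N assume "N \<in> packings (Suc k) F"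
    hence "{B\<in>F. B \<in> N} = N" by (auto simp: packings_def)
    thus "card N = (\<Sum>B\<in>{B\<in>F. B \<in> N}. 1)" by simp
  qed
  also have "\<dots> = (\<Sum>B\<in>F. \<Sum>N\<in>{N\<in>packings (Suc k) F. B \<in> N}. 1)"
    by (rule sum.swap_restrict) (use F finite_packings in auto)
  also have "\<dots> = (\<Sum>B\<in>F. card (packings k {C\<in>F. C \<inter> B = {}}))"
  proof (intro sum.cong refl)
    fix B assume B: "B \<in> F"
    have nB: "B \<notin> N" if "N \<in> packings k {C\<in>F. C \<inter> B = {}}" for N
    proof
      assume "B \<in> N"
      hence "B \<inter> B = {}" using that unfolding packings_def by blast
      thus False using B ne by auto
    qed
    have fin: "finite N" if "N \<subseteq> F" for N using F that finite_subset by blast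
    have "bij_betw (insert B) (packings k {C\<in>F. C \<inter> B = {}}) {N\<in>packings (Suc k) F. B \<in> N}"
    proof (rule bij_betw_byWitness[where f'="\<lambda>N. N - {B}"])
      show "\<forall>N\<in>packings k {C\<in>F. C \<inter> B = {}}. insert B N - {B} = N" using nB by auto
      show "\<forall>N\<in>{N\<in>packings (Suc k) F. B \<in> N}. insert B (N - {B}) = N" by auto
      show "insert B ` packings k {C\<in>F. C \<inter> B = {}} \<subseteq> {N\<in>packings (Suc k) F. B \<in> N}"
      proof (intro image_subsetI)
        fix N assume N: "N \<in> packings k {C\<in>F. C \<inter> B = {}}"
        have "finite N" using N fin unfolding packings_def by blast
        moreover have "disjoint (insert B N)" 
          using N by (subst disjoint_insert_iff[OF nB[OF N]]) (auto simp: packings_def)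
        ultimately show "insert B N \<in> {N\<in>packings (Suc k) F. B \<in> N}"
          using N nB[OF N] B unfolding packings_def by auto
      qed
      show "(\<lambda>N. N - {B}) ` {N\<in>packings (Suc k) F. B \<in> N} \<subseteq> packings k {C\<in>F. C \<inter> B = {}}"
      proof (intro image_subsetI)
        fix N assume N: "N \<in> {N\<in>packings (Suc k) F. B \<in> N}"
        hence "finite N" using fin unfolding packings_def by blast
        have "disjoint (insert B (N - {B}))" using N by (simp add: packings_def insert_absorb)
        hence "disjoint (N - {B}) \<and> (\<forall>C\<in>N - {B}. C \<inter> B = {})"
          by (subst (asm) disjoint_insert_iff) auto
        thus "N - {B} \<in> packings k {C\<in>F. C \<inter> B = {}}"
          using N \<open>finite N\<close> unfolding packings_def by auto
      qed
    qed
    thus "(\<Sum>N\<in>{N\<in>packings (Suc k) F. B \<in> N}. 1) = card (packings k {C\<in>F. C \<inter> B = {}})"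
      using bij_betw_same_card by fastforce
  qed
  finally show ?thesis .
qed

text \<open>In the application \<open>na\<close> is non-adjacency of distinct vertices, so cliques of \<open>na\<close> are
  independent sets of the coloured graph.\<close>

locale finite_graph =
  fixes V :: "'a set" and na :: "'a \<Rightarrow> 'a \<Rightarrow> bool"
  assumes finV: "finite V"
    and na_sym: "na x y \<Longrightarrow> na y x"
    and na_irrefl: "\<not> na x x"
begin

definition clique :: "'a set \<Rightarrow> bool" where
  "clique B \<longleftrightarrow> (\<forall>x\<in>B. \<forall>y\<in>B. x \<noteq> y \<longrightarrow> na x y)"

definition cliques :: "nat \<Rightarrow> 'a set set" where
  "cliques r = {B. B \<subseteq> V \<and> card B = r \<and> clique B}"

abbreviation edges :: "'a set set" where "edges \<equiv> cliques 2"

definition clique_partitions :: "'a set set set" where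
  "clique_partitions = {P. partition_on V P \<and> (\<forall>B\<in>P. clique B)}"

text \<open>A partition into \<open>card V - r\<close> cliques is determined by its blocks with at least two elements,
  and these satisfy \<open>\<Sum> (card B - 1) = r\<close>.\<close>

definition nontrivial_packings :: "nat \<Rightarrow> 'a set set set" where
  "nontrivial_packings r = {N. N \<subseteq> {B. B \<subseteq> V \<and> clique B \<and> card B \<ge> 2} \<and> disjoint N \<and> (\<Sum>B\<in>N. card B - 1) = r}"

lemma finite_cliques: "finite (cliques r)"
  by (rule finite_subset[of _ "Pow V"]) (auto simp: cliques_def finV)

lemma finite_clique_partitions: "finite clique_partitions"
  by (rule finite_subset[OF _ finitely_many_partition_on[OF finV]]) (auto simp: clique_partitions_def)

lemma finite_subset_Pow: "N \<subseteq> {B. B \<subseteq> V \<and> Q B} \<Longrightarrow> finite N"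
  by (rule finite_subset[of _ "Pow V"]) (auto simp: finV)

lemma card_partition_defect:
  assumes P: "partition_on V P"
  shows "card P + (\<Sum>B\<in>{B\<in>P. card B \<ge> 2}. card B - 1) = card V"
proof -
  have fP: "finite P" using finite_elements[OF finV P] .
  have fB: "finite B" if "B \<in> P" for B
    using that partition_onD1[OF P] finV by (meson Sup_upper finite_subset)
  have pos: "card B \<ge> 1" if "B \<in> P" for B
    using fB[OF that] that partition_onD3[OF P] by (metis One_nat_def Suc_leI card_gt_0_iff)
  have "card V = (\<Sum>B\<in>P. card B)"
    using card_Union_disjoint[of P] partition_onD1[OF P] partition_onD2[OF P] fB
    by (simp add: disjoint_def pairwise_def disjnt_def)
  also have "\<dots> = (\<Sum>B\<in>P. 1 + (card B - 1))"
  proof (intro sum.cong refl)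
    fix B assume "B \<in> P"
    from pos[OF this] show "card B = 1 + (card B - 1)" by simp
  qed
  also have "\<dots> = card P + (\<Sum>B\<in>P. card B - 1)" by (simp only: sum.distrib) simp
  also have "(\<Sum>B\<in>P. card B - 1) = (\<Sum>B\<in>{B\<in>P. card B \<ge> 2}. card B - 1)"
    using fP by (intro sum.mono_neutral_right) auto
  finally show ?thesis by simp
qed

lemma card_clique_partitions:
  "card {P\<in>clique_partitions. card P + r = card V} = card (nontrivial_packings r)"
proof -
  let ?f = "\<lambda>P. {B\<in>P. card B \<ge> 2}"
  \<comment> \<open>The inverse refills the uncovered vertices as singleton blocks.\<close>
  let ?g = "\<lambda>N. N \<union> (\<lambda>x. {x}) ` (V - \<Union>N)"
  have g_part: "partition_on V (?g N)" and fg: "?f (?g N) = N"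
    if "N \<in> nontrivial_packings r" for N
  proof -
    have N: "N \<subseteq> {B. B \<subseteq> V \<and> clique B \<and> card B \<ge> 2}" "disjoint N"
      using that by (auto simp: nontrivial_packings_def)
    show "partition_on V (?g N)"
    proof (rule partition_onI)
      fix p q assume "p \<in> ?g N" "q \<in> ?g N" "p \<noteq> q"
      thus "disjnt p q" using N(2) by (auto simp: disjnt_iff disjoint_def)
    qed (use N in auto)
    show "?f (?g N) = N" using N(1) by auto
  qed
  have "bij_betw ?f {P\<in>clique_partitions. card P + r = card V} (nontrivial_packings r)"
  proof (rule bij_betw_byWitness[where f'="?g"])
    show "\<forall>P\<in>{P\<in>clique_partitions. card P + r = card V}. ?g (?f P) = P"
    proof
      fix P assume "P \<in> {P\<in>clique_partitions. card P + r = card V}"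
      hence P: "partition_on V P" by (simp add: clique_partitions_def)
      have uniq: "B = B'" if "B \<in> P" "B' \<in> P" "x \<in> B" "x \<in> B'" for x B B'
        using that partition_onD2[OF P] unfolding disjoint_def by blast
      have fB: "finite B" if "B \<in> P" for B
        using that partition_onD1[OF P] finV by (meson Sup_upper finite_subset)
      have sing: "\<exists>x. B = {x}" if "B \<in> P" "\<not> card B \<ge> 2" for B
      proof -
        have "card B \<noteq> 0" using that fB partition_onD3[OF P] by auto
        hence "card B = 1" using that by linarith
        thus ?thesis by (rule card_1_singletonE) blast
      qed
      show "?g (?f P) = P"
      proof (intro equalityI subsetI)
        fix B assume "B \<in> ?g (?f P)"
        then consider "B \<in> P" | x where "B = {x}" "x \<in> V" "x \<notin> \<Union>(?f P)" by auto
        thus "B \<in> P"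
        proof cases
          case 2
          have "x \<in> \<Union>P" using 2 partition_onD1[OF P] by simp
          then obtain C where C: "C \<in> P" "x \<in> C" by blast
          hence "\<not> card C \<ge> 2" using 2 by auto
          then obtain y where "C = {y}" using sing C by blast
          thus ?thesis using C 2 by auto
        qed simp
      next
        fix B assume B: "B \<in> P"
        show "B \<in> ?g (?f P)"
        proof (cases "card B \<ge> 2")
          case False
          then obtain x where x: "B = {x}" using sing B by blast
          have "x \<notin> \<Union>(?f P)"
          proof
            assume "x \<in> \<Union>(?f P)"
            then obtain C where C: "C \<in> P" "card C \<ge> 2" "x \<in> C" by blast
            hence "B = C" using uniq[OF B C(1)] x by blast
            thus False using C False by simp
          qed
          moreover have "x \<in> V" using B x partition_onD1[OF P] by auto
          ultimately show ?thesis using x by auto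
        qed (use B in auto)
      qed
    qed
    show "\<forall>N\<in>nontrivial_packings r. ?f (?g N) = N" using fg by blast
    show "?f ` {P\<in>clique_partitions. card P + r = card V} \<subseteq> nontrivial_packings r"
    proof (intro image_subsetI)
      fix P assume "P \<in> {P\<in>clique_partitions. card P + r = card V}"
      hence P: "partition_on V P" "\<And>B. B \<in> P \<Longrightarrow> clique B" and c: "card P + r = card V"
        by (auto simp: clique_partitions_def)
      have "(\<Sum>B\<in>?f P. card B - 1) = r" using card_partition_defect[OF P(1)] c by simp
      moreover have "disjoint (?f P)" using partition_onD2[OF P(1)] by (auto simp: disjoint_def)
      moreover have "B \<subseteq> V" if "B \<in> P" for B using that partition_onD1[OF P(1)] by auto
      ultimately show "?f P \<in> nontrivial_packings r" using P(2) by (auto simp: nontrivial_packings_def)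
    qed
    show "?g ` nontrivial_packings r \<subseteq> {P\<in>clique_partitions. card P + r = card V}"
    proof (intro image_subsetI)
      fix N assume N: "N \<in> nontrivial_packings r"
      have "card (?g N) + r = card V"
        using card_partition_defect[OF g_part[OF N]] N unfolding fg[OF N] by (simp add: nontrivial_packings_def)
      moreover have "clique B" if "B \<in> ?g N" for B
        using that N by (auto simp: nontrivial_packings_def clique_def)
      ultimately show "?g N \<in> {P\<in>clique_partitions. card P + r = card V}"
        using g_part[OF N] by (simp add: clique_partitions_def)
    qed
  qed
  thus ?thesis by (rule bij_betw_same_card)
qed

text \<open>The last identity comes from \<open>card B - 1 = (card B - 2) + 1\<close>. It bounds
  \<open>card N\<close> by \<open>r\<close> and shows that equality forces all blocks to be
  edges.\<close>

lemma nontrivial_packingsE: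
  assumes "N \<in> nontrivial_packings r"
  shows "finite N" "card N \<le> r" "\<And>B. B \<in> N \<Longrightarrow> B \<in> cliques (card B)" "\<And>B. B \<in> N \<Longrightarrow> card B \<ge> 2" 
    "disjoint N" "(\<Sum>B\<in>N. card B - 1) = r" "(\<Sum>B\<in>N. card B - 2) + card N = r"
proof -
  have N: "N \<subseteq> {B. B \<subseteq> V \<and> clique B \<and> card B \<ge> 2}" "disjoint N" "(\<Sum>B\<in>N. card B - 1) = r"
    using assms by (auto simp: nontrivial_packings_def)
  show f: "finite N" using N(1) finite_subset_Pow by blast
  show "\<And>B. B \<in> N \<Longrightarrow> B \<in> cliques (card B)" "\<And>B. B \<in> N \<Longrightarrow> card B \<ge> 2" "disjoint N" "(\<Sum>B\<in>N. card B - 1) = r"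
    using N by (auto simp: cliques_def)
  have "(\<Sum>B\<in>N. card B - 1) = (\<Sum>B\<in>N. (card B - 2) + 1)"
    using N(1) by (intro sum.cong) auto
  also have "\<dots> = (\<Sum>B\<in>N. card B - 2) + card N" by (simp only: sum.distrib) simp
  finally show "(\<Sum>B\<in>N. card B - 2) + card N = r" using N(3) by simp
  thus "card N \<le> r" by simp
qed

lemma nontrivial_packings_all_edges:
  "{N\<in>nontrivial_packings r. card N = r} = packings r edges"
proof (intro equalityI subsetI)
  fix N assume N: "N \<in> {N\<in>nontrivial_packings r. card N = r}"
  hence n: "N \<in> nontrivial_packings r" "card N = r" by auto
  note e = nontrivial_packingsE[OF n(1)]
  have "(\<Sum>B\<in>N. card B - 2) = 0" using e(7) n(2) by simp
  hence z: "card B - 2 = 0" if "B \<in> N" for B using that e(1) by simp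
  have "card B = 2" if "B \<in> N" for B using z[OF that] e(4)[OF that] by simp
  hence "N \<subseteq> edges" using e(3) by (metis subsetI)
  thus "N \<in> packings r edges" using e(5) n(2) by (simp add: packings_def)
next
  fix N assume "N \<in> packings r edges"
  hence N: "N \<subseteq> edges" "card N = r" "disjoint N" by (auto simp: packings_def)
  have "(\<Sum>B\<in>N. card B - 1) = (\<Sum>B\<in>N. 1)" using N(1) by (intro sum.cong) (auto simp: cliques_def)
  thus "N \<in> {N\<in>nontrivial_packings r. card N = r}"
    using N by (auto simp: nontrivial_packings_def cliques_def)
qed

lemma nontrivial_packings_single:
  assumes "r \<ge> 1"
  shows "card {N\<in>nontrivial_packings r. card N = 1} = card (cliques (Suc r))"
proof -
  have "{N\<in>nontrivial_packings r. card N = 1} = (\<lambda>B. {B}) ` cliques (Suc r)"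
  proof (intro equalityI subsetI)
    fix N assume N: "N \<in> {N\<in>nontrivial_packings r. card N = 1}"
    hence "card N = 1" by simp
    then obtain B where B: "N = {B}" by (rule card_1_singletonE)
    have n: "N \<in> nontrivial_packings r" using N by simp
    have "card B - 1 = r" "card B \<ge> 2" "B \<in> cliques (card B)"
      using nontrivial_packingsE(3,4,6)[OF n] B by simp_all
    moreover from this have "card B = Suc r" by linarith
    ultimately have "B \<in> cliques (Suc r)" by simp
    thus "N \<in> (\<lambda>B. {B}) ` cliques (Suc r)" using B by simp
  next
    fix N assume "N \<in> (\<lambda>B. {B}) ` cliques (Suc r)"
    thus "N \<in> {N\<in>nontrivial_packings r. card N = 1}"
      using assms by (auto simp: nontrivial_packings_def cliques_def disjoint_def)
  qed
  thus ?thesis by (simp add: card_image)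
qed

lemma nontrivial_packings_0: "card {N\<in>nontrivial_packings r. card N = 0} = (if r = 0 then 1 else 0)"
proof -
  have "{N\<in>nontrivial_packings r. card N = 0} = (if r = 0 then {{}} else {})"
  proof (intro equalityI subsetI)
    fix N assume N: "N \<in> {N\<in>nontrivial_packings r. card N = 0}"
    hence n: "N \<in> nontrivial_packings r" by simp
    have "N = {}" using nontrivial_packingsE(1)[OF n] N by simp
    thus "N \<in> (if r = 0 then {{}} else {})" using nontrivial_packingsE(6)[OF n] by simp
  qed (auto simp: nontrivial_packings_def split: if_splits)
  thus ?thesis by simp
qed

lemma finite_nontrivial_packings: "finite (nontrivial_packings r)"
  by (rule finite_subset[of _ "Pow (Pow V)"]) (auto simp: nontrivial_packings_def finV)

lemma card_nontrivial_packings_split: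
  "card (nontrivial_packings r) = (\<Sum>k\<le>r. card {N\<in>nontrivial_packings r. card N = k})"
proof -
  have "card (nontrivial_packings r) = (\<Sum>N\<in>nontrivial_packings r. 1)" by simp
  also have "\<dots> = (\<Sum>k\<le>r. \<Sum>N\<in>{N\<in>nontrivial_packings r. card N = k}. 1)"
    using nontrivial_packingsE(2)
    by (intro sum.group[OF finite_nontrivial_packings finite_atMost, symmetric] image_subsetI) simp
  finally show ?thesis by (simp only: card_eq_sum)
qed

text \<open>Two blocks share the defect 3 only as 2 + 1. The different sizes of triangle and edge
  make the passage from ordered to unordered pairs injective, so no factor 2 arises.\<close>

lemma card_nontrivial_packings_3_2:
  "card {N\<in>nontrivial_packings 3. card N = 2} = (\<Sum>T\<in>cliques 3. card {D\<in>edges. D \<inter> T = {}})"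
proof -
  let ?S = "Sigma (cliques 3) (\<lambda>T. {D\<in>edges. D \<inter> T = {}})"
  have img: "{N\<in>nontrivial_packings 3. card N = 2} = (\<lambda>(T, D). {T, D}) ` ?S"
  proof (intro equalityI subsetI)
    fix N assume "N \<in> {N\<in>nontrivial_packings 3. card N = 2}"
    hence N: "N \<in> nontrivial_packings 3" "card N = 2" by auto
    note e = nontrivial_packingsE[OF N(1)]
    obtain B C where BC: "N = {B, C}" "B \<noteq> C" using N(2) by (auto simp: card_2_iff)
    have s: "(card B - 1) + (card C - 1) = 3" using e(6) BC by simp
    have dj: "B \<inter> C = {}" using e(5) BC by (auto simp: disjoint_def)
    have "card B \<ge> 2" "card C \<ge> 2" using e(4) BC by auto
    hence "card B = 3 \<and> card C = 2 \<or> card B = 2 \<and> card C = 3" using s by linarith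
    thus "N \<in> (\<lambda>(T, D). {T, D}) ` ?S"
    proof
      assume "card B = 3 \<and> card C = 2"
      hence "(B, C) \<in> ?S" using e(3)[of B] e(3)[of C] BC dj by auto
      thus ?thesis using BC(1) by (intro image_eqI[of _ _ "(B, C)"]) simp_all
    next
      assume "card B = 2 \<and> card C = 3"
      hence "(C, B) \<in> ?S" using e(3)[of B] e(3)[of C] BC dj by auto
      thus ?thesis using BC(1) by (intro image_eqI[of _ _ "(C, B)"]) (simp_all add: insert_commute)
    qed
  next
    fix N assume "N \<in> (\<lambda>(T, D). {T, D}) ` ?S"
    then obtain T D where TD: "N = {T, D}" "T \<in> cliques 3" "D \<in> edges" "D \<inter> T = {}" by auto
    have "card T = 3" "card D = 2" using TD by (auto simp: cliques_def)
    moreover from this have "T \<noteq> D" by auto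
    moreover have "disjoint N" using TD by (auto simp: disjoint_def)
    moreover have "T \<subseteq> V" "D \<subseteq> V" "clique T" "clique D" using TD by (simp_all add: cliques_def)
    ultimately show "N \<in> {N\<in>nontrivial_packings 3. card N = 2}"
      using TD(1) by (simp add: nontrivial_packings_def)
  qed
  have "inj_on (\<lambda>(T, D). {T, D}) ?S"
  proof (rule inj_onI)
    fix u v assume uv: "u \<in> ?S" "v \<in> ?S" "(\<lambda>(T, D). {T, D}) u = (\<lambda>(T, D). {T, D}) v"
    obtain T D T' D' where TD: "u = (T, D)" "v = (T', D')" by (cases u, cases v)
    have "card T = 3" "card D = 2" "card T' = 3" "card D' = 2"
      using uv(1,2) unfolding TD by (simp_all add: cliques_def)
    hence "T \<noteq> D'" "D \<noteq> T'" by auto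
    moreover have "{T, D} = {T', D'}" using uv(3) unfolding TD by simp
    ultimately show "u = v" unfolding TD doubleton_eq_iff by blast
  qed
  hence "card {N\<in>nontrivial_packings 3. card N = 2} = card ?S"
    unfolding img by (rule card_image)
  also have "\<dots> = (\<Sum>T\<in>cliques 3. card {D\<in>edges. D \<inter> T = {}})"
    by (rule card_SigmaI) (auto simp: finite_cliques)
  finally show ?thesis .
qed

lemma card_clique_partitions_0: "card {P\<in>clique_partitions. card P = card V} = 1"
  using card_clique_partitions[of 0] card_nontrivial_packings_split[of 0] nontrivial_packings_0[of 0] by simp

lemma card_clique_partitions_1: "card {P\<in>clique_partitions. card P + 1 = card V} = card edges"
  using card_clique_partitions[of 1] card_nontrivial_packings_split[of 1] nontrivial_packings_0[of 1]
    nontrivial_packings_single[of 1] by (simp add: numeral_2_eq_2)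

lemma card_clique_partitions_2: 
  "card {P\<in>clique_partitions. card P + 2 = card V} = card (cliques 3) + card (packings 2 edges)"
  using card_clique_partitions[of 2] card_nontrivial_packings_split[of 2] nontrivial_packings_0[of 2]
    nontrivial_packings_single[of 2] nontrivial_packings_all_edges[of 2] 
  by (simp add: numeral_eq_Suc atMost_Suc)

text \<open>The three terms correspond to writing the defect 3 as 3, 2 + 1 and 1 + 1 + 1.\<close>

lemma card_clique_partitions_3: 
  "card {P\<in>clique_partitions. card P + 3 = card V} = 
    card (cliques 4) + (\<Sum>T\<in>cliques 3. card {D\<in>edges. D \<inter> T = {}}) + card (packings 3 edges)"
  using card_clique_partitions[of 3] card_nontrivial_packings_split[of 3] nontrivial_packings_0[of 3]
    nontrivial_packings_single[of 3] nontrivial_packings_all_edges[of 3] card_nontrivial_packings_3_2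
  by (simp add: numeral_eq_Suc atMost_Suc)

end

section \<open>Cliques and matchings in a strongly regular graph\<close>

lemma int_eq_sum: "numeral k * a = sum f A \<Longrightarrow> numeral k * int a = (\<Sum>x\<in>A. int (f x))"
  by (metis of_nat_mult of_nat_numeral of_nat_sum)

lemma card_packings_two:
  assumes F: "finite F" and ne: "{} \<notin> F"
  shows "2 * card (packings 2 F) = (\<Sum>B\<in>F. card {C\<in>F. C \<inter> B = {}})"
proof -
  have "Suc 1 * card (packings (Suc 1) F) = (\<Sum>B\<in>F. card (packings 1 {C\<in>F. C \<inter> B = {}}))"
    by (rule card_packings_Suc[OF F ne])
  also have "\<dots> = (\<Sum>B\<in>F. card {C\<in>F. C \<inter> B = {}})"
    using F by (intro sum.cong refl packings_one) simp
  finally show ?thesis by (simp only: Suc_1)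
qed

text \<open>\<open>arcs\<close> counts every edge inside a common neighbourhood twice, once in each direction.\<close>

locale regular_graph = finite_graph +
  fixes d lam arcs :: nat
  assumes deg: "x \<in> V \<Longrightarrow> card {y\<in>V. na x y} = d"
    and codeg: "x \<in> V \<Longrightarrow> y \<in> V \<Longrightarrow> na x y \<Longrightarrow> card {z\<in>V. na x z \<and> na y z} = lam"
    and nbhd: "x \<in> V \<Longrightarrow> y \<in> V \<Longrightarrow> na x y \<Longrightarrow> 
      (\<Sum>z\<in>{z\<in>V. na x z \<and> na y z}. card {w\<in>{z\<in>V. na x z \<and> na y z}. na z w}) = arcs"

context finite_graph
begin

lemma edgesE:
  assumes "D \<in> edges"
  obtains x y where "D = {x, y}" "x \<noteq> y" "na x y" "na y x" "x \<in> V" "y \<in> V"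
proof -
  have "card D = 2" "D \<subseteq> V" "clique D" using assms by (auto simp: cliques_def)
  then obtain x y where "D = {x, y}" "x \<noteq> y" by (auto simp: card_2_iff)
  thus ?thesis using that \<open>D \<subseteq> V\<close> \<open>clique D\<close> by (auto simp: clique_def)
qed

lemma edgesI: "x \<in> V \<Longrightarrow> y \<in> V \<Longrightarrow> na x y \<Longrightarrow> {x, y} \<in> edges"
  using na_sym na_irrefl by (auto simp: cliques_def clique_def card_insert_if)

lemma edges_subset: "D \<in> edges \<Longrightarrow> D \<subseteq> V" "D \<in> edges \<Longrightarrow> finite D" "D \<in> edges \<Longrightarrow> card D = 2"
  using finV finite_subset by (auto simp: cliques_def)

lemma card_edges_at:
  assumes v: "v \<in> S" "S \<subseteq> V"
  shows "card {D\<in>edges. v \<in> D \<and> D \<subseteq> S} = card {y\<in>S. na v y}"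
proof -
  have "{D\<in>edges. v \<in> D \<and> D \<subseteq> S} = (\<lambda>y. {v, y}) ` {y\<in>S. na v y}"
  proof (intro equalityI subsetI)
    fix D assume D: "D \<in> {D\<in>edges. v \<in> D \<and> D \<subseteq> S}"
    hence "D \<in> edges" by simp
    then obtain x y where xy: "D = {x, y}" "na x y" "na y x" by (rule edgesE)
    have "v = x \<or> v = y" using D xy by auto
    thus "D \<in> (\<lambda>y. {v, y}) ` {y\<in>S. na v y}"
    proof
      assume "v = x"
      thus ?thesis using xy D by (intro image_eqI[of _ _ y]) auto
    next
      assume "v = y"
      thus ?thesis using xy D by (intro image_eqI[of _ _ x]) auto
    qed
  next
    fix D assume "D \<in> (\<lambda>y. {v, y}) ` {y\<in>S. na v y}"
    then obtain y where "D = {v, y}" "y \<in> S" "na v y" by blast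
    thus "D \<in> {D\<in>edges. v \<in> D \<and> D \<subseteq> S}" using edgesI[of v y] v by auto
  qed
  moreover have "inj_on (\<lambda>y. {v, y}) {y\<in>S. na v y}"
    by (rule inj_onI) (auto simp: doubleton_eq_iff)
  ultimately show ?thesis by (simp add: card_image)
qed

lemma sum_card_incident:
  assumes S: "S \<subseteq> V" and F: "F \<subseteq> edges"
  shows "(\<Sum>v\<in>S. card {D\<in>F. v \<in> D}) = (\<Sum>D\<in>F. card (D \<inter> S))"
proof -
  have fin: "finite S" "finite F" using S F finV finite_cliques finite_subset by blast+
  have "(\<Sum>v\<in>S. card {D\<in>F. v \<in> D}) = (\<Sum>v\<in>S. \<Sum>D\<in>{D\<in>F. v \<in> D}. 1)" by simp
  also have "\<dots> = (\<Sum>D\<in>F. \<Sum>v\<in>{v\<in>S. v \<in> D}. 1)"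
    by (rule sum.swap_restrict[OF fin])
  also have "\<dots> = (\<Sum>D\<in>F. card (D \<inter> S))"
    by (intro sum.cong refl) (simp add: Int_def conj_commute)
  finally show ?thesis .
qed

text \<open>Stated for induced subgraphs, since it is applied to the whole graph, to common
  neighbourhoods and to unions of two edges.\<close>

lemma handshake:
  assumes S: "S \<subseteq> V"
  shows "2 * card {D\<in>edges. D \<subseteq> S} = (\<Sum>v\<in>S. card {y\<in>S. na v y})"
proof -
  have "(\<Sum>v\<in>S. card {y\<in>S. na v y}) = (\<Sum>v\<in>S. card {D\<in>{D\<in>edges. D \<subseteq> S}. v \<in> D})"
  proof (intro sum.cong refl)
    fix v assume "v \<in> S"
    have "{D\<in>{D\<in>edges. D \<subseteq> S}. v \<in> D} = {D\<in>edges. v \<in> D \<and> D \<subseteq> S}" by auto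
    thus "card {y\<in>S. na v y} = card {D\<in>{D\<in>edges. D \<subseteq> S}. v \<in> D}"
      using card_edges_at[OF \<open>v \<in> S\<close> S] by simp
  qed
  also have "\<dots> = (\<Sum>D\<in>{D\<in>edges. D \<subseteq> S}. card (D \<inter> S))"
    by (rule sum_card_incident[OF S]) auto
  also have "\<dots> = (\<Sum>D\<in>{D\<in>edges. D \<subseteq> S}. 2)"
    by (intro sum.cong refl) (auto simp: Int_absorb2 edges_subset)
  finally show ?thesis by simp
qed

end

context regular_graph
begin

lemma card_edges_at_vertex: "v \<in> V \<Longrightarrow> card {D\<in>edges. v \<in> D} = d"
proof -
  assume v: "v \<in> V"
  have "{D\<in>edges. v \<in> D} = {D\<in>edges. v \<in> D \<and> D \<subseteq> V}" using edges_subset by auto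
  thus ?thesis using card_edges_at[OF v order_refl] deg[OF v] by simp
qed

lemma card_edges: "2 * card edges = d * card V"
proof -
  have "{D\<in>edges. D \<subseteq> V} = edges" using edges_subset by auto
  thus ?thesis using handshake[OF order_refl] deg by simp
qed

text \<open>An edge meets \<open>S\<close> in 0, 1 or 2 vertices, and in each case the indicator of
  \<open>D \<inter> S = {}\<close> plus \<open>card (D \<inter> S)\<close> is 1 plus the indicator
  of \<open>D \<subseteq> S\<close>. The additive form keeps the identity within the
  naturals.\<close>

lemma card_edges_avoiding:
  assumes S: "S \<subseteq> V"
  shows "card {D\<in>edges. D \<inter> S = {}} + d * card S = card edges + card {D\<in>edges. D \<subseteq> S}"
proof -
  have fS: "finite S" using S finV finite_subset by blast
  have "d * card S = (\<Sum>v\<in>S. card {D\<in>edges. v \<in> D})"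
    using S card_edges_at_vertex by (simp add: subset_iff)
  also have "\<dots> = (\<Sum>D\<in>edges. card (D \<inter> S))" by (rule sum_card_incident[OF S order_refl])
  finally have 1: "d * card S = (\<Sum>D\<in>edges. card (D \<inter> S))" .
  have "card {D\<in>edges. D \<inter> S = {}} + d * card S = (\<Sum>D\<in>edges. of_bool (D \<inter> S = {}) + card (D \<inter> S))"
    unfolding 1 sum.distrib by (simp add: finite_cliques Collect_conj_eq)
  also have "\<dots> = (\<Sum>D\<in>edges. 1 + of_bool (D \<subseteq> S))"
  proof (intro sum.cong refl)
    fix D assume "D \<in> edges"
    then obtain x y where "D = {x, y}" "x \<noteq> y" by (rule edgesE)
    thus "of_bool (D \<inter> S = {}) + card (D \<inter> S) = 1 + of_bool (D \<subseteq> S)"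
      by (cases "x \<in> S"; cases "y \<in> S") (simp_all add: Int_insert_left)
  qed
  also have "\<dots> = card edges + card {D\<in>edges. D \<subseteq> S}"
    unfolding sum.distrib by (simp add: finite_cliques Collect_conj_eq)
  finally show ?thesis .
qed

lemma card_edges_in_clique:
  assumes "B \<in> cliques r"
  shows "card {D\<in>edges. D \<subseteq> B} = r choose 2"
proof -
  have B: "B \<subseteq> V" "card B = r" "clique B" "finite B"
    using assms finV finite_subset by (auto simp: cliques_def)
  have "{D\<in>edges. D \<subseteq> B} = {D. D \<subseteq> B \<and> card D = 2}"
    using B by (auto simp: cliques_def clique_def)
  thus ?thesis using n_subsets[OF B(4), of 2] B(2) by simp
qed

text \<open>Pairs of an edge and an \<open>r\<close>-clique above it, counted both ways. For
  \<open>r = 3\<close> and \<open>r = 4\<close> the summands on the right are constant, determined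
  by \<open>lam\<close> and \<open>arcs\<close>.\<close>

lemma sum_cliques_edges:
  "(r choose 2) * card (cliques r) = (\<Sum>D\<in>edges. card {B\<in>cliques r. D \<subseteq> B})"
proof -
  have "(\<Sum>D\<in>edges. \<Sum>B\<in>{B\<in>cliques r. D \<subseteq> B}. 1) = (\<Sum>B\<in>cliques r. \<Sum>D\<in>{D\<in>edges. D \<subseteq> B}. 1)"
    by (rule sum.swap_restrict[OF finite_cliques finite_cliques])
  also have "\<dots> = (\<Sum>B\<in>cliques r. r choose 2)"
    using card_edges_in_clique by (intro sum.cong) auto
  finally show ?thesis by simp
qed

lemma card_triangles: "3 * card (cliques 3) = card edges * lam"
proof -
  have "card {B\<in>cliques 3. D \<subseteq> B} = lam" if D: "D \<in> edges" for D
  proof -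
    obtain x y where xy: "D = {x, y}" "x \<noteq> y" "na x y" "na y x" "x \<in> V" "y \<in> V" 
      using D by (rule edgesE)
    let ?C = "{z\<in>V. na x z \<and> na y z}"
    have "{B\<in>cliques 3. D \<subseteq> B} = (\<lambda>z. insert z D) ` ?C"
    proof (intro equalityI subsetI)
      fix B assume "B \<in> {B\<in>cliques 3. D \<subseteq> B}"
      hence B: "B \<subseteq> V" "card B = 3" "clique B" "D \<subseteq> B" by (auto simp: cliques_def)
      have "card (B - D) = 1" using B xy(1,2) by (subst card_Diff_subset) auto
      then obtain z where z: "B - D = {z}" by (rule card_1_singletonE)
      hence "z \<in> B - D" by simp
      hence zB: "z \<in> B" "z \<notin> D" by simp_all
      hence "z \<noteq> x" "z \<noteq> y" unfolding xy(1) by simp_all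
      moreover have "x \<in> B" "y \<in> B" using B(4) unfolding xy(1) by simp_all
      ultimately have "na x z" "na y z" "z \<in> V"
        using B(3)[unfolded clique_def, rule_format, of _ z] B(1) zB(1) by auto
      hence "z \<in> ?C" by simp
      moreover have "B = insert z D" using z B by auto
      ultimately show "B \<in> (\<lambda>z. insert z D) ` ?C" by blast
    next
      fix B assume "B \<in> (\<lambda>z. insert z D) ` ?C"
      then obtain z where z: "B = insert z D" "z \<in> V" "na x z" "na y z" by blast
      moreover have "z \<noteq> x" "z \<noteq> y" using z na_irrefl by auto
      moreover have "na z x" "na z y" using z na_sym by auto
      ultimately show "B \<in> {B\<in>cliques 3. D \<subseteq> B}"
        using xy by (auto simp: cliques_def clique_def)
    qed
    moreover have "inj_on (\<lambda>z. insert z D) ?C"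
    proof (rule inj_onI)
      fix z w assume zw: "z \<in> ?C" "w \<in> ?C" "insert z D = insert w D"
      hence "z \<notin> D" "w \<notin> D" using xy na_irrefl by auto
      thus "z = w" using zw(3) by auto
    qed
    ultimately show ?thesis using codeg[OF xy(5,6,3)] by (simp add: card_image)
  qed
  hence "(\<Sum>D\<in>edges. card {B\<in>cliques 3. D \<subseteq> B}) = (\<Sum>D\<in>edges. lam)" by (intro sum.cong) auto
  hence 1: "(\<Sum>D\<in>edges. card {B\<in>cliques 3. D \<subseteq> B}) = card edges * lam"
    by (simp only: sum_constant of_nat_id)
  have "(3::nat) choose 2 = 3" by (simp add: choose_two)
  thus ?thesis using sum_cliques_edges[of 3] 1 by simp
qed

text \<open>Over a fixed edge, 4-cliques correspond to edges inside its common neighbourhood. The 12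
  is the 6 edges of a 4-clique times the 2 directions counted in \<open>arcs\<close>.\<close>

lemma card_4_cliques: "12 * card (cliques 4) = card edges * arcs"
proof -
  have "2 * card {B\<in>cliques 4. D \<subseteq> B} = arcs" if D: "D \<in> edges" for D
  proof -
    obtain x y where xy: "D = {x, y}" "x \<noteq> y" "na x y" "na y x" "x \<in> V" "y \<in> V" 
      using D by (rule edgesE)
    let ?C = "{z\<in>V. na x z \<and> na y z}"
    have dj: "E \<inter> D = {}" if "E \<subseteq> ?C" for E using that xy na_irrefl by auto
    have "bij_betw (\<lambda>B. B - D) {B\<in>cliques 4. D \<subseteq> B} {E\<in>edges. E \<subseteq> ?C}"
    proof (rule bij_betw_byWitness[where f'="\<lambda>E. E \<union> D"])
      show "\<forall>B\<in>{B\<in>cliques 4. D \<subseteq> B}. B - D \<union> D = B" by auto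
      show "\<forall>E\<in>{E\<in>edges. E \<subseteq> ?C}. E \<union> D - D = E" using dj by blast
      show "(\<lambda>B. B - D) ` {B\<in>cliques 4. D \<subseteq> B} \<subseteq> {E\<in>edges. E \<subseteq> ?C}"
      proof (intro image_subsetI)
        fix B assume "B \<in> {B\<in>cliques 4. D \<subseteq> B}"
        hence B: "B \<subseteq> V" "card B = 4" "clique B" "D \<subseteq> B" by (auto simp: cliques_def)
        have "card (B - D) = 2" using B xy(1,2) by (subst card_Diff_subset) auto
        moreover have "clique (B - D)" using B(3) by (auto simp: clique_def)
        moreover have "B - D \<subseteq> ?C" using B xy by (auto simp: clique_def)
        ultimately show "B - D \<in> {E\<in>edges. E \<subseteq> ?C}" by (auto simp: cliques_def)
      qed
      show "(\<lambda>E. E \<union> D) ` {E\<in>edges. E \<subseteq> ?C} \<subseteq> {B\<in>cliques 4. D \<subseteq> B}"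
      proof (intro image_subsetI)
        fix E assume E: "E \<in> {E\<in>edges. E \<subseteq> ?C}"
        have "card (E \<union> D) = 4"
          using E xy(1,2) dj by (subst card_Un_disjoint) (auto simp: edges_subset)
        moreover have "clique (E \<union> D)"
          unfolding clique_def
        proof (intro ballI impI)
          fix u v assume uv: "u \<in> E \<union> D" "v \<in> E \<union> D" "u \<noteq> v"
          have 1: "clique E" using E by (auto simp: cliques_def)
          have 2: "na a b" "na b a" if "a \<in> E" "b \<in> D" for a b
            using that E xy na_sym by blast+
          have 3: "clique D" using D by (auto simp: cliques_def)
          show "na u v" using uv 1 2 3 unfolding clique_def by blast
        qed
        moreover have "E \<union> D \<subseteq> V" using E xy by auto
        ultimately show "E \<union> D \<in> {B\<in>cliques 4. D \<subseteq> B}" by (auto simp: cliques_def)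
      qed
    qed
    hence "card {B\<in>cliques 4. D \<subseteq> B} = card {E\<in>edges. E \<subseteq> ?C}" by (rule bij_betw_same_card)
    thus ?thesis using handshake[of ?C] nbhd[OF xy(5,6,3)] by auto
  qed
  hence "(\<Sum>D\<in>edges. 2 * card {B\<in>cliques 4. D \<subseteq> B}) = (\<Sum>D\<in>edges. arcs)" by (intro sum.cong) auto
  hence 1: "2 * (\<Sum>D\<in>edges. card {B\<in>cliques 4. D \<subseteq> B}) = card edges * arcs"
    by (simp only: sum_distrib_left[symmetric] sum_constant of_nat_id)
  have "(4::nat) choose 2 = 6" by (simp add: choose_two)
  thus ?thesis using sum_cliques_edges[of 4] 1 by simp
qed

lemma card_edges_avoiding_edge:
  assumes "B \<in> edges"
  shows "int (card {D\<in>edges. D \<inter> B = {}}) = int (card edges) - 2 * int d + 1"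
  using card_edges_avoiding[of B] card_edges_in_clique[OF assms] edges_subset[OF assms] 
  by (simp add: numeral_eq_Suc)

lemma card_edges_avoiding_triangle:
  assumes "T \<in> cliques 3"
  shows "int (card {D\<in>edges. D \<inter> T = {}}) = int (card edges) - 3 * int d + 3"
proof -
  have "T \<subseteq> V" "card T = 3" using assms by (auto simp: cliques_def)
  thus ?thesis using card_edges_avoiding[of T] card_edges_in_clique[OF assms] by (simp add: numeral_eq_Suc)
qed

text \<open>For disjoint sets this is the number of edges between them. For \<open>B = C\<close>
  every inner edge counts twice, which lets the edges within a union be split into four such
  terms.\<close>

definition cross :: "'a set \<Rightarrow> 'a set \<Rightarrow> nat" where
  "cross B C = (\<Sum>v\<in>B. card {y\<in>C. na v y})"

lemma cross_commute:
  assumes "finite B" "finite C"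
  shows "cross B C = cross C B"
proof -
  have "cross B C = (\<Sum>v\<in>B. \<Sum>y\<in>{y\<in>C. na v y}. 1)" by (simp add: cross_def)
  also have "\<dots> = (\<Sum>y\<in>C. \<Sum>v\<in>{v\<in>B. na v y}. 1)" by (rule sum.swap_restrict[OF assms])
  also have "\<dots> = cross C B" unfolding cross_def
    by (intro sum.cong refl) (auto intro!: arg_cong[where f=card] na_sym)
  finally show ?thesis .
qed

lemma card_edges_in_union:
  assumes B: "B \<in> edges" and C: "C \<in> edges" and BC: "C \<inter> B = {}"
  shows "card {D\<in>edges. D \<subseteq> B \<union> C} = 2 + cross B C"
proof -
  have f: "finite B" "finite C" "B \<subseteq> V" "C \<subseteq> V" using B C edges_subset by auto
  have e: "cross D D = 2" if "D \<in> edges" for D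
    using handshake[of D] card_edges_in_clique[OF that] edges_subset[OF that]
    by (simp add: cross_def numeral_eq_Suc)
  have split: "card {y\<in>B \<union> C. na v y} = card {y\<in>B. na v y} + card {y\<in>C. na v y}" for v
  proof -
    have "{y\<in>B \<union> C. na v y} = {y\<in>B. na v y} \<union> {y\<in>C. na v y}" by auto
    thus ?thesis using f BC by (auto intro!: card_Un_disjoint)
  qed
  have "2 * card {D\<in>edges. D \<subseteq> B \<union> C} = (\<Sum>v\<in>B \<union> C. card {y\<in>B \<union> C. na v y})"
    using f by (intro handshake) auto
  also have "\<dots> = (\<Sum>v\<in>B. card {y\<in>B \<union> C. na v y}) + (\<Sum>v\<in>C. card {y\<in>B \<union> C. na v y})"
    using f BC by (intro sum.union_disjoint) auto
  also have "\<dots> = cross B B + cross B C + (cross C B + cross C C)"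
    unfolding split sum.distrib cross_def ..
  finally show ?thesis using e[OF B] e[OF C] cross_commute[OF f(1,2)] by simp
qed

text \<open>The number of edges joining \<open>B\<close> to a disjoint edge \<open>C\<close> varies
  with \<open>C\<close>, but the total is fixed by \<open>d\<close> and \<open>lam\<close>. This
  makes the number of 3-matchings a function of the parameters.\<close>

lemma sum_cross:
  assumes B: "B \<in> edges"
  shows "(\<Sum>C\<in>{C\<in>edges. C \<inter> B = {}}. int (cross B C)) = 2 * ((int d - 1)\<^sup>2 - int lam)"
proof -
  let ?F = "{C\<in>edges. C \<inter> B = {}}"
  have fF: "finite ?F" using finite_cliques by simp
  have fB: "finite B" "B \<subseteq> V" using B edges_subset by auto
  \<comment> \<open>An edge through \<open>y\<close> that avoids \<open>B\<close> amounts to a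
    neighbour of \<open>y\<close> outside \<open>B\<close>.\<close>
  have at: "int (card {C\<in>?F. y \<in> C}) = int d - int (card {z\<in>B. na y z})" if y: "y \<in> V - B" for y
  proof -
    have "{C\<in>?F. y \<in> C} = {C\<in>edges. y \<in> C \<and> C \<subseteq> V - B}" using edges_subset by auto
    hence "card {C\<in>?F. y \<in> C} = card {z\<in>V - B. na y z}"
      using card_edges_at[OF y, of] by auto
    also have "{z\<in>V - B. na y z} = {z\<in>V. na y z} - {z\<in>B. na y z}" by auto
    also have "card \<dots> = d - card {z\<in>B. na y z}"
      using fB y deg[of y] by (subst card_Diff_subset) auto
    also have "int \<dots> = int d - int (card {z\<in>B. na y z})"
    proof -
      have "card {z\<in>B. na y z} \<le> card {z\<in>V. na y z}" using fB finV by (intro card_mono) auto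
      thus ?thesis using y deg[of y] by (simp add: of_nat_diff)
    qed
    finally show ?thesis .
  qed
  have inner: "(\<Sum>C\<in>?F. int (card {y\<in>C. na v y})) = 
      (\<Sum>y\<in>{y\<in>V - B. na v y}. int d - int (card {z\<in>B. na y z}))" for v
  proof -
    have "(\<Sum>C\<in>?F. int (card {y\<in>C. na v y})) = (\<Sum>C\<in>?F. \<Sum>y\<in>{y\<in>{y\<in>V - B. na v y}. y \<in> C}. 1)"
    proof (intro sum.cong refl)
      fix C assume "C \<in> ?F"
      hence "{y\<in>{y\<in>V - B. na v y}. y \<in> C} = {y\<in>C. na v y}" using edges_subset by auto
      thus "int (card {y\<in>C. na v y}) = (\<Sum>y\<in>{y\<in>{y\<in>V - B. na v y}. y \<in> C}. 1)" by simp
    qed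
    also have "\<dots> = (\<Sum>y\<in>{y\<in>V - B. na v y}. \<Sum>C\<in>{C\<in>?F. y \<in> C}. 1)"
      by (rule sum.swap_restrict) (use fF finV in auto)
    also have "\<dots> = (\<Sum>y\<in>{y\<in>V - B. na v y}. int d - int (card {z\<in>B. na y z}))"
    proof (intro sum.cong refl)
      fix y assume "y \<in> {y\<in>V - B. na v y}"
      hence "y \<in> V - B" by simp
      from at[OF this] show "(\<Sum>C\<in>{C\<in>?F. y \<in> C}. 1) = int d - int (card {z\<in>B. na y z})" by simp
    qed
    finally show ?thesis .
  qed
  \<comment> \<open>The endpoint \<open>v\<close> has \<open>d - 1\<close> neighbours
    \<open>y\<close> outside \<open>B\<close>. Each lies on \<open>d - 1\<close> edges avoiding
    \<open>B\<close>, or on \<open>d - 2\<close> if it is also adjacent to the other endpoint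
    \<open>w\<close>; there are \<open>lam\<close> of the latter.\<close>
  have end1: "(\<Sum>y\<in>{y\<in>V - B. na v y}. int d - int (card {z\<in>B. na y z})) = (int d - 1)\<^sup>2 - int lam"
    if vw: "B = {v, w}" "v \<noteq> w" "na v w" "v \<in> V" "w \<in> V" for v w
  proof -
    have set: "{y\<in>V - B. na v y} = {y\<in>V. na v y} - {w}" using vw na_irrefl by auto
    have fin: "finite {y\<in>V. na v y}" using finV by simp
    have "d \<ge> 1" using deg[of v] vw fin by (metis (mono_tags, lifting) One_nat_def Suc_leI card_gt_0_iff empty_iff mem_Collect_eq)
    hence c: "int (card ({y\<in>V. na v y} - {w})) = int d - 1"
      using vw fin deg[of v] by (simp add: of_nat_diff)
    have "(\<Sum>y\<in>{y\<in>V. na v y} - {w}. int d - int (card {z\<in>B. na y z})) = 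
        (\<Sum>y\<in>{y\<in>V. na v y} - {w}. (int d - 1) - of_bool (na w y))"
    proof (intro sum.cong refl)
      fix y assume y: "y \<in> {y\<in>V. na v y} - {w}"
      have "{z\<in>B. na y z} = (if na w y then {v, w} else {v})" using y vw na_sym by auto
      thus "int d - int (card {z\<in>B. na y z}) = (int d - 1) - of_bool (na w y)" using vw by simp
    qed
    also have "\<dots> = (int d - 1) * (int d - 1) - (\<Sum>y\<in>{y\<in>V. na v y} - {w}. of_bool (na w y))"
      by (simp only: sum_subtractf sum_constant c) (simp add: algebra_simps)
    also have "(\<Sum>y\<in>{y\<in>V. na v y} - {w}. of_bool (na w y)) = int (card {y\<in>{y\<in>V. na v y} - {w}. na w y})"
      using sum_of_bool_eq[of "{y\<in>V. na v y} - {w}" "na w", where ?'a=int] fin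
      by (simp only: finite_Diff Collect_conj_eq Collect_mem_eq)
    also have "{y\<in>{y\<in>V. na v y} - {w}. na w y} = {y\<in>V. na v y \<and> na w y}" using na_irrefl by auto
    also have "card \<dots> = lam" using codeg vw by simp
    finally show ?thesis unfolding set by (simp add: power2_eq_square)
  qed
  obtain x y where xy: "B = {x, y}" "x \<noteq> y" "na x y" "na y x" "x \<in> V" "y \<in> V" 
    using B by (rule edgesE)
  have "(\<Sum>C\<in>?F. int (cross B C)) = (\<Sum>v\<in>B. \<Sum>C\<in>?F. int (card {y\<in>C. na v y}))"
    unfolding cross_def of_nat_sum by (rule sum.swap)
  also have "\<dots> = (\<Sum>v\<in>B. \<Sum>y\<in>{y\<in>V - B. na v y}. int d - int (card {z\<in>B. na y z}))"
    unfolding inner ..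
  also have "\<dots> = (\<Sum>v\<in>B. (int d - 1)\<^sup>2 - int lam)"
  proof (rule sum.cong[OF refl])
    fix v assume "v \<in> B"
    note ex = end1[OF xy(1,2,3,5,6)]
    have "B = {y, x}" using xy(1) by (simp only: insert_commute)
    note ey = end1[OF this xy(2)[symmetric] xy(4,6,5)]
    from \<open>v \<in> B\<close> consider "v = x" | "v = y" using xy(1) by blast
    thus "(\<Sum>y\<in>{y\<in>V - B. na v y}. int d - int (card {z\<in>B. na y z})) = (int d - 1)\<^sup>2 - int lam"
      using ex ey by cases blast+
  qed
  also have "\<dots> = 2 * ((int d - 1)\<^sup>2 - int lam)"
    using xy(2) by (simp add: xy(1))
  finally show ?thesis .
qed

lemma empty_notin_edges: "{} \<notin> edges"
  by (auto simp: cliques_def)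

lemma card_packings_2:
  "2 * int (card (packings 2 edges)) = int (card edges) * (int (card edges) - 2 * int d + 1)"
proof -
  have "2 * card (packings 2 edges) = (\<Sum>B\<in>edges. card {C\<in>edges. C \<inter> B = {}})"
    by (rule card_packings_two[OF finite_cliques empty_notin_edges])
  hence "2 * int (card (packings 2 edges)) = (\<Sum>B\<in>edges. int (card {C\<in>edges. C \<inter> B = {}}))"
    by (rule int_eq_sum)
  also have "\<dots> = (\<Sum>B\<in>edges. int (card edges) - 2 * int d + 1)"
    using card_edges_avoiding_edge by (intro sum.cong) auto
  finally show ?thesis by simp
qed

text \<open>For disjoint edges \<open>B\<close>, \<open>C\<close> exactly
  \<open>m - 4 * d + 2 + cross B C\<close> edges avoid both, with \<open>m\<close> the number of
  edges, and \<open>sum_cross\<close> takes care of the varying term. The 6 counts the orders of the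
  three edges.\<close>

lemma card_packings_3:
  "6 * int (card (packings 3 edges)) = int (card edges) * 
     ((int (card edges) - 2 * int d + 1) * (int (card edges) - 4 * int d + 2) + 2 * ((int d - 1)\<^sup>2 - int lam))"
proof -
  define m where "m = int (card edges)"
  have step: "2 * int (card (packings 2 {C\<in>edges. C \<inter> B = {}})) = 
    (m - 2 * int d + 1) * (m - 4 * int d + 2) + 2 * ((int d - 1)\<^sup>2 - int lam)" if B: "B \<in> edges" for B
  proof -
    let ?F = "{C\<in>edges. C \<inter> B = {}}"
    have "2 * card (packings 2 ?F) = (\<Sum>C\<in>?F. card {D\<in>?F. D \<inter> C = {}})"
      using finite_cliques empty_notin_edges by (intro card_packings_two) auto
    hence "2 * int (card (packings 2 ?F)) = (\<Sum>C\<in>?F. int (card {D\<in>?F. D \<inter> C = {}}))"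
      by (rule int_eq_sum)
    also have "\<dots> = (\<Sum>C\<in>?F. (m - 4 * int d + 2) + int (cross B C))"
    proof (intro sum.cong refl)
      fix C assume "C \<in> ?F"
      hence C: "C \<in> edges" "C \<inter> B = {}" by auto
      have "{D\<in>?F. D \<inter> C = {}} = {D\<in>edges. D \<inter> (B \<union> C) = {}}" by auto
      moreover have "card (B \<union> C) = 4"
        using B C edges_subset by (subst card_Un_disjoint) auto
      moreover have "B \<union> C \<subseteq> V" using B C edges_subset by auto
      ultimately show "int (card {D\<in>?F. D \<inter> C = {}}) = (m - 4 * int d + 2) + int (cross B C)"
        using card_edges_avoiding[of "B \<union> C"] card_edges_in_union[OF B C] by (simp add: m_def)
    qed
    also have "\<dots> = int (card ?F) * (m - 4 * int d + 2) + 2 * ((int d - 1)\<^sup>2 - int lam)"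
      by (simp only: sum.distrib sum_cross[OF B]) (simp add: algebra_simps)
    also have "int (card ?F) = m - 2 * int d + 1"
      using card_edges_avoiding_edge[OF B] by (simp add: m_def)
    finally show ?thesis .
  qed
  have "3 * card (packings 3 edges) = (\<Sum>B\<in>edges. card (packings 2 {C\<in>edges. C \<inter> B = {}}))"
  proof -
    have "Suc 2 = 3" by simp
    from card_packings_Suc[OF finite_cliques empty_notin_edges, of 2, unfolded this] show ?thesis .
  qed
  hence "3 * int (card (packings 3 edges)) = (\<Sum>B\<in>edges. int (card (packings 2 {C\<in>edges. C \<inter> B = {}})))"
    by (rule int_eq_sum)
  hence "6 * int (card (packings 3 edges)) = (\<Sum>B\<in>edges. 2 * int (card (packings 2 {C\<in>edges. C \<inter> B = {}})))"
    by (simp add: sum_distrib_left[symmetric])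
  also have "\<dots> = (\<Sum>B\<in>edges. (m - 2 * int d + 1) * (m - 4 * int d + 2) + 2 * ((int d - 1)\<^sup>2 - int lam))"
    by (intro sum.cong refl step)
  finally show ?thesis by (simp add: m_def)
qed

lemma sum_triangle_edge_pairs:
  "(\<Sum>T\<in>cliques 3. int (card {D\<in>edges. D \<inter> T = {}})) = int (card (cliques 3)) * (int (card edges) - 3 * int d + 3)"
  using card_edges_avoiding_triangle by simp

end

subsection \<open>The leading coefficients for Paley graphs\<close>

text \<open>Lets an explicit expression be recognised as a polynomial by its shape, without
  computing coefficients.\<close>

definition polynomial_fun :: "(rat \<Rightarrow> rat) \<Rightarrow> bool" where
  "polynomial_fun f \<longleftrightarrow> (\<exists>p. \<forall>x. f x = poly p x)"

lemma polynomial_fun_id: "polynomial_fun (\<lambda>x. x)"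
  unfolding polynomial_fun_def by (rule exI[of _ "[:0, 1:]"]) simp

lemma polynomial_fun_const: "polynomial_fun (\<lambda>x. c)"
  unfolding polynomial_fun_def by (rule exI[of _ "[:c:]"]) simp

lemma polynomial_fun_add: "polynomial_fun f \<Longrightarrow> polynomial_fun g \<Longrightarrow> polynomial_fun (\<lambda>x. f x + g x)"
  unfolding polynomial_fun_def by (metis poly_add)

lemma polynomial_fun_diff: "polynomial_fun f \<Longrightarrow> polynomial_fun g \<Longrightarrow> polynomial_fun (\<lambda>x. f x - g x)"
  unfolding polynomial_fun_def by (metis poly_diff)

lemma polynomial_fun_mult: "polynomial_fun f \<Longrightarrow> polynomial_fun g \<Longrightarrow> polynomial_fun (\<lambda>x. f x * g x)"
  unfolding polynomial_fun_def by (metis poly_mult)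

lemma polynomial_fun_uminus: "polynomial_fun f \<Longrightarrow> polynomial_fun (\<lambda>x. - f x)"
  unfolding polynomial_fun_def by (metis poly_minus)

lemma polynomial_fun_power: "polynomial_fun f \<Longrightarrow> polynomial_fun (\<lambda>x. f x ^ k)"
  unfolding polynomial_fun_def by (metis poly_power)

lemma polynomial_fun_divide: "polynomial_fun f \<Longrightarrow> polynomial_fun (\<lambda>x. f x / c)"
  using polynomial_fun_mult[OF _ polynomial_fun_const[of "1 / c"], of f] by simp

lemmas polynomial_fun_intros = polynomial_fun_id polynomial_fun_const polynomial_fun_add
  polynomial_fun_diff polynomial_fun_mult polynomial_fun_uminus polynomial_fun_power polynomial_fun_divide

text \<open>The third coefficient with the Jacobsthal term removed from the number of arcs. Its four
  groups belong to partitions of defect 0, 1, 2 and 3: a Stirling number times 1, the edges, the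
  triangles plus 2-matchings, and the defect-3 partitions themselves. Here
  \<open>x * (x - 1) / 4\<close>, \<open>(x - 1) / 2\<close> and \<open>(x - 5) / 4\<close> are the
  edge number, degree and codegree; the terms stay unsimplified to match the expansion in
  \<open>desc_coeff_3\<close>.\<close>

definition c3_poly_part :: "rat \<Rightarrow> rat" where
  "c3_poly_part x = - (x\<^sup>2 * (x - 1)\<^sup>2 * (x - 2) * (x - 3) / 48) + 
    x * (x - 1) / 4 * ((x - 1) * (x - 2) * (x - 3) * (3 * (x - 1) - 1) / 24) + 
    (x * (x - 1) / 4 * ((x - 5) / 4) / 3 + x * (x - 1) / 4 * (x * (x - 1) / 4 - 2 * ((x - 1) / 2) + 1) / 2) * 
      (- ((x - 2) * (x - 3) / 2)) +
    (x * (x - 1) / 4 * ((x\<^sup>2 - 22 * x + 81) / 32) / 12 + 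
     x * (x - 1) / 4 * ((x - 5) / 4) / 3 * (x * (x - 1) / 4 - 3 * ((x - 1) / 2) + 3) + 
     x * (x - 1) / 4 * ((x * (x - 1) / 4 - 2 * ((x - 1) / 2) + 1) * (x * (x - 1) / 4 - 4 * ((x - 1) / 2) + 2)
     + 2 * (((x - 1) / 2 - 1)\<^sup>2 - (x - 5) / 4)) / 6)"

lemma polynomial_fun_c3: "polynomial_fun c3_poly_part"
  unfolding c3_poly_part_def by (intro polynomial_fun_intros)

context finite_graph
begin

lemma card_clique_partition_le: "P \<in> clique_partitions \<Longrightarrow> card P \<le> card V"
  using card_partition_defect[of P] by (simp add: clique_partitions_def)

text \<open>Partitions with fewer than \<open>card V - r\<close> blocks have falling factorials of
  too small a degree to contribute; the others are sorted by their defect \<open>s\<close>.\<close>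

lemma coeff_sum_falling_poly:
  assumes r: "r \<le> card V"
  shows "Polynomial.coeff (\<Sum>P\<in>clique_partitions. falling_poly (card P)) (card V - r) =
    (\<Sum>s\<le>r. of_nat (card {P\<in>clique_partitions. card P + s = card V}) * 
       Polynomial.coeff (falling_poly (card V - s)) (card V - r))"
proof -
  let ?n = "card V" and ?C = clique_partitions
  let ?c = "\<lambda>k. Polynomial.coeff (falling_poly k) (?n - r)"
  have "Polynomial.coeff (\<Sum>P\<in>?C. falling_poly (card P)) (?n - r) = (\<Sum>P\<in>?C. ?c (card P))"
    by (rule coeff_sum)
  also have "\<dots> = (\<Sum>P\<in>{P\<in>?C. ?n - card P \<le> r}. ?c (card P))"
  proof (rule sum.mono_neutral_right[OF finite_clique_partitions])
    show "\<forall>P\<in>?C - {P\<in>?C. ?n - card P \<le> r}. ?c (card P) = 0"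
      by (auto intro!: coeff_eq_0 simp: degree_falling_poly)
  qed auto
  also have "\<dots> = (\<Sum>s\<le>r. \<Sum>P\<in>{P\<in>{P\<in>?C. ?n - card P \<le> r}. ?n - card P = s}. ?c (card P))"
    by (rule sum.group[symmetric]) (simp_all add: finite_clique_partitions image_subset_iff)
  also have "\<dots> = (\<Sum>s\<le>r. of_nat (card {P\<in>?C. card P + s = ?n}) * ?c (?n - s))"
  proof (rule sum.cong[OF refl])
    fix s assume s: "s \<in> {..r}"
    have eq: "{P\<in>{P\<in>?C. ?n - card P \<le> r}. ?n - card P = s} = {P\<in>?C. card P + s = ?n}"
    proof (intro Collect_eqI iffI conjI; elim conjE)
    qed (use s r card_clique_partition_le in force)+
    have "(\<Sum>P\<in>{P\<in>?C. card P + s = ?n}. ?c (card P)) = (\<Sum>P\<in>{P\<in>?C. card P + s = ?n}. ?c (?n - s))"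
      by (rule sum.cong[OF refl]) (auto dest: sym)
    thus "(\<Sum>P\<in>{P\<in>{P\<in>?C. ?n - card P \<le> r}. ?n - card P = s}. ?c (card P)) = 
       of_nat (card {P\<in>?C. card P + s = ?n}) * ?c (?n - s)"
      unfolding eq by simp
  qed
  finally show ?thesis .
qed

end

section \<open>The Paley graph as an instance of the clique counts\<close>

context paley_prime
begin

lemma nonadj_irrefl: "\<not> nonadj x x"
  by (simp add: nonadj_def)

lemma int_card_nonadj: "int (card {y\<in>R. Q y}) = (\<Sum>y\<in>R. of_bool (Q y))"
  using sum_of_bool_eq[of R Q, where ?'a=int] by (simp only: Collect_conj_eq Collect_mem_eq finite_atLeastLessThan_int)

lemma q_eqs: "2 * ((q - 1) div 2) = q - 1" "4 * ((q - 5) div 4) = q - 5"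
  using q_mod_4 q_ge_5 by presburger+

text \<open>The evaluated character sums are read as cardinalities. Both divisions are exact because
  \<open>q\<close> is 1 modulo 4.\<close>

lemma paley_regular_graph: "regular_graph R nonadj ((q - 1) div 2) ((q - 5) div 4) (nat common_arcs)"
proof
  show "finite R" by simp
  show "nonadj x y \<Longrightarrow> nonadj y x" for x y using nonadj_sym by blast
  show "\<not> nonadj x x" for x by (rule nonadj_irrefl)
  show "card {y\<in>R. nonadj x y} = (q - 1) div 2" if "x \<in> R" for x
    using sum_nonadj[OF that] int_card_nonadj[of "nonadj x"] q_eqs(1) by linarith
  show "card {z\<in>R. nonadj x z \<and> nonadj y z} = (q - 5) div 4" if "nonadj x y" for x y
    using sum_common_nonadj[OF that] int_card_nonadj[of "\<lambda>z. nonadj x z \<and> nonadj y z"] q_eqs(2) by linarith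
  show "(\<Sum>z\<in>{z\<in>R. nonadj x z \<and> nonadj y z}. card {w\<in>{z\<in>R. nonadj x z \<and> nonadj y z}. nonadj z w}) = nat common_arcs"
    if "nonadj x y" for x y
  proof -
    let ?C = "\<lambda>z. nonadj x z \<and> nonadj y z"
    have if_sum: "(if b then sum f A else 0) = (\<Sum>w\<in>A. of_bool b * f w)" for b and f :: "int \<Rightarrow> int" and A
      by simp
    have "int (\<Sum>z\<in>{z\<in>R. ?C z}. card {w\<in>{z\<in>R. ?C z}. nonadj z w}) = 
       (\<Sum>z\<in>{z\<in>R. ?C z}. \<Sum>w\<in>R. of_bool (?C w) * of_bool (nonadj z w))"
    proof -
      have "int (card {w\<in>{z\<in>R. ?C z}. nonadj z w}) = (\<Sum>w\<in>R. of_bool (?C w) * of_bool (nonadj z w))" for z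
      proof -
        have "{w\<in>{z\<in>R. ?C z}. nonadj z w} = {w\<in>R. ?C w \<and> nonadj z w}" by auto
        thus ?thesis using int_card_nonadj[of "\<lambda>w. ?C w \<and> nonadj z w"] by (simp only: of_bool_conj)
      qed
      thus ?thesis by (simp only: of_nat_sum)
    qed
    also have "\<dots> = (\<Sum>z\<in>R. if ?C z then \<Sum>w\<in>R. of_bool (?C w) * of_bool (nonadj z w) else 0)"
      by (rule sum.inter_filter) simp
    also have "\<dots> = (\<Sum>z\<in>R. \<Sum>w\<in>R. of_bool (?C z) * of_bool (?C w) * of_bool (nonadj z w))"
    proof (rule sum.cong[OF refl])
      fix z
      show "(if ?C z then \<Sum>w\<in>R. of_bool (?C w) * of_bool (nonadj z w) else 0) =
         (\<Sum>w\<in>R. of_bool (?C z) * of_bool (?C w) * of_bool (nonadj z w) :: int)"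
        by (simp only: if_sum mult.assoc)
    qed
    also have "\<dots> = common_arcs" by (rule sum_common_nonadj_pairs[OF that])
    finally show ?thesis by linarith
  qed
qed

sublocale G: regular_graph R nonadj "(q - 1) div 2" "(q - 5) div 4" "nat common_arcs"
  by (rule paley_regular_graph)

lemma indep_partitions_paley: "indep_partitions (paley_vertices q) (paley_adj q) = G.clique_partitions"
proof -
  have "(\<forall>x\<in>B. \<forall>y\<in>B. \<not> paley_adj q x y) \<longleftrightarrow> G.clique B" if "B \<in> P" "partition_on R P" for B P
  proof -
    have BR: "B \<subseteq> R" using that(1) partition_onD1[OF that(2)] by auto
    have "\<not> paley_adj q x y \<longleftrightarrow> (x \<noteq> y \<longrightarrow> nonadj x y)" if "x \<in> B" "y \<in> B" for x y
    proof -
      have "nonadj x y \<longleftrightarrow> x \<noteq> y \<and> \<not> paley_adj q x y" 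
        by (rule nonadj_iff) (use that BR in auto)
      moreover have "\<not> paley_adj q x x" by (simp add: paley_adj_def)
      ultimately show ?thesis by blast
    qed
    thus ?thesis unfolding G.clique_def by (intro ball_cong refl)
  qed
  thus ?thesis unfolding indep_partitions_def G.clique_partitions_def paley_vertices_def
    by (intro Collect_cong conj_cong ball_cong refl) simp
qed

lemma paley_chromatic_eq: "paley_chromatic q = (\<Sum>P\<in>G.clique_partitions. falling_poly (card P))"
  unfolding paley_chromatic_def indep_partitions_paley[symmetric]
  by (rule chromatic_polynomial_eq) (simp add: paley_vertices_def)

lemma desc_coeff_paley:
  assumes "r \<le> q"
  shows "desc_coeff q (paley_chromatic q) r = 
    (\<Sum>s\<le>r. of_nat (card {P\<in>G.clique_partitions. card P + s = q}) * 
       Polynomial.coeff (falling_poly (q - s)) (q - r))"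
  using G.coeff_sum_falling_poly[of r] assms by (simp add: desc_coeff_def paley_chromatic_eq)

abbreviation Q :: rat where "Q \<equiv> of_nat q"

lemma rat_d: "of_nat ((q - 1) div 2) = (Q - 1) / 2"
  and rat_lam: "of_nat ((q - 5) div 4) = (Q - 5) / 4"
proof -
  have "of_nat (2 * ((q - 1) div 2)) = (of_nat (q - 1) :: rat)" "of_nat (4 * ((q - 5) div 4)) = (of_nat (q - 5) :: rat)"
    by (simp_all only: q_eqs)
  thus "of_nat ((q - 1) div 2) = (Q - 1) / 2" "of_nat ((q - 5) div 4) = (Q - 5) / 4"
    using q_ge_5 by (simp_all add: of_nat_diff field_simps)
qed

lemma rat_edges: "of_nat (card G.edges) = Q * (Q - 1) / 4"
proof -
  have "of_nat (2 * card G.edges) = (of_nat ((q - 1) div 2 * q) :: rat)"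
    using G.card_edges by simp
  hence "2 * of_nat (card G.edges) = (of_nat ((q - 1) div 2) * Q)"
    by (simp only: of_nat_mult of_nat_numeral)
  thus ?thesis unfolding rat_d by (simp add: field_simps)
qed

lemma rat_triangles: "of_nat (card (G.cliques 3)) = Q * (Q - 1) / 4 * ((Q - 5) / 4) / 3"
proof -
  have "of_nat (3 * card (G.cliques 3)) = (of_nat (card G.edges * ((q - 5) div 4)) :: rat)"
    by (simp only: G.card_triangles)
  thus ?thesis by (simp add: rat_lam rat_edges)
qed

lemma common_arcs_nonneg: "common_arcs \<ge> 0"
  unfolding common_arcs_def by (intro sum_nonneg) (simp add: common_ind_def)

lemma rat_4_cliques: "of_nat (card (G.cliques 4)) = Q * (Q - 1) / 4 * of_int common_arcs / 12"
proof -
  have "of_nat (12 * card (G.cliques 4)) = (of_nat (card G.edges * nat common_arcs) :: rat)"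
    by (simp only: G.card_4_cliques)
  thus ?thesis using common_arcs_nonneg by (simp add: rat_edges of_nat_nat)
qed

lemma rat_packings_2: "of_nat (card (packings 2 G.edges)) = 
   Q * (Q - 1) / 4 * (Q * (Q - 1) / 4 - 2 * ((Q - 1) / 2) + 1) / 2"
proof -
  have "rat_of_int (2 * int (card (packings 2 G.edges))) = rat_of_int (int (card G.edges) * 
     (int (card G.edges) - 2 * int ((q - 1) div 2) + 1))"
    by (simp only: G.card_packings_2)
  hence "2 * of_nat (card (packings 2 G.edges)) = (of_nat (card G.edges) * 
     (of_nat (card G.edges) - 2 * of_nat ((q - 1) div 2) + 1) :: rat)"
    by (simp only: of_int_mult of_int_add of_int_diff of_int_of_nat_eq of_int_numeral of_int_1)
  thus ?thesis unfolding rat_edges rat_d by simp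
qed

lemma rat_packings_3: "of_nat (card (packings 3 G.edges)) = 
   Q * (Q - 1) / 4 * ((Q * (Q - 1) / 4 - 2 * ((Q - 1) / 2) + 1) * (Q * (Q - 1) / 4 - 4 * ((Q - 1) / 2) + 2)
     + 2 * (((Q - 1) / 2 - 1)\<^sup>2 - (Q - 5) / 4)) / 6"
proof -
  have "rat_of_int (6 * int (card (packings 3 G.edges))) = rat_of_int (int (card G.edges) * 
     ((int (card G.edges) - 2 * int ((q - 1) div 2) + 1) * (int (card G.edges) - 4 * int ((q - 1) div 2) + 2)
       + 2 * ((int ((q - 1) div 2) - 1)\<^sup>2 - int ((q - 5) div 4))))"
    by (simp only: G.card_packings_3)
  hence "6 * of_nat (card (packings 3 G.edges)) = (of_nat (card G.edges) * 
     ((of_nat (card G.edges) - 2 * of_nat ((q - 1) div 2) + 1) * (of_nat (card G.edges) - 4 * of_nat ((q - 1) div 2) + 2)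
       + 2 * ((of_nat ((q - 1) div 2) - 1)\<^sup>2 - of_nat ((q - 5) div 4))) :: rat)"
    by (simp only: of_int_mult of_int_add of_int_diff of_int_of_nat_eq of_int_numeral of_int_1 of_int_power)
  thus ?thesis unfolding rat_edges rat_d rat_lam by simp
qed

lemma rat_triangle_edge_pairs: 
  "of_nat (\<Sum>T\<in>G.cliques 3. card {D\<in>G.edges. D \<inter> T = {}}) = 
   Q * (Q - 1) / 4 * ((Q - 5) / 4) / 3 * (Q * (Q - 1) / 4 - 3 * ((Q - 1) / 2) + 3)"
proof -
  have "rat_of_int (\<Sum>T\<in>G.cliques 3. int (card {D\<in>G.edges. D \<inter> T = {}})) = 
    rat_of_int (int (card (G.cliques 3)) * (int (card G.edges) - 3 * int ((q - 1) div 2) + 3))"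
    by (simp only: G.sum_triangle_edge_pairs)
  hence "of_nat (\<Sum>T\<in>G.cliques 3. card {D\<in>G.edges. D \<inter> T = {}}) = 
    (of_nat (card (G.cliques 3)) * (of_nat (card G.edges) - 3 * of_nat ((q - 1) div 2) + 3) :: rat)"
    by (simp only: of_int_mult of_int_add of_int_diff of_int_of_nat_eq of_int_numeral of_nat_sum of_int_sum)
  thus ?thesis unfolding rat_edges rat_d rat_triangles .
qed

lemma falling_coeffs:
  "Polynomial.coeff (falling_poly q) (q - 1) = - (Q * (Q - 1) / 2)"
  "Polynomial.coeff (falling_poly (q - 1)) (q - 2) = - ((Q - 1) * (Q - 2) / 2)"
  "Polynomial.coeff (falling_poly (q - 2)) (q - 3) = - ((Q - 2) * (Q - 3) / 2)"
  "Polynomial.coeff (falling_poly q) (q - 2) = Q * (Q - 1) * (Q - 2) * (3 * Q - 1) / 24"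
  "Polynomial.coeff (falling_poly (q - 1)) (q - 3) = (Q - 1) * (Q - 2) * (Q - 3) * (3 * (Q - 1) - 1) / 24"
  "Polynomial.coeff (falling_poly q) (q - 3) = - (Q\<^sup>2 * (Q - 1)\<^sup>2 * (Q - 2) * (Q - 3) / 48)"
proof -
  have "q = (q - 3) + 3" using q_ge_5 by simp
  then obtain j where j: "q = j + 3" by blast
  have s: "j + 3 - 1 = Suc (Suc j)" "j + 3 - 2 = Suc j" "j + 3 - 3 = j" "j + 3 = Suc (Suc (Suc j))" by simp_all
  show "Polynomial.coeff (falling_poly q) (q - 1) = - (Q * (Q - 1) / 2)"
    using coeff_falling_poly_1[of "Suc (Suc j)"] unfolding j s by (simp add: field_simps)
  show "Polynomial.coeff (falling_poly (q - 1)) (q - 2) = - ((Q - 1) * (Q - 2) / 2)"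
    using coeff_falling_poly_1[of "Suc j"] unfolding j s by (simp add: field_simps)
  show "Polynomial.coeff (falling_poly (q - 2)) (q - 3) = - ((Q - 2) * (Q - 3) / 2)"
    using coeff_falling_poly_1[of j] unfolding j s by (simp add: field_simps)
  show "Polynomial.coeff (falling_poly q) (q - 2) = Q * (Q - 1) * (Q - 2) * (3 * Q - 1) / 24"
    using coeff_falling_poly_2[of "Suc j"] unfolding j s by (simp add: field_simps)
  show "Polynomial.coeff (falling_poly (q - 1)) (q - 3) = (Q - 1) * (Q - 2) * (Q - 3) * (3 * (Q - 1) - 1) / 24"
    using coeff_falling_poly_2[of j] unfolding j s by (simp add: field_simps)
  show "Polynomial.coeff (falling_poly q) (q - 3) = - (Q\<^sup>2 * (Q - 1)\<^sup>2 * (Q - 2) * (Q - 3) / 48)"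
    using coeff_falling_poly_3[of j] unfolding j s by (simp add: field_simps power2_eq_square eval_nat_numeral)
qed

lemma clique_partition_counts:
  "card {P\<in>G.clique_partitions. card P + 0 = q} = 1"
  "card {P\<in>G.clique_partitions. card P + 1 = q} = card G.edges"
  "card {P\<in>G.clique_partitions. card P + 2 = q} = card (G.cliques 3) + card (packings 2 G.edges)"
  "card {P\<in>G.clique_partitions. card P + 3 = q} = card (G.cliques 4) + 
     (\<Sum>T\<in>G.cliques 3. card {D\<in>G.edges. D \<inter> T = {}}) + card (packings 3 G.edges)"
  using G.card_clique_partitions_0 G.card_clique_partitions_1 G.card_clique_partitions_2 G.card_clique_partitions_3
  by simp_all

lemma sum_atMost_small:
  fixes f :: "nat \<Rightarrow> rat"
  shows "(\<Sum>s\<le>0. f s) = f 0" "(\<Sum>s\<le>1. f s) = f 0 + f 1" "(\<Sum>s\<le>2. f s) = f 0 + f 1 + f 2"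
    "(\<Sum>s\<le>3. f s) = f 0 + f 1 + f 2 + f 3"
  by (simp_all add: eval_nat_numeral)

lemma desc_coeff_0: "desc_coeff q (paley_chromatic q) 0 = 1"
  unfolding desc_coeff_paley[of 0, simplified] sum_atMost_small
  using clique_partition_counts(1) coeff_falling_poly_degree[of q] by simp

lemma desc_coeff_1: "desc_coeff q (paley_chromatic q) 1 = - (Q * (Q - 1) / 2) + Q * (Q - 1) / 4"
proof -
  have le: "1 \<le> q" using q_ge_5 by simp
  show ?thesis unfolding desc_coeff_paley[OF le] sum_atMost_small clique_partition_counts
     rat_edges falling_coeffs coeff_falling_poly_degree diff_zero of_nat_1
    by (simp only: mult_1 mult_1_right)
qed

lemma desc_coeff_2: "desc_coeff q (paley_chromatic q) 2 = 
    Q * (Q - 1) * (Q - 2) * (3 * Q - 1) / 24 + Q * (Q - 1) / 4 * (- ((Q - 1) * (Q - 2) / 2)) + 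
    (Q * (Q - 1) / 4 * ((Q - 5) / 4) / 3 + Q * (Q - 1) / 4 * (Q * (Q - 1) / 4 - 2 * ((Q - 1) / 2) + 1) / 2)"
proof -
  have le: "2 \<le> q" using q_ge_5 by simp
  show ?thesis unfolding desc_coeff_paley[OF le] sum_atMost_small clique_partition_counts of_nat_add
     rat_edges rat_triangles rat_packings_2 falling_coeffs coeff_falling_poly_degree diff_zero of_nat_1
    by (simp only: mult_1 mult_1_right)
qed

lemma rat_common_arcs: "of_int common_arcs = (Q\<^sup>2 - 22 * Q + 81) / 32 + (of_int (jacobsthal 1))\<^sup>2 / 32"
proof -
  have "rat_of_int (32 * common_arcs) = rat_of_int (p\<^sup>2 - 22 * p + 81 + (jacobsthal 1)\<^sup>2)" by (simp only: common_arcs_eq)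
  thus ?thesis by (simp add: field_simps)
qed

text \<open>The constant 1536 is 4 * 32 * 12: the 4 of the edge number
  \<open>Q * (Q - 1) / 4\<close>, the 32 of \<open>common_arcs_eq\<close> and the 12 of
  \<open>card_4_cliques\<close>.\<close>

lemma desc_coeff_3: "desc_coeff q (paley_chromatic q) 3 = 
    c3_poly_part Q + Q * (Q - 1) * (of_int (jacobsthal 1))\<^sup>2 / 1536"
proof -
  have le: "3 \<le> q" using q_ge_5 by simp
  have "desc_coeff q (paley_chromatic q) 3 = - (Q\<^sup>2 * (Q - 1)\<^sup>2 * (Q - 2) * (Q - 3) / 48) + 
    Q * (Q - 1) / 4 * ((Q - 1) * (Q - 2) * (Q - 3) * (3 * (Q - 1) - 1) / 24) + 
    (Q * (Q - 1) / 4 * ((Q - 5) / 4) / 3 + Q * (Q - 1) / 4 * (Q * (Q - 1) / 4 - 2 * ((Q - 1) / 2) + 1) / 2) * 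
      (- ((Q - 2) * (Q - 3) / 2)) +
    (Q * (Q - 1) / 4 * of_int common_arcs / 12 + 
     Q * (Q - 1) / 4 * ((Q - 5) / 4) / 3 * (Q * (Q - 1) / 4 - 3 * ((Q - 1) / 2) + 3) + 
     Q * (Q - 1) / 4 * ((Q * (Q - 1) / 4 - 2 * ((Q - 1) / 2) + 1) * (Q * (Q - 1) / 4 - 4 * ((Q - 1) / 2) + 2)
     + 2 * (((Q - 1) / 2 - 1)\<^sup>2 - (Q - 5) / 4)) / 6)"
    unfolding desc_coeff_paley[OF le] sum_atMost_small clique_partition_counts of_nat_add
     rat_edges rat_triangles rat_packings_2 rat_packings_3 rat_4_cliques rat_triangle_edge_pairs 
     falling_coeffs coeff_falling_poly_degree diff_zero of_nat_1
    by (simp only: mult_1 mult_1_right)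
  thus ?thesis unfolding c3_poly_part_def rat_common_arcs by (simp add: distrib_left add_divide_distrib)
qed

lemma degree_paley_chromatic: "paley_chromatic q \<noteq> 0" "Polynomial.degree (paley_chromatic q) = q"
proof -
  have c: "Polynomial.coeff (paley_chromatic q) q = 1" using desc_coeff_0 by (simp add: desc_coeff_def)
  thus "paley_chromatic q \<noteq> 0" by auto
  have "Polynomial.degree (paley_chromatic q) \<le> q"
    unfolding paley_chromatic_eq
    by (rule degree_sum_le) (use G.finite_clique_partitions G.card_clique_partition_le degree_falling_poly in auto)
  moreover have "q \<le> Polynomial.degree (paley_chromatic q)" using c by (intro le_degree) simp
  ultimately show "Polynomial.degree (paley_chromatic q) = q" by simp
qed

end

section \<open>No polynomial for the third coefficient\<close>

lemma paley_primeI: "q \<in> paley_orders \<Longrightarrow> paley_prime q"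
  by unfold_locales (auto simp: paley_orders_def cong_def)

lemma infinite_paley_orders: "infinite paley_orders"
proof
  assume f: "finite paley_orders"
  obtain X where "(\<Sum>q\<in>{q\<in>paley_orders. q \<le> X}. 1 / real q) > (\<Sum>q\<in>paley_orders. 1 / real q)"
    using sum_inverse_paley_orders_unbounded by blast
  moreover have "(\<Sum>q\<in>{q\<in>paley_orders. q \<le> X}. 1 / real q) \<le> (\<Sum>q\<in>paley_orders. 1 / real q)"
    using f by (intro sum_mono2) auto
  ultimately show False by simp
qed

text \<open>A label of size at most \<open>2 * sqrt q\<close> with fibres of at most
  \<open>D\<close> elements keeps the reciprocal sum bounded, because the fibre over a positive
  \<open>z\<close> contributes at most \<open>4 * D / z^2\<close>. In the bound
  \<open>N + 9 * D\<close>, the \<open>N\<close> covers the primes below \<open>N\<close>, and 9 = 1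
  + 4 * 2 collects \<open>z = 0\<close> and the inverse squares.\<close>

lemma paley_orders_not_sparse:
  fixes Z :: "nat \<Rightarrow> nat"
  assumes Z: "\<And>q. q \<in> paley_orders \<Longrightarrow> q \<ge> N \<Longrightarrow> (Z q)\<^sup>2 \<le> 4 * q"
    and fib: "\<And>z. finite {q\<in>paley_orders. q \<ge> N \<and> Z q = z}" "\<And>z. card {q\<in>paley_orders. q \<ge> N \<and> Z q = z} \<le> D"
  shows False
proof -
  have bound: "(\<Sum>q\<in>{q\<in>paley_orders. q \<le> X}. 1 / real q) \<le> real N + 9 * real D" for X
  proof -
    let ?A = "{q\<in>paley_orders. q \<le> X}" and ?B = "{q\<in>paley_orders. N \<le> q \<and> q \<le> X}"
    have pos: "q \<ge> 1" if "q \<in> paley_orders" for q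
      using that by (auto simp: paley_orders_def Suc_le_eq prime_gt_0_nat)
    have "?A \<subseteq> {..<N} \<union> ?B" by auto
    hence "(\<Sum>q\<in>?A. 1 / real q) \<le> (\<Sum>q\<in>{..<N} \<union> ?B. 1 / real q)"
      by (intro sum_mono2) auto
    also have "\<dots> = (\<Sum>q<N. 1 / real q) + (\<Sum>q\<in>?B. 1 / real q)"
      by (rule sum.union_disjoint) auto
    also have "(\<Sum>q<N. 1 / real q) \<le> (\<Sum>q<N. 1)"
    proof (rule sum_mono)
      fix q show "1 / real q \<le> 1" by (cases q) (auto simp: divide_le_eq_1)
    qed
    also have "(\<Sum>q\<in>?B. 1 / real q) = (\<Sum>z\<le>4*X. \<Sum>q\<in>{q\<in>?B. Z q = z}. 1 / real q)"
    proof (rule sum.group[symmetric])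
      show "Z ` ?B \<subseteq> {..4*X}"
      proof (intro image_subsetI)
        fix q assume q: "q \<in> ?B"
        have "Z q \<le> (Z q)\<^sup>2" by (simp add: power2_eq_square)
        also have "\<dots> \<le> 4 * q" using Z q by simp
        also have "\<dots> \<le> 4 * X" using q by simp
        finally show "Z q \<in> {..4*X}" by simp
      qed
    qed auto
    \<comment> \<open>For \<open>z = 0\<close> the inequality \<open>z^2 \<le> 4 * q\<close> says
      nothing, so that fibre is bounded by \<open>1 / q \<le> 1\<close>.\<close>
    also have "\<dots> \<le> (\<Sum>z\<le>4*X. real D * (if z = 0 then 1 else 4 / (real z)\<^sup>2))"
    proof (rule sum_mono)
      fix z
      let ?F = "{q\<in>?B. Z q = z}"
      have "(\<Sum>q\<in>?F. 1 / real q) \<le> (\<Sum>q\<in>?F. if z = 0 then 1 else 4 / (real z)\<^sup>2)"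
      proof (rule sum_mono)
        fix q assume q: "q \<in> ?F"
        hence q1: "real q \<ge> 1" using pos[of q] by simp
        have "z\<^sup>2 \<le> 4 * q" using Z[of q] q by auto
        hence "(real z)\<^sup>2 \<le> 4 * real q" by (metis of_nat_le_iff of_nat_mult of_nat_numeral of_nat_power)
        thus "1 / real q \<le> (if z = 0 then 1 else 4 / (real z)\<^sup>2)"
          using q1 by (auto simp: field_simps)
      qed
      also have "\<dots> = real (card ?F) * (if z = 0 then 1 else 4 / (real z)\<^sup>2)" by simp
      also have "\<dots> \<le> real D * (if z = 0 then 1 else 4 / (real z)\<^sup>2)"
      proof (rule mult_right_mono)
        have "card ?F \<le> card {q\<in>paley_orders. q \<ge> N \<and> Z q = z}"
          using fib(1) by (intro card_mono) auto
        thus "real (card ?F) \<le> real D" using fib(2)[of z] by simp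
      qed simp
      finally show "(\<Sum>q\<in>?F. 1 / real q) \<le> real D * (if z = 0 then 1 else 4 / (real z)\<^sup>2)" .
    qed
    also have "\<dots> = real D * (\<Sum>z\<le>4*X. if z = 0 then 1 else 4 / (real z)\<^sup>2)"
      by (simp only: sum_distrib_left)
    also have "(\<Sum>z\<le>4*X. if z = 0 then 1 else 4 / (real z)\<^sup>2) = 1 + 4 * (\<Sum>z=1..4*X. 1 / (real z)\<^sup>2)"
    proof -
      have "{..4*X} = insert 0 {1..4*X}" by auto
      hence "(\<Sum>z\<le>4*X. if z = 0 then 1 else 4 / (real z)\<^sup>2) = 
          1 + (\<Sum>z=1..4*X. if z = 0 then 1 else 4 / (real z)\<^sup>2)" by simp
      also have "(\<Sum>z=1..4*X. if z = 0 then 1 else 4 / (real z)\<^sup>2) = (\<Sum>z=1..4*X. 4 * (1 / (real z)\<^sup>2))"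
        by (intro sum.cong) auto
      finally show ?thesis by (simp only: sum_distrib_left)
    qed
    also have "real D * (1 + 4 * (\<Sum>z=1..4*X. 1 / (real z)\<^sup>2)) \<le> real D * 9"
      using sum_inverse_squares_le[of "4*X"] by (intro mult_left_mono) auto
    finally show ?thesis by simp
  qed
  show False using sum_inverse_paley_orders_unbounded[of "real N + 9 * real D"] bound by (meson not_le)
qed

lemma no_third_polynomial:
  assumes \<phi>: "\<And>q. q \<in> paley_orders \<Longrightarrow> q \<ge> N \<Longrightarrow> desc_coeff q (paley_chromatic q) 3 = poly \<phi> (of_nat q)"
  shows False
proof -
  obtain g where g: "\<And>x. c3_poly_part x = poly g x"
    using polynomial_fun_c3 unfolding polynomial_fun_def by blast
  \<comment> \<open>This solves \<open>desc_coeff_3\<close> for the Jacobsthal term, so that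
    \<open>\<psi>\<close> takes the value \<open>q * (q - 1) * (X q)^2\<close> at
    \<open>q\<close>.\<close>
  define \<psi> where "\<psi> = Polynomial.smult 1536 (\<phi> - g)"
  define X where "X q = nat \<bar>paley_prime.jacobsthal q 1\<bar>" for q
  \<comment> \<open>Every nonresidue satisfies the two-squares identity, so an arbitrary one is
    fixed for each \<open>q\<close>.\<close>
  define nr where "nr q = (SOME g. paley_prime.eta q g = -1)" for q
  define Y where "Y q = nat \<bar>paley_prime.jacobsthal q (nr q)\<bar>" for q
  have XY: "(X q)\<^sup>2 + (Y q)\<^sup>2 = 4 * q" if "q \<in> paley_orders" for q
  proof -
    interpret paley_prime q using that by (rule paley_primeI)
    have "eta (nr q) = -1" unfolding nr_def using ex_nonresidue by (rule someI_ex)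
    hence "int ((X q)\<^sup>2 + (Y q)\<^sup>2) = int (4 * q)"
      using jacobsthal_squares by (simp add: X_def Y_def)
    thus ?thesis by (simp only: of_nat_eq_iff)
  qed
  have rel: "of_nat q * (of_nat q - 1) * (of_nat (X q))\<^sup>2 = poly \<psi> (of_nat q)"
    if "q \<in> paley_orders" "q \<ge> N" for q
  proof -
    interpret paley_prime q using that(1) by (rule paley_primeI)
    have "(of_nat (X q) :: rat) = of_int \<bar>jacobsthal 1\<bar>" by (simp add: X_def)
    hence "(of_nat (X q) :: rat)\<^sup>2 = (of_int (jacobsthal 1))\<^sup>2" by simp
    thus ?thesis using \<phi>[OF that] desc_coeff_3 g by (simp add: \<psi>_def field_simps)
  qed
  let ?u = "[:0, -1, 1:] :: rat poly"
  have u: "poly ?u x = x * (x - 1)" for x by (simp add: algebra_simps)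
  show False
  \<comment> \<open>If \<open>\<psi>\<close> is a multiple of \<open>x * (x - 1)\<close>, all values
    \<open>X^2\<close> coincide. Otherwise \<open>\<psi> - z^2 * x * (x - 1)\<close> is nonzero for
    each \<open>z\<close>, and its roots bound the fibre of \<open>X\<close> over
    \<open>z\<close>.\<close>
  proof (cases "\<exists>c. \<psi> = Polynomial.smult c ?u")
    case False
    have sub: "of_nat ` {q\<in>paley_orders. q \<ge> N \<and> X q = z} \<subseteq> {x. poly (\<psi> - Polynomial.smult ((of_nat z)\<^sup>2) ?u) x = 0}" for z
    proof (rule image_subsetI)
      fix q assume "q \<in> {q\<in>paley_orders. q \<ge> N \<and> X q = z}"
      hence "of_nat q * (of_nat q - 1) * (of_nat z)\<^sup>2 = poly \<psi> (of_nat q)" using rel by auto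
      thus "of_nat q \<in> {x. poly (\<psi> - Polynomial.smult ((of_nat z)\<^sup>2) ?u) x = 0}"
        unfolding mem_Collect_eq poly_diff poly_smult u by (simp only: mult.commute diff_self)
    qed
    have nz: "\<psi> - Polynomial.smult ((of_nat z)\<^sup>2) ?u \<noteq> 0" for z :: nat
      using False by auto
    have inj: "inj_on (of_nat :: nat \<Rightarrow> rat) A" for A by (simp add: inj_on_def)
    show False
    proof (rule paley_orders_not_sparse[of N X "max (Polynomial.degree \<psi>) 2"])
      show "(X q)\<^sup>2 \<le> 4 * q" if "q \<in> paley_orders" for q using XY[OF that] by linarith
      fix z
      have fin: "finite {x. poly (\<psi> - Polynomial.smult ((of_nat z)\<^sup>2) ?u) x = 0}" by (rule poly_roots_finite[OF nz])
      show "finite {q\<in>paley_orders. q \<ge> N \<and> X q = z}"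
        using finite_subset[OF sub fin] inj by (rule finite_imageD)
      have "card {q\<in>paley_orders. q \<ge> N \<and> X q = z} \<le> card {x. poly (\<psi> - Polynomial.smult ((of_nat z)\<^sup>2) ?u) x = 0}"
        using card_mono[OF fin sub] by (simp only: card_image[OF inj])
      also have "\<dots> \<le> Polynomial.degree (\<psi> - Polynomial.smult ((of_nat z)\<^sup>2) ?u)"
        by (rule card_poly_roots_bound[OF nz])
      also have "\<dots> \<le> max (Polynomial.degree \<psi>) 2"
        by (rule order.trans[OF degree_diff_le_max]) (auto simp: max_def)
      finally show "card {q\<in>paley_orders. q \<ge> N \<and> X q = z} \<le> max (Polynomial.degree \<psi>) 2" .
    qed
  next
    case True
    then obtain c where c: "\<psi> = Polynomial.smult c ?u" by blast
    have Xc: "(of_nat (X q))\<^sup>2 = c" if "q \<in> paley_orders" "q \<ge> N" for q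
    proof -
      interpret paley_prime q using that(1) by (rule paley_primeI)
      have "of_nat q * (of_nat q - 1) \<noteq> (0 :: rat)" using q_ge_5 by simp
      thus ?thesis using rel[OF that] unfolding c poly_smult u by (simp add: mult.commute[of c])
    qed
    \<comment> \<open>Now \<open>Y^2 = 4 * q - c\<close> recovers \<open>q\<close>, so
      \<open>Y\<close> is an injective label from \<open>N\<close> on.\<close>
    have uniq: "q = q'" if "q \<in> paley_orders" "q \<ge> N" "q' \<in> paley_orders" "q' \<ge> N" "Y q = Y q'" for q q'
    proof -
      have "rat_of_nat ((X q)\<^sup>2) = rat_of_nat ((X q')\<^sup>2)"
        unfolding of_nat_power Xc[OF that(1,2)] Xc[OF that(3,4)] ..
      hence "(X q)\<^sup>2 = (X q')\<^sup>2" by (simp only: of_nat_eq_iff)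
      moreover have "(Y q)\<^sup>2 = (Y q')\<^sup>2" by (simp only: that(5))
      ultimately show ?thesis using XY[OF that(1)] XY[OF that(3)] by linarith
    qed
    have sub: "\<exists>a. {q\<in>paley_orders. q \<ge> N \<and> Y q = z} \<subseteq> {a}" for z
    proof (cases "\<exists>a. a \<in> {q\<in>paley_orders. q \<ge> N \<and> Y q = z}")
      case True
      then obtain a where a: "a \<in> paley_orders" "a \<ge> N" "Y a = z" by blast
      have "{q\<in>paley_orders. q \<ge> N \<and> Y q = z} \<subseteq> {a}"
        using uniq[OF _ _ a(1,2)] a(3) by simp blast
      thus ?thesis ..
    qed blast
    show False
    proof (rule paley_orders_not_sparse[of N Y 1])
      show "(Y q)\<^sup>2 \<le> 4 * q" if "q \<in> paley_orders" for q using XY[OF that] by linarith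
      fix z
      obtain a where a: "{q\<in>paley_orders. q \<ge> N \<and> Y q = z} \<subseteq> {a}" using sub by blast
      show "finite {q\<in>paley_orders. q \<ge> N \<and> Y q = z}" using a by (rule finite_subset) simp
      show "card {q\<in>paley_orders. q \<ge> N \<and> Y q = z} \<le> 1" using card_mono[OF _ a] by simp
    qed
  qed
qed

lemma ex_polynomials:
  "\<exists>\<phi> :: nat \<Rightarrow> rat poly. \<forall>q\<in>paley_orders. \<forall>r\<le>2. desc_coeff q (paley_chromatic q) r = poly (\<phi> r) (of_nat q)"
proof -
  have "polynomial_fun (\<lambda>x. - (x * (x - 1) / 2) + x * (x - 1) / 4)" by (intro polynomial_fun_intros)
  then obtain \<phi>1 where 1: "\<And>x::rat. - (x * (x - 1) / 2) + x * (x - 1) / 4 = poly \<phi>1 x"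
    unfolding polynomial_fun_def by blast
  have "polynomial_fun (\<lambda>x. x * (x - 1) * (x - 2) * (3 * x - 1) / 24 + x * (x - 1) / 4 * (- ((x - 1) * (x - 2) / 2)) + 
    (x * (x - 1) / 4 * ((x - 5) / 4) / 3 + x * (x - 1) / 4 * (x * (x - 1) / 4 - 2 * ((x - 1) / 2) + 1) / 2))"
    by (intro polynomial_fun_intros)
  then obtain \<phi>2 where 2: "\<And>x::rat. x * (x - 1) * (x - 2) * (3 * x - 1) / 24 + x * (x - 1) / 4 * (- ((x - 1) * (x - 2) / 2)) + 
    (x * (x - 1) / 4 * ((x - 5) / 4) / 3 + x * (x - 1) / 4 * (x * (x - 1) / 4 - 2 * ((x - 1) / 2) + 1) / 2) = poly \<phi>2 x"
    unfolding polynomial_fun_def by blast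
  define \<phi> where "\<phi> r = (if r = 0 then 1 else if r = 1 then \<phi>1 else \<phi>2)" for r :: nat
  show ?thesis
  proof (intro exI[of _ \<phi>] ballI allI impI)
    fix q r assume q: "q \<in> paley_orders" and r: "r \<le> (2::nat)"
    interpret paley_prime q using q by (rule paley_primeI)
    have "r = 0 \<or> r = 1 \<or> r = 2" using r by linarith
    thus "desc_coeff q (paley_chromatic q) r = poly (\<phi> r) (of_nat q)"
      using desc_coeff_0 desc_coeff_1 desc_coeff_2 unfolding 1 2 by (auto simp: \<phi>_def)
  qed
qed

theorem theorem2p9:
  shows "two_level_polynomial paley_orders [:0, 1:] (\<lambda>_. 2) paley_chromatic \<and>
    (\<exists>\<phi>\<^sub>0 \<phi>\<^sub>1 \<phi>\<^sub>2 :: rat poly. \<forall>q\<in>paley_orders.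
       desc_coeff q (paley_chromatic q) 0 = poly \<phi>\<^sub>0 (of_nat q) \<and>
       desc_coeff q (paley_chromatic q) 1 = poly \<phi>\<^sub>1 (of_nat q) \<and>
       desc_coeff q (paley_chromatic q) 2 = poly \<phi>\<^sub>2 (of_nat q)) \<and>
    \<not> (\<exists>\<phi>\<^sub>3 :: rat poly. \<exists>N. \<forall>q\<in>paley_orders. q \<ge> N \<longrightarrow>
       desc_coeff q (paley_chromatic q) 3 = poly \<phi>\<^sub>3 (of_nat q))"
proof -
  obtain \<phi> :: "nat \<Rightarrow> rat poly" where \<phi>: "\<And>q r. q \<in> paley_orders \<Longrightarrow> r \<le> 2 \<Longrightarrow>
      desc_coeff q (paley_chromatic q) r = poly (\<phi> r) (of_nat q)"
    using ex_polynomials by blast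
  have deg: "paley_chromatic q \<noteq> 0" "Polynomial.degree (paley_chromatic q) = q" if "q \<in> paley_orders" for q
    using paley_prime.degree_paley_chromatic[OF paley_primeI[OF that]] .
  have e2: "(2 :: ereal) = ereal (real 2)" by simp
  have two: "ereal (real r) \<le> 2 \<longleftrightarrow> r \<le> 2" for r
    unfolding e2 by (simp only: ereal_less_eq of_nat_le_iff)
  have "(2 :: ereal) \<in> range (\<lambda>k::nat. ereal (real k))" unfolding e2 by blast
  hence "two_level_polynomial paley_orders [:0, 1:] (\<lambda>_. 2) paley_chromatic"
    unfolding two_level_polynomial_def
    using infinite_paley_orders deg \<phi> by (auto simp: two intro!: exI[of _ \<phi>])
  moreover have "\<exists>\<phi>\<^sub>0 \<phi>\<^sub>1 \<phi>\<^sub>2 :: rat poly. \<forall>q\<in>paley_orders.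
       desc_coeff q (paley_chromatic q) 0 = poly \<phi>\<^sub>0 (of_nat q) \<and>
       desc_coeff q (paley_chromatic q) 1 = poly \<phi>\<^sub>1 (of_nat q) \<and>
       desc_coeff q (paley_chromatic q) 2 = poly \<phi>\<^sub>2 (of_nat q)"
    by (rule exI[of _ "\<phi> 0"], rule exI[of _ "\<phi> 1"], rule exI[of _ "\<phi> 2"]) (simp add: \<phi>)
  moreover have "\<not> (\<exists>\<phi>\<^sub>3 :: rat poly. \<exists>N. \<forall>q\<in>paley_orders. q \<ge> N \<longrightarrow>
       desc_coeff q (paley_chromatic q) 3 = poly \<phi>\<^sub>3 (of_nat q))"
    using no_third_polynomial by blast
  ultimately show ?thesis by blast
qed

end
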